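(* Let $(X,\|\cdot\|,\tau)$ be a sequentially complete C-sequential Saks space with mixed topology $\gamma$, and for each $n\in\mathbb N$ let $(S_n(t))_{t\ge0}$ be a locally $\tau$-bi-continuous semigroup on $X$ with bi-generator $A_n$ such that $(S_n(t))_{n\in\mathbb N,t\ge0}$ is uniformly locally bi-equicontinuous. Let $\omega\in\mathbb R$ and $M\ge1$ be such that $\|S_n(t)\|_{\mathcal L(X)}\le Me^{\omega t}$ for all $t\ge0$ and $n\in\mathbb N$, and let $\lambda>\omega$. Consider the following assertions. (a) There exist a bi-densely defined linear operator $(A,D(A))$ and a bi-core $D\subseteq\bigcup_{k=1}^\infty\bigcap_{n=k}^\infty D(A_n)$ for $A$ such that $(A_nx)_{n\in\mathbb N}$ is $\|\cdot\|$-bounded and $A_nx\to Ax$ w.r.t. $\tau$ for all $x\in D$, and $\lambda-A$ has bi-dense range. (b) There exist a $\gamma$-densely defined linear operator $(A,D(A))$ and a $\gamma$-core $D\subseteq\bigcup_{k=1}^\infty\bigcap_{n=k}^\infty D(A_n)$ for $A$ such that $A_nx\to Ax$ w.r.t. $\gamma$ for all $x\in D$, and $\lambda-A$ has $\gamma$-dense range. (c) There exists $R\in\mathcal L(X)$ such that $R(\lambda,A_n)x\to Rx$ w.r.t. $\tau$ for all $x\in X$, and $R$ is injective and has bi-dense range. (d) There exists $R\in\mathcal L(X,\gamma)$ such that $R(\lambda,A_n)x\to Rx$ w.r.t. $\gamma$ for all $x\in X$, and $R$ is injective and has $\gamma$-dense range. (e) There exists a locally $\tau$-bi-continuous semigroup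 $(S(t))_{t\ge0}$ on $X$ such that $\|S(t)\|_{\mathcal L(X)}\le Me^{\omega t}$ for all $t\ge0$, and for all $x\in X$ we have $S_n(\cdot)x\to S(\cdot)x$ w.r.t. $\tau$ uniformly on compact subsets of $[0,\infty)$. Then (a)$\Rightarrow$(b)$\Rightarrow$(c)$\Leftrightarrow$(d)$\Leftrightarrow$(e). In particular, if (c) holds, then the bi-generator $B$ of $(S(t))_{t\ge0}$ fulfils $R(\lambda,B)=R$. If (b) holds, then $A$ is $\gamma$-closable and $B=\overline A^{\gamma}$. If (a) holds, then $B=\overline A^{\mathrm{bi}}$.
   Context: Linear spaces are over $\mathbb R$ or $\mathbb C$; $\mathbb N=\{1,2,\dots\}$. For a normed space $(X,\|\cdot\|)$, $\tau_{\|\cdot\|}$ is the norm topology and $\mathcal L(X)$ the bounded linear operators with the operator norm; $\mathcal L(X,\gamma)$ is the space of $\gamma$-continuous linear maps $X\to X$. $R(\lambda,A):=(\lambda-A)^{-1}$ denotes the resolvent of $A$. Saks space: a triple $(X,\|\cdot\|,\tau)$ where $(X,\|\cdot\|)$ is a normed space and $\tau\subseteq\tau_{\|\cdot\|}$ is a Hausdorff locally convex topology on $X$ such that some directed system of seminorms $\mathcal P_\tau$ generating $\tau$ satisfies $\|x\|=\sup_{p\in\mathcal P_\tau}p(x)$ for all $x\in X$. Its mixed topology $\gamma$ is the finest linear topology on $X$ that coincides with $\tau$ on $\|\cdot\|$-bounded sets and satisfies $\tau\subseteq\gamma\subseteq\tau_{\|\cdot\|}$; it is Hausdorff locally convex.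 The Saks space is sequentially complete if $(X,\gamma)$ is sequentially complete, and C-sequential if $(X,\gamma)$ is C-sequential, i.e. every convex sequentially open subset of $(X,\gamma)$ is open ($U$ is sequentially open if every sequence converging to a point of $U$ is eventually in $U$). A family $(T_j)_{j\in J}$ of linear maps $X\to X$ is bi-equicontinuous if for every $\|\cdot\|$-bounded sequence $(x_n)$ in $X$ and $x\in X$ with $x_n\to x$ w.r.t. $\tau$ one has $\tau$-$\lim_{n\to\infty}T_j(x_n-x)=0$ uniformly for $j\in J$. $(S_n(t))_{n\in\mathbb N,t\ge0}$ is uniformly locally bi-equicontinuous if $(S_n(t))_{(n,t)\in\mathbb N\times N}$ is bi-equicontinuous for every compact $N\subseteq[0,\infty)$. A semigroup $(S(t))_{t\ge0}$ on $X$ consists of linear maps with $S(0)=\mathrm{id}$, $S(t)S(s)=S(t+s)$. It is locally $\tau$-bi-continuous if all $S(t)\in\mathcal L(X)$, $t\mapsto S(t)x$ is $\tau$-continuous for every $x\in X$, and for every compact $N\subseteq[0,\infty)$ one has $\sup_{t\in N}\|S(t)\|_{\mathcal L(X)}<\infty$ and $(S(t))_{t\in N}$ is bi-equicontinuous. Its bi-generator is the operator $Bx:=\tau\text{-}\lim_{t\to0+}\frac1t(S(t)x-x)$ with domain the set of all $x\in X$ such that this limit exists and $\sup_{t\in(0,1]}\frac1t\|S(t)x-x\|<\infty$. Let $(A,D(A))$ be a linear operator on $X$ and $D$ a linear subspace of $D(A)$. A set $N\subseteq X$ is bi-dense if for every $x\in X$ there is a $\|\cdot\|$-bounded sequence in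 $N$ converging to $x$ w.r.t. $\tau$; $A$ is bi-densely (resp. $\gamma$-densely) defined if $D(A)$ is bi-dense (resp. $\gamma$-dense) in $X$. $A$ is bi-closed if for each sequence $(x_i)$ in $D(A)$ with $(x_i)$, $(Ax_i)$ $\|\cdot\|$-bounded and $x_i\to x$, $Ax_i\to y$ w.r.t. $\tau$ one has $x\in D(A)$, $Ax=y$; $A$ is $\gamma$-closed if its graph is closed in $(X,\gamma)\times(X,\gamma)$. $A$ is bi-closable (resp. $\gamma$-closable) if it has a bi-closed (resp. $\gamma$-closed) extension, and then $\overline A^{\mathrm{bi}}$ (resp. $\overline A^{\gamma}$) denotes the smallest such extension. $D$ is a bi-core for $A$ if for all $x\in D(A)$ there is a sequence $(x_i)$ in $D$ with $(x_i)$, $(Ax_i)$ $\|\cdot\|$-bounded and $x_i\to x$ w.r.t. the topology on $D(A)$ given by the seminorms $x\mapsto p(x)+p(Ax)$, $p\in\mathcal P_\tau$. $D$ is a $\gamma$-core for $A$ if $D$ is dense in $D(A)$ w.r.t. the topology given by the seminorms $x\mapsto p(x)+p(Ax)$, $p$ running through a system of seminorms generating $\gamma$. *)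

theory Defs
  imports "HOL-Analysis.Analysis"
begin

text \<open>
  The scalar field is a type of class \<^class>\<open>real_normed_field\<close>; by Gelfand--Mazur the instances of
  this class are, up to isometric isomorphism, exactly the real and the complex numbers. The type
  class \<^class>\<open>real_normed_vector\<close> provides the norm and the underlying real structure of the space.
\<close>

locale normed_space = vector_space scal
  for scal :: "'k::real_normed_field \<Rightarrow> 'a::real_normed_vector \<Rightarrow> 'a" +
  assumes scal_of_real: "scal (of_real r) x = r *\<^sub>R x"
    and norm_scal: "norm (scal c x) = norm c * norm x"

definition linear_topology ::
    "('k::real_normed_field \<Rightarrow> 'a::real_normed_vector \<Rightarrow> 'a) \<Rightarrow> 'a topology \<Rightarrow> bool" where
  "linear_topology scal \<sigma> \<longleftrightarrow> topspace \<sigma> = UNIV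
     \<and> continuous_map (prod_topology \<sigma> \<sigma>) \<sigma> (\<lambda>(x, y). x + y)
     \<and> continuous_map (prod_topology euclidean \<sigma>) \<sigma> (\<lambda>(c, x). scal c x)"

definition is_seminorm ::
    "('k::real_normed_field \<Rightarrow> 'a::real_normed_vector \<Rightarrow> 'a) \<Rightarrow> ('a \<Rightarrow> real) \<Rightarrow> bool" where
  "is_seminorm scal p \<longleftrightarrow>
     (\<forall>x y. p (x + y) \<le> p x + p y) \<and> (\<forall>c x. p (scal c x) = norm c * p x)"

text \<open>The topology on the linear subspace \<open>V\<close> given by seminorms that need only be defined on \<open>V\<close>.\<close>

definition seminorm_topology :: "'a::real_normed_vector set \<Rightarrow> ('a \<Rightarrow> real) set \<Rightarrow> 'a topology" where
  "seminorm_topology V P =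
     topology_generated_by (insert V {{y \<in> V. p (y - x) < r} | p x r. p \<in> P \<and> x \<in> V \<and> 0 < r})"

definition generates ::
    "('k::real_normed_field \<Rightarrow> 'a::real_normed_vector \<Rightarrow> 'a) \<Rightarrow> ('a \<Rightarrow> real) set \<Rightarrow> 'a topology \<Rightarrow> bool" where
  "generates scal P \<sigma> \<longleftrightarrow> (\<forall>p\<in>P. is_seminorm scal p) \<and> \<sigma> = seminorm_topology UNIV P"

definition directed_seminorms :: "('a \<Rightarrow> real) set \<Rightarrow> bool" where
  "directed_seminorms P \<longleftrightarrow> P \<noteq> {}
     \<and> (\<forall>p\<in>P. \<forall>q\<in>P. \<exists>r\<in>P. \<exists>C\<ge>0. \<forall>x. max (p x) (q x) \<le> C * r x)"

text \<open>
  \<open>P\<close> is the system of seminorms chosen for the Saks space. That \<open>\<tau>\<close> is locally convex is contained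
  in its being generated by \<open>P\<close>. The boundedness clause makes the real-valued supremum genuine.
\<close>

definition saks_space ::
    "('k::real_normed_field \<Rightarrow> 'a::real_normed_vector \<Rightarrow> 'a) \<Rightarrow> 'a topology \<Rightarrow> ('a \<Rightarrow> real) set \<Rightarrow> bool" where
  "saks_space scal \<tau> P \<longleftrightarrow> normed_space scal
     \<and> Hausdorff_space \<tau> \<and> (\<forall>U. openin \<tau> U \<longrightarrow> open U)
     \<and> directed_seminorms P \<and> generates scal P \<tau>
     \<and> (\<forall>x. bdd_above ((\<lambda>p. p x) ` P) \<and> norm x = (SUP p\<in>P. p x))"

definition mixed_candidate ::
    "('k::real_normed_field \<Rightarrow> 'a::real_normed_vector \<Rightarrow> 'a) \<Rightarrow> 'a topology \<Rightarrow> 'a topology \<Rightarrow> bool" where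
  "mixed_candidate scal \<tau> \<sigma> \<longleftrightarrow> linear_topology scal \<sigma>
     \<and> (\<forall>Z. bounded Z \<longrightarrow> subtopology \<sigma> Z = subtopology \<tau> Z)
     \<and> (\<forall>U. openin \<tau> U \<longrightarrow> openin \<sigma> U) \<and> (\<forall>U. openin \<sigma> U \<longrightarrow> open U)"

definition is_mixed_topology ::
    "('k::real_normed_field \<Rightarrow> 'a::real_normed_vector \<Rightarrow> 'a) \<Rightarrow> 'a topology \<Rightarrow> 'a topology \<Rightarrow> bool" where
  "is_mixed_topology scal \<tau> \<gamma> \<longleftrightarrow> mixed_candidate scal \<tau> \<gamma>
     \<and> (\<forall>\<sigma>. mixed_candidate scal \<tau> \<sigma> \<longrightarrow> (\<forall>U. openin \<sigma> U \<longrightarrow> openin \<gamma> U))"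

definition sequentially_complete :: "'a::real_normed_vector topology \<Rightarrow> bool" where
  "sequentially_complete \<gamma> \<longleftrightarrow>
     (\<forall>x :: nat \<Rightarrow> 'a.
        (\<forall>U. openin \<gamma> U \<and> 0 \<in> U \<longrightarrow> (\<exists>N. \<forall>m\<ge>N. \<forall>n\<ge>N. x m - x n \<in> U))
        \<longrightarrow> (\<exists>l. limitin \<gamma> x l sequentially))"

definition sequentially_open :: "'a topology \<Rightarrow> 'a set \<Rightarrow> bool" where
  "sequentially_open \<gamma> U \<longleftrightarrow>
     (\<forall>x\<in>U. \<forall>s. limitin \<gamma> s x sequentially \<longrightarrow> (\<forall>\<^sub>F n in sequentially. s n \<in> U))"

definition C_sequential :: "'a::real_normed_vector topology \<Rightarrow> bool" where
  "C_sequential \<gamma> \<longleftrightarrow> (\<forall>U. convex U \<and> sequentially_open \<gamma> U \<longrightarrow> openin \<gamma> U)"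

definition bounded_operator ::
    "('k::real_normed_field \<Rightarrow> 'a::real_normed_vector \<Rightarrow> 'a) \<Rightarrow> ('a \<Rightarrow> 'a) \<Rightarrow> bool" where
  "bounded_operator scal T \<longleftrightarrow> Vector_Spaces.linear scal scal T \<and> bounded_linear T"

definition continuous_operator ::
    "('k::real_normed_field \<Rightarrow> 'a::real_normed_vector \<Rightarrow> 'a) \<Rightarrow> 'a topology \<Rightarrow> ('a \<Rightarrow> 'a) \<Rightarrow> bool" where
  "continuous_operator scal \<gamma> T \<longleftrightarrow> Vector_Spaces.linear scal scal T \<and> continuous_map \<gamma> \<gamma> T"

definition bi_equicontinuous ::
    "'a::real_normed_vector topology \<Rightarrow> 'j set \<Rightarrow> ('j \<Rightarrow> 'a \<Rightarrow> 'a) \<Rightarrow> bool" where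
  "bi_equicontinuous \<tau> J T \<longleftrightarrow>
     (\<forall>(s :: nat \<Rightarrow> 'a) x. bounded (range s) \<and> limitin \<tau> s x sequentially \<longrightarrow>
        (\<forall>U. openin \<tau> U \<and> 0 \<in> U \<longrightarrow> (\<forall>\<^sub>F n in sequentially. \<forall>j\<in>J. T j (s n - x) \<in> U)))"

definition uniformly_locally_bi_equicontinuous ::
    "'a::real_normed_vector topology \<Rightarrow> (nat \<Rightarrow> real \<Rightarrow> 'a \<Rightarrow> 'a) \<Rightarrow> bool" where
  "uniformly_locally_bi_equicontinuous \<tau> S \<longleftrightarrow>
     (\<forall>N. compact N \<and> N \<subseteq> {0..} \<longrightarrow> bi_equicontinuous \<tau> (UNIV \<times> N) (\<lambda>(n, t). S n t))"

text \<open>A semigroup is a function on all of \<^typ>\<open>real\<close> whose values at negative times are irrelevant.\<close>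

definition operator_semigroup ::
    "('k::real_normed_field \<Rightarrow> 'a::real_normed_vector \<Rightarrow> 'a) \<Rightarrow> (real \<Rightarrow> 'a \<Rightarrow> 'a) \<Rightarrow> bool" where
  "operator_semigroup scal S \<longleftrightarrow> (\<forall>t\<ge>0. Vector_Spaces.linear scal scal (S t))
     \<and> S 0 = id \<and> (\<forall>t\<ge>0. \<forall>s\<ge>0. S t \<circ> S s = S (t + s))"

definition locally_bi_continuous_semigroup ::
    "('k::real_normed_field \<Rightarrow> 'a::real_normed_vector \<Rightarrow> 'a) \<Rightarrow> 'a topology \<Rightarrow> (real \<Rightarrow> 'a \<Rightarrow> 'a) \<Rightarrow> bool" where
  "locally_bi_continuous_semigroup scal \<tau> S \<longleftrightarrow> operator_semigroup scal S
     \<and> (\<forall>t\<ge>0. bounded_operator scal (S t))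
     \<and> (\<forall>x. continuous_map (top_of_set {0..}) \<tau> (\<lambda>t. S t x))
     \<and> (\<forall>N. compact N \<and> N \<subseteq> {0..} \<longrightarrow>
          bdd_above ((\<lambda>t. onorm (S t)) ` N) \<and> bi_equicontinuous \<tau> N S)"

text \<open>
  An operator \<open>(A, D(A))\<close> is a partial map \<open>A\<close> with \<open>D(A) = dom A\<close>, so that equality of operators is
  equality of maps and \<open>A \<subseteq>\<^sub>m C\<close> says that \<open>C\<close> extends \<open>A\<close>.
\<close>

definition linear_operator ::
    "('k::real_normed_field \<Rightarrow> 'a::real_normed_vector \<Rightarrow> 'a) \<Rightarrow> ('a \<rightharpoonup> 'a) \<Rightarrow> bool" where
  "linear_operator scal A \<longleftrightarrow> module.subspace scal (dom A)
     \<and> (\<forall>x\<in>dom A. \<forall>y\<in>dom A. the (A (x + y)) = the (A x) + the (A y))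
     \<and> (\<forall>c. \<forall>x\<in>dom A. the (A (scal c x)) = scal c (the (A x)))"

definition bi_generator ::
    "'a::real_normed_vector topology \<Rightarrow> (real \<Rightarrow> 'a \<Rightarrow> 'a) \<Rightarrow> ('a \<rightharpoonup> 'a)" where
  "bi_generator \<tau> S = (\<lambda>x.
     if (\<exists>y. limitin \<tau> (\<lambda>t. (1 / t) *\<^sub>R (S t x - x)) y (at_right 0))
        \<and> bdd_above ((\<lambda>t. (1 / t) * norm (S t x - x)) ` {0<..1})
     then Some (THE y. limitin \<tau> (\<lambda>t. (1 / t) *\<^sub>R (S t x - x)) y (at_right 0))
     else None)"

definition shifted ::
    "('k::real_normed_field \<Rightarrow> 'a::real_normed_vector \<Rightarrow> 'a) \<Rightarrow> 'k \<Rightarrow> ('a \<rightharpoonup> 'a) \<Rightarrow> 'a \<Rightarrow> 'a" where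
  "shifted scal l A x = scal l x - the (A x)"

definition resolvent ::
    "('k::real_normed_field \<Rightarrow> 'a::real_normed_vector \<Rightarrow> 'a) \<Rightarrow> 'k \<Rightarrow> ('a \<rightharpoonup> 'a) \<Rightarrow> 'a \<Rightarrow> 'a" where
  "resolvent scal l A = inv_into (dom A) (shifted scal l A)"

definition resolvent_set ::
    "('k::real_normed_field \<Rightarrow> 'a::real_normed_vector \<Rightarrow> 'a) \<Rightarrow> ('a \<rightharpoonup> 'a) \<Rightarrow> 'k set" where
  "resolvent_set scal A =
     {l. bij_betw (shifted scal l A) (dom A) UNIV \<and> bounded_operator scal (resolvent scal l A)}"

definition bi_dense :: "'a::real_normed_vector topology \<Rightarrow> 'a set \<Rightarrow> bool" where
  "bi_dense \<tau> N \<longleftrightarrow>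
     (\<forall>x. \<exists>s :: nat \<Rightarrow> 'a. range s \<subseteq> N \<and> bounded (range s) \<and> limitin \<tau> s x sequentially)"

definition dense_in_topology :: "'a topology \<Rightarrow> 'a set \<Rightarrow> bool" where
  "dense_in_topology \<sigma> N \<longleftrightarrow> \<sigma> closure_of N = topspace \<sigma>"

definition bi_closed :: "'a::real_normed_vector topology \<Rightarrow> ('a \<rightharpoonup> 'a) \<Rightarrow> bool" where
  "bi_closed \<tau> A \<longleftrightarrow>
     (\<forall>(s :: nat \<Rightarrow> 'a) x y. range s \<subseteq> dom A \<and> bounded (range s)
        \<and> bounded (range (\<lambda>i. the (A (s i))))
        \<and> limitin \<tau> s x sequentially \<and> limitin \<tau> (\<lambda>i. the (A (s i))) y sequentially
        \<longrightarrow> x \<in> dom A \<and> the (A x) = y)"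

definition gamma_closed :: "'a topology \<Rightarrow> ('a \<rightharpoonup> 'a) \<Rightarrow> bool" where
  "gamma_closed \<gamma> A \<longleftrightarrow> closedin (prod_topology \<gamma> \<gamma>) (Map.graph A)"

definition gamma_closable ::
    "('k::real_normed_field \<Rightarrow> 'a::real_normed_vector \<Rightarrow> 'a) \<Rightarrow> 'a topology \<Rightarrow> ('a \<rightharpoonup> 'a) \<Rightarrow> bool" where
  "gamma_closable scal \<gamma> A \<longleftrightarrow> (\<exists>C. linear_operator scal C \<and> gamma_closed \<gamma> C \<and> A \<subseteq>\<^sub>m C)"

definition smallest_extension :: "(('a \<rightharpoonup> 'a) \<Rightarrow> bool) \<Rightarrow> ('a \<rightharpoonup> 'a) \<Rightarrow> ('a \<rightharpoonup> 'a) \<Rightarrow> bool" where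
  "smallest_extension Q A C \<longleftrightarrow> Q C \<and> A \<subseteq>\<^sub>m C \<and> (\<forall>C'. Q C' \<and> A \<subseteq>\<^sub>m C' \<longrightarrow> C \<subseteq>\<^sub>m C')"

text \<open>The closures are relations (the second operator is the closure of the first), so that a
  statement about a closure includes its existence.\<close>

definition is_bi_closure ::
    "('k::real_normed_field \<Rightarrow> 'a::real_normed_vector \<Rightarrow> 'a) \<Rightarrow> 'a topology \<Rightarrow> ('a \<rightharpoonup> 'a) \<Rightarrow> ('a \<rightharpoonup> 'a) \<Rightarrow> bool" where
  "is_bi_closure scal \<tau> = smallest_extension (\<lambda>C. linear_operator scal C \<and> bi_closed \<tau> C)"

definition is_gamma_closure ::
    "('k::real_normed_field \<Rightarrow> 'a::real_normed_vector \<Rightarrow> 'a) \<Rightarrow> 'a topology \<Rightarrow> ('a \<rightharpoonup> 'a) \<Rightarrow> ('a \<rightharpoonup> 'a) \<Rightarrow> bool" where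
  "is_gamma_closure scal \<gamma> = smallest_extension (\<lambda>C. linear_operator scal C \<and> gamma_closed \<gamma> C)"

definition graph_topology :: "('a::real_normed_vector \<Rightarrow> real) set \<Rightarrow> ('a \<rightharpoonup> 'a) \<Rightarrow> 'a topology" where
  "graph_topology P A = seminorm_topology (dom A) ((\<lambda>p x. p x + p (the (A x))) ` P)"

definition bi_core ::
    "('k::real_normed_field \<Rightarrow> 'a::real_normed_vector \<Rightarrow> 'a) \<Rightarrow> ('a \<Rightarrow> real) set \<Rightarrow> ('a \<rightharpoonup> 'a) \<Rightarrow> 'a set \<Rightarrow> bool" where
  "bi_core scal P A D \<longleftrightarrow> module.subspace scal D \<and> D \<subseteq> dom A
     \<and> (\<forall>x\<in>dom A. \<exists>s :: nat \<Rightarrow> 'a. range s \<subseteq> D \<and> bounded (range s)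
          \<and> bounded (range (\<lambda>i. the (A (s i)))) \<and> limitin (graph_topology P A) s x sequentially)"

definition gamma_core ::
    "('k::real_normed_field \<Rightarrow> 'a::real_normed_vector \<Rightarrow> 'a) \<Rightarrow> 'a topology \<Rightarrow> ('a \<rightharpoonup> 'a) \<Rightarrow> 'a set \<Rightarrow> bool" where
  "gamma_core scal \<gamma> A D \<longleftrightarrow> module.subspace scal D \<and> D \<subseteq> dom A
     \<and> (\<exists>G. generates scal G \<gamma> \<and> dense_in_topology (graph_topology G A) D)"

text \<open>
  The five assertions, for the sequence \<open>A\<close> of generators and with their existentially quantified
  objects as the last arguments. For \<open>x \<in> D\<close> the value \<open>A n x\<close> is defined for almost all \<open>n\<close> only.
  The resolvent-set conjuncts spell out the presupposition that the resolvents of \<open>A n\<close> exist.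
\<close>

definition assertion_a ::
    "('k::real_normed_field \<Rightarrow> 'a::real_normed_vector \<Rightarrow> 'a) \<Rightarrow> 'a topology \<Rightarrow> ('a \<Rightarrow> real) set
      \<Rightarrow> (nat \<Rightarrow> ('a \<rightharpoonup> 'a)) \<Rightarrow> real \<Rightarrow> ('a \<rightharpoonup> 'a) \<Rightarrow> 'a set \<Rightarrow> bool" where
  "assertion_a scal \<tau> P A l A\<^sub>0 D \<longleftrightarrow> linear_operator scal A\<^sub>0 \<and> bi_dense \<tau> (dom A\<^sub>0)
     \<and> bi_core scal P A\<^sub>0 D \<and> D \<subseteq> (\<Union>k. \<Inter>n\<in>{k..}. dom (A n))
     \<and> (\<forall>x\<in>D. bounded {the (A n x) | n. x \<in> dom (A n)}
          \<and> limitin \<tau> (\<lambda>n. the (A n x)) (the (A\<^sub>0 x)) sequentially)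
     \<and> bi_dense \<tau> (shifted scal (of_real l) A\<^sub>0 ` dom A\<^sub>0)"

definition assertion_b ::
    "('k::real_normed_field \<Rightarrow> 'a::real_normed_vector \<Rightarrow> 'a) \<Rightarrow> 'a topology
      \<Rightarrow> (nat \<Rightarrow> ('a \<rightharpoonup> 'a)) \<Rightarrow> real \<Rightarrow> ('a \<rightharpoonup> 'a) \<Rightarrow> 'a set \<Rightarrow> bool" where
  "assertion_b scal \<gamma> A l A\<^sub>0 D \<longleftrightarrow> linear_operator scal A\<^sub>0 \<and> dense_in_topology \<gamma> (dom A\<^sub>0)
     \<and> gamma_core scal \<gamma> A\<^sub>0 D \<and> D \<subseteq> (\<Union>k. \<Inter>n\<in>{k..}. dom (A n))
     \<and> (\<forall>x\<in>D. limitin \<gamma> (\<lambda>n. the (A n x)) (the (A\<^sub>0 x)) sequentially)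
     \<and> dense_in_topology \<gamma> (shifted scal (of_real l) A\<^sub>0 ` dom A\<^sub>0)"

definition assertion_c ::
    "('k::real_normed_field \<Rightarrow> 'a::real_normed_vector \<Rightarrow> 'a) \<Rightarrow> 'a topology
      \<Rightarrow> (nat \<Rightarrow> ('a \<rightharpoonup> 'a)) \<Rightarrow> real \<Rightarrow> ('a \<Rightarrow> 'a) \<Rightarrow> bool" where
  "assertion_c scal \<tau> A l R \<longleftrightarrow> bounded_operator scal R
     \<and> (\<forall>n. of_real l \<in> resolvent_set scal (A n))
     \<and> (\<forall>x. limitin \<tau> (\<lambda>n. resolvent scal (of_real l) (A n) x) (R x) sequentially)
     \<and> inj R \<and> bi_dense \<tau> (range R)"

definition assertion_d ::
    "('k::real_normed_field \<Rightarrow> 'a::real_normed_vector \<Rightarrow> 'a) \<Rightarrow> 'a topology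
      \<Rightarrow> (nat \<Rightarrow> ('a \<rightharpoonup> 'a)) \<Rightarrow> real \<Rightarrow> ('a \<Rightarrow> 'a) \<Rightarrow> bool" where
  "assertion_d scal \<gamma> A l R \<longleftrightarrow> continuous_operator scal \<gamma> R
     \<and> (\<forall>n. of_real l \<in> resolvent_set scal (A n))
     \<and> (\<forall>x. limitin \<gamma> (\<lambda>n. resolvent scal (of_real l) (A n) x) (R x) sequentially)
     \<and> inj R \<and> dense_in_topology \<gamma> (range R)"

definition assertion_e ::
    "('k::real_normed_field \<Rightarrow> 'a::real_normed_vector \<Rightarrow> 'a) \<Rightarrow> 'a topology
      \<Rightarrow> (nat \<Rightarrow> real \<Rightarrow> 'a \<Rightarrow> 'a) \<Rightarrow> real \<Rightarrow> real \<Rightarrow> (real \<Rightarrow> 'a \<Rightarrow> 'a) \<Rightarrow> bool" where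
  "assertion_e scal \<tau> S M \<omega> S\<^sub>0 \<longleftrightarrow> locally_bi_continuous_semigroup scal \<tau> S\<^sub>0
     \<and> (\<forall>t\<ge>0. onorm (S\<^sub>0 t) \<le> M * exp (\<omega> * t))
     \<and> (\<forall>x N. compact N \<and> N \<subseteq> {0..} \<longrightarrow>
          (\<forall>U. openin \<tau> U \<and> 0 \<in> U \<longrightarrow>
            (\<forall>\<^sub>F n in sequentially. \<forall>t\<in>N. S n t x - S\<^sub>0 t x \<in> U)))"

end

theory Submission
  imports Defs "HOL-Real_Asymp.Real_Asymp"
begin

text \<open>
  The mixed topology \<open>\<gamma>\<close> is generated by the set \<open>G\<close> of all seminorms whose restrictions to norm-bounded
  sets are \<open>\<tau>\<close>-continuous at 0. As the space is C-sequential, \<open>G\<close> contains every seminorm that tends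
  to 0 along norm-bounded \<open>\<tau>\<close>-null sequences; hence bi-equicontinuous families are \<open>\<gamma>\<close>-equicontinuous, and
  the \<open>\<gamma>\<close>-convergent sequences are exactly the norm-bounded \<open>\<tau>\<close>-convergent ones. After rescaling to
  \<open>T(t) = e\<^sup>-\<^sup>\<omega>\<^sup>t S(t)\<close> the resolvents are Laplace transforms, defined by means of primitives in
  \<open>\<gamma>\<close>, for which all estimates follow from a mean value inequality for each seminorm in \<open>G\<close>.

  If the resolvents at \<open>\<lambda>\<close> converge to \<open>R\<close> with dense range, then by the resolvent identity they converge at
  every larger point. The backward Euler approximation \<open>(k/t R(k/t, A\<^sub>n))\<^sup>k\<close> of \<open>T\<^sub>n(t)\<close> has an error of order
  \<open>1/k\<close> in norm, uniformly in \<open>n\<close>, on the vectors \<open>R(\<lambda>, A\<^sub>n)\<^sup>2 y\<close>. Therefore \<open>T\<^sub>n(t)x\<close> is \<open>\<gamma>\<close>-Cauchy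
  for \<open>x\<close> in the dense range of \<open>R\<^sup>2\<close>, and by equicontinuity for all \<open>x\<close>. The limit semigroup has the
  resolvent \<open>R\<close>. The graph of its generator \<open>B\<close> is \<open>{(x, y). R (\<lambda> x - y) = x}\<close>, from which the statements on closures are read off.
\<close>

section \<open>Seminorm topologies\<close>

text \<open>A classical route first needs a generation theorem that makes \<open>R\<close> the
  resolvent of a semigroup generator; only then can semigroups be compared. Backward Euler expresses
  the semigroups through resolvents alone, so convergence of the resolvents makes the semigroup
  values Cauchy before any limit operator is known. The points k/t move off to the right, hence
  convergence of the resolvents is only continued to larger points. The square of the resolvent
  appears because a second-order remainder needs vectors in the domain of the squared generator;
  since the error bound speaks of the n-th resolvent, the approximated vectors vary with n.

  Two restrictions shape the analysis. Completeness of \<gamma> is sequential, so integrals are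
  built as limits of sequences, with bisection arguments in place of compactness. Equicontinuity is
  local in time, so the tails of Laplace integrals are estimated in norm, which dominates each
  seminorm in \<open>G\<close> up to a constant.\<close>

lemma openin_seminorm_topology:
  fixes Q :: "('a::real_normed_vector \<Rightarrow> real) set"
  assumes V: "\<And>x y. x \<in> V \<Longrightarrow> y \<in> V \<Longrightarrow> x - y \<in> V"
    and tri: "\<And>q x y. q \<in> Q \<Longrightarrow> x \<in> V \<Longrightarrow> y \<in> V \<Longrightarrow> q (x + y) \<le> q x + q y"
    and zero: "\<And>q. q \<in> Q \<Longrightarrow> q 0 = 0"
  shows "openin (seminorm_topology V Q) U \<longleftrightarrow>
    U \<subseteq> V \<and> (\<forall>x\<in>U. \<exists>F. finite F \<and> F \<subseteq> Q \<and> (\<exists>r>0. \<forall>y\<in>V. (\<forall>q\<in>F. q (y - x) < r) \<longrightarrow> y \<in> U))"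
    (is "?L \<longleftrightarrow> ?R U")
proof
  assume ?L
  then have "generate_topology_on (insert V {{y \<in> V. p (y - x) < r} | p x r. p \<in> Q \<and> x \<in> V \<and> 0 < r}) U"
    by (simp add: seminorm_topology_def openin_topology_generated_by_iff)
  then show "?R U"
  proof (induction U rule: generate_topology_on.induct)
    case Empty
    then show ?case by simp
  next
    case (Int a b)
    show ?case
    proof (intro conjI ballI)
      fix x assume x: "x \<in> a \<inter> b"
      obtain F r where F: "finite F" "F \<subseteq> Q" "r > 0" "\<forall>y\<in>V. (\<forall>q\<in>F. q (y - x) < r) \<longrightarrow> y \<in> a"
        using Int.IH(1) x by blast
      obtain F' r' where F': "finite F'" "F' \<subseteq> Q" "r' > 0" "\<forall>y\<in>V. (\<forall>q\<in>F'. q (y - x) < r') \<longrightarrow> y \<in> b"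
        using Int.IH(2) x by blast
      show "\<exists>F. finite F \<and> F \<subseteq> Q \<and> (\<exists>r>0. \<forall>y\<in>V. (\<forall>q\<in>F. q (y - x) < r) \<longrightarrow> y \<in> a \<inter> b)"
      proof (intro exI conjI)
        show "\<forall>y\<in>V. (\<forall>q\<in>F \<union> F'. q (y - x) < min r r') \<longrightarrow> y \<in> a \<inter> b"
          using F(4) F'(4) by auto
        show "finite (F \<union> F')" "F \<union> F' \<subseteq> Q" "min r r' > 0"
          using F(1-3) F'(1-3) by auto
      qed
    qed (use Int in auto)
  next
    case (UN K)
    show ?case
    proof (intro conjI ballI)
      fix x assume "x \<in> \<Union> K"
      then obtain k where k: "k \<in> K" "x \<in> k" by auto
      then obtain F r where "finite F" "F \<subseteq> Q" "r > 0" "\<forall>y\<in>V. (\<forall>q\<in>F. q (y - x) < r) \<longrightarrow> y \<in> k"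
        using UN.IH[OF k(1)] by blast
      moreover from this(4) have "\<forall>y\<in>V. (\<forall>q\<in>F. q (y - x) < r) \<longrightarrow> y \<in> \<Union> K" using k(1) by blast
      ultimately show "\<exists>F. finite F \<and> F \<subseteq> Q \<and> (\<exists>r>0. \<forall>y\<in>V. (\<forall>q\<in>F. q (y - x) < r) \<longrightarrow> y \<in> \<Union> K)"
        by blast
    next
      show "\<Union> K \<subseteq> V" using UN.IH by (meson Sup_least)
    qed
  next
    case (Basis s)
    then consider "s = V"
      | p x0 r where "p \<in> Q" "x0 \<in> V" "0 < r" "s = {y \<in> V. p (y - x0) < r}" by auto
    then show ?case
    proof cases
      case 1
      then show ?thesis by (auto intro!: exI[of _ "{}"] exI[of _ "1::real"])
    next
      case (2 p x0 r)
      show ?thesis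
      proof (intro conjI ballI)
        fix x assume x: "x \<in> s"
        \<comment> \<open>The ball is re-centred at x: \<open>y - x0 = (y - x) + (x - x0)\<close>
          leaves the radius \<open>r - p (x - x0)\<close>. Both summands lie in V, the set on which
          subadditivity is assumed.\<close>
        have "y \<in> s" if y: "y \<in> V" "p (y - x) < r - p (x - x0)" for y
          using tri[OF 2(1), of "y - x" "x - x0"] V x y 2 by auto
        then show "\<exists>F. finite F \<and> F \<subseteq> Q \<and> (\<exists>r>0. \<forall>y\<in>V. (\<forall>q\<in>F. q (y - x) < r) \<longrightarrow> y \<in> s)"
          using x 2 by (intro exI[of _ "{p}"] conjI exI[of _ "r - p (x - x0)"]) auto
      qed (use 2 in auto)
    qed
  qed
next
  let ?B = "insert V {{y \<in> V. p (y - x) < r} | p x r. p \<in> Q \<and> x \<in> V \<and> 0 < r}"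
  assume R: "?R U"
  have "\<exists>T. openin (seminorm_topology V Q) T \<and> x \<in> T \<and> T \<subseteq> U" if x: "x \<in> U" for x
  proof -
    obtain F r where F: "finite F" "F \<subseteq> Q" "r > 0" "\<forall>y\<in>V. (\<forall>q\<in>F. q (y - x) < r) \<longrightarrow> y \<in> U"
      using R x by blast
    let ?T = "\<Inter> (insert V ((\<lambda>q. {y \<in> V. q (y - x) < r}) ` F))"
    have xV: "x \<in> V" using R x by auto
    have "openin (seminorm_topology V Q) ?T"
    proof (rule openin_Inter)
      fix s assume "s \<in> insert V ((\<lambda>q. {y \<in> V. q (y - x) < r}) ` F)"
      then have "s \<in> ?B" using F xV by auto
      then show "openin (seminorm_topology V Q) s"
        unfolding seminorm_topology_def openin_topology_generated_by_iff
        by (rule generate_topology_on.Basis)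
    qed (use F in auto)
    moreover have "q (x - x) < r" if "q \<in> F" for q
      using that zero F(2,3) by (metis diff_self subsetD)
    then have "x \<in> ?T" using xV by auto
    moreover have "?T \<subseteq> U" using F(4) by auto
    ultimately show ?thesis by blast
  qed
  then show ?L by (subst openin_subopen) blast
qed

lemma openin_seminorm_topology_ball:
  assumes "p \<in> Q" "x \<in> V" "r > 0"
  shows "openin (seminorm_topology V Q) {y \<in> V. p (y - x) < r}"
  unfolding seminorm_topology_def openin_topology_generated_by_iff
  by (rule generate_topology_on.Basis) (use assms in auto)

lemma map_le_dom:
  assumes "f \<subseteq>\<^sub>m g" "x \<in> dom f"
  shows "x \<in> dom g" "g x = f x"
proof -
  show "g x = f x" using assms by (simp add: map_le_def)
  then show "x \<in> dom g" using assms(2) by (simp add: domIff)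
qed

lemma topspace_seminorm_topology: "topspace (seminorm_topology V Q) = V"
  unfolding seminorm_topology_def topology_generated_by_topspace by auto

context normed_space
begin

lemma seminorm_add: "is_seminorm scal q \<Longrightarrow> q (x + y) \<le> q x + q y"
  by (simp add: is_seminorm_def)

lemma seminorm_scal: "is_seminorm scal q \<Longrightarrow> q (scal c x) = norm c * q x"
  by (simp add: is_seminorm_def)

lemma seminorm_scaleR: "is_seminorm scal q \<Longrightarrow> q (r *\<^sub>R x) = \<bar>r\<bar> * q x"
  using seminorm_scal[of q "of_real r" x] by (simp add: scal_of_real)

lemma seminorm_0: "is_seminorm scal q \<Longrightarrow> q 0 = 0"
  using seminorm_scaleR[of q 0 0] by simp

lemma seminorm_minus: "is_seminorm scal q \<Longrightarrow> q (- x) = q x"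
  using seminorm_scaleR[of q "-1" x] by simp

lemma seminorm_minus_commute: "is_seminorm scal q \<Longrightarrow> q (x - y) = q (y - x)"
  using seminorm_minus[of q "x - y"] by simp

lemma seminorm_nonneg: "is_seminorm scal q \<Longrightarrow> 0 \<le> q x"
  using seminorm_add[of q x "- x"] seminorm_0[of q] seminorm_minus[of q x] by simp

lemma seminorm_diff: "is_seminorm scal q \<Longrightarrow> q (x - y) \<le> q x + q y"
  using seminorm_add[of q x "- y"] seminorm_minus[of q y] by simp

lemma seminorm_sum: "is_seminorm scal q \<Longrightarrow> q (\<Sum>i\<in>I. f i) \<le> (\<Sum>i\<in>I. q (f i))"
proof (induction I rule: infinite_finite_induct)
  case (insert i I)
  then show ?case using seminorm_add[of q "f i" "sum f I"] by simp
qed (auto simp: seminorm_0)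

text \<open>Two inequalities suffice: the scaling bound for the inverse scalar gives its own
  converse, and for the scalar 0 it forces \<open>q 0 = 0\<close> together with
  subadditivity.\<close>

lemma seminormI:
  assumes add: "\<And>x y. q (x + y) \<le> q x + q y"
    and scal: "\<And>c x. q (scal c x) \<le> norm c * q x"
  shows "is_seminorm scal q"
proof -
  have "q (scal c x) = norm c * q x" for c x
  proof (cases "c = 0")
    case True
    then show ?thesis using scal[of 0 x] add[of 0 0] by simp
  next
    case False
    have "norm c * q x = norm c * q (scal (inverse c) (scal c x))" using False by simp
    also have "\<dots> \<le> norm c * (norm (inverse c) * q (scal c x))"
      by (intro mult_left_mono scal) simp
    also have "\<dots> = q (scal c x)" using False by (simp add: norm_inverse)
    finally show ?thesis using scal[of c x] by simp
  qed
  then show ?thesis using add by (simp add: is_seminorm_def)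
qed

lemma seminorm_SUP:
  assumes J: "J \<noteq> {}" and f: "\<And>j. j \<in> J \<Longrightarrow> is_seminorm scal (f j)"
    and bdd: "\<And>x. bdd_above ((\<lambda>j. f j x) ` J)"
  shows "is_seminorm scal (\<lambda>x. SUP j\<in>J. f j x)"
proof (rule seminormI)
  show "(SUP j\<in>J. f j (x + y)) \<le> (SUP j\<in>J. f j x) + (SUP j\<in>J. f j y)" for x y
    using J f by (intro cSUP_least) (auto intro!: order.trans[OF seminorm_add] add_mono cSUP_upper bdd)
  show "(SUP j\<in>J. f j (scal c x)) \<le> norm c * (SUP j\<in>J. f j x)" for c x
    using J f by (intro cSUP_least) (auto simp: seminorm_scal intro!: mult_left_mono cSUP_upper bdd)
qed

lemma openin_directed_seminorms:
  assumes Q: "\<And>q. q \<in> Q \<Longrightarrow> is_seminorm scal q"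
    and dir: "\<And>F. finite F \<Longrightarrow> F \<subseteq> Q \<Longrightarrow> \<exists>q\<in>Q. \<exists>C>0. \<forall>f\<in>F. \<forall>x. f x \<le> C * q x"
  shows "openin (seminorm_topology UNIV Q) U \<longleftrightarrow> (\<forall>x\<in>U. \<exists>q\<in>Q. \<exists>r>0. \<forall>y. q (y - x) < r \<longrightarrow> y \<in> U)"
    (is "?L \<longleftrightarrow> ?R")
proof -
  have *: "?L \<longleftrightarrow> (\<forall>x\<in>U. \<exists>F. finite F \<and> F \<subseteq> Q \<and> (\<exists>r>0. \<forall>y. (\<forall>q\<in>F. q (y - x) < r) \<longrightarrow> y \<in> U))"
    by (subst openin_seminorm_topology) (auto intro: seminorm_add seminorm_0 Q)
  show ?thesis
  proof
    assume ?L
    show ?R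
    proof
      fix x assume "x \<in> U"
      then obtain F r where F: "finite F" "F \<subseteq> Q" "r > 0" "\<forall>y. (\<forall>q\<in>F. q (y - x) < r) \<longrightarrow> y \<in> U"
        using \<open>?L\<close> * by blast
      obtain p C where p: "p \<in> Q" "C > 0" "\<forall>f\<in>F. \<forall>x. f x \<le> C * p x"
        using dir[OF F(1,2)] by blast
      have "y \<in> U" if "p (y - x) < r / C" for y
      proof -
        have "C * p (y - x) < r" using that p by (simp add: field_simps)
        then have "\<forall>q\<in>F. q (y - x) < r" using p(3) by (meson le_less_trans)
        then show ?thesis using F by blast
      qed
      moreover have "r / C > 0" using F p by simp
      ultimately show "\<exists>q\<in>Q. \<exists>r>0. \<forall>y. q (y - x) < r \<longrightarrow> y \<in> U" using p(1) by blast
    qed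
  next
    assume R: ?R
    have "\<exists>F. finite F \<and> F \<subseteq> Q \<and> (\<exists>r>0. \<forall>y. (\<forall>q\<in>F. q (y - x) < r) \<longrightarrow> y \<in> U)" if xU: "x \<in> U" for x
    proof -
      obtain p r where "p \<in> Q" "r > 0" "\<forall>y. p (y - x) < r \<longrightarrow> y \<in> U" using bspec[OF R xU] by blast
      then have "finite {p} \<and> {p} \<subseteq> Q \<and> r > 0 \<and> (\<forall>y. (\<forall>q\<in>{p}. q (y - x) < r) \<longrightarrow> y \<in> U)" by simp
      then show ?thesis by (intro exI conjI; elim conjE)
    qed
    then show ?L using * by blast
  qed
qed

lemma openin_seminorm_ball:
  assumes q: "q \<in> Q" "is_seminorm scal q"
  shows "openin (seminorm_topology UNIV Q) {y. q (y - x) < r}"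
proof (cases "r > 0")
  case True
  then show ?thesis using openin_seminorm_topology_ball[OF q(1) UNIV_I, of r x] by simp
next
  case False
  then have "{y. q (y - x) < r} = {}" using seminorm_nonneg[OF q(2)] by (simp add: not_less order.trans)
  then show ?thesis by simp
qed

lemma limitin_directed_seminorms:
  assumes Q: "\<And>q. q \<in> Q \<Longrightarrow> is_seminorm scal q"
    and dir: "\<And>F. finite F \<Longrightarrow> F \<subseteq> Q \<Longrightarrow> \<exists>q\<in>Q. \<exists>C>0. \<forall>f\<in>F. \<forall>x. f x \<le> C * q x"
  shows "limitin (seminorm_topology UNIV Q) f x F \<longleftrightarrow> (\<forall>q\<in>Q. ((\<lambda>i. q (f i - x)) \<longlongrightarrow> 0) F)"
proof
  assume L: "limitin (seminorm_topology UNIV Q) f x F"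
  show "\<forall>q\<in>Q. ((\<lambda>i. q (f i - x)) \<longlongrightarrow> 0) F"
  proof (intro ballI tendstoI)
    fix q and e :: real assume q: "q \<in> Q" and e: "e > 0"
    have "x \<in> {y. q (y - x) < e}" using e by (simp add: seminorm_0[OF Q[OF q]])
    then have "\<forall>\<^sub>F i in F. f i \<in> {y. q (y - x) < e}"
      using L openin_seminorm_ball[OF q Q[OF q]] unfolding limitin_def by blast
    then show "\<forall>\<^sub>F i in F. dist (q (f i - x)) 0 < e"
      by (simp add: seminorm_nonneg[OF Q[OF q]])
  qed
next
  assume R: "\<forall>q\<in>Q. ((\<lambda>i. q (f i - x)) \<longlongrightarrow> 0) F"
  show "limitin (seminorm_topology UNIV Q) f x F"
    unfolding limitin_def topspace_seminorm_topology
  proof (intro conjI allI impI UNIV_I)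
    fix U assume U: "openin (seminorm_topology UNIV Q) U \<and> x \<in> U"
    obtain q r where q: "q \<in> Q" "r > 0" "\<forall>y. q (y - x) < r \<longrightarrow> y \<in> U"
      using bspec[OF iffD1[OF openin_directed_seminorms[OF Q dir] conjunct1[OF U]] conjunct2[OF U]] by blast
    have "\<forall>\<^sub>F i in F. q (f i - x) < r" using R q by (intro order_tendstoD(2)[where y = 0]) auto
    then show "\<forall>\<^sub>F i in F. f i \<in> U" by eventually_elim (use q(3) in blast)
  qed
qed

section \<open>Inf-convolution of a sequence of seminorms\<close>

text \<open>For seminorms \<open>r k\<close> this is the largest seminorm below all of them.
  Decompositions are finite, of arbitrary length, so its open unit ball consists of finite
  sums.\<close>

definition infconv :: "(nat \<Rightarrow> 'a \<Rightarrow> real) \<Rightarrow> 'a \<Rightarrow> real" where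
  "infconv r x = Inf {\<Sum>k<N. r k (y k) | N y. x = (\<Sum>k<N. y k)}"

lemma infconv_le:
  assumes "\<And>k. is_seminorm scal (r k)" and "x = (\<Sum>k<N. y k)"
  shows "infconv r x \<le> (\<Sum>k<N. r k (y k))"
  unfolding infconv_def
proof (rule cInf_lower)
  show "bdd_below {\<Sum>k<N. r k (y k) |N y. x = (\<Sum>k<N. y k)}"
    by (rule bdd_belowI[of _ 0]) (auto intro!: sum_nonneg simp: seminorm_nonneg[OF assms(1)])
qed (use assms in blast)

lemma infconv_le_component:
  assumes "\<And>k. is_seminorm scal (r k)"
  shows "infconv r x \<le> r k x"
proof -
  have "infconv r x \<le> (\<Sum>i<Suc k. r i (if i = k then x else 0))"
    by (rule infconv_le[OF assms]) simp
  also have "\<dots> = (\<Sum>i<Suc k. if i = k then r k x else 0)"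
    by (intro sum.cong) (auto simp: seminorm_0[OF assms])
  finally show ?thesis by simp
qed

lemma infconv_lessD:
  assumes "infconv r x < c"
  obtains N y where "x = (\<Sum>k<N. y k)" "(\<Sum>k<N. r k (y k)) < c"
proof -
  have "x = (\<Sum>k<Suc 0. x)" by simp
  then have "{\<Sum>k<N. r k (y k) |N y. x = (\<Sum>k<N. y k)} \<noteq> {}" by blast
  from cInf_lessD[OF this] assms that show ?thesis unfolding infconv_def by blast
qed

text \<open>Padding by zeros brings two decompositions to a common length, so that they can be added
  termwise.\<close>

lemma sum_lessThan_extend:
  fixes N N' :: nat and f :: "nat \<Rightarrow> 'b::comm_monoid_add"
  shows "(\<Sum>k<N. f k) = (\<Sum>k<max N N'. if k < N then f k else 0)"
  by (rule sum.mono_neutral_cong_left) (auto simp: less_max_iff_disj)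

lemma seminorm_infconv:
  assumes r: "\<And>k. is_seminorm scal (r k)"
  shows "is_seminorm scal (infconv r)"
proof (rule seminormI)
  fix x x'
  \<comment> \<open>The infimum need not be attained, so numbers strictly above the two values are
    used; letting them decrease gives subadditivity.\<close>
  have "infconv r (x + x') \<le> a + b" if ab: "infconv r x < a" "infconv r x' < b" for a b
  proof -
    obtain N y where y: "x = (\<Sum>k<N. y k)" "(\<Sum>k<N. r k (y k)) < a"
      using ab infconv_lessD by metis
    obtain N' y' where y': "x' = (\<Sum>k<N'. y' k)" "(\<Sum>k<N'. r k (y' k)) < b"
      using ab infconv_lessD by metis
    define K where "K = max N N'"
    define z z' where "z k = (if k < N then y k else 0)" and "z' k = (if k < N' then y' k else 0)" for k
    have "x = (\<Sum>k<K. z k)" "x' = (\<Sum>k<K. z' k)"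
      unfolding y y' K_def z_def z'_def using sum_lessThan_extend[of y N N'] sum_lessThan_extend[of y' N' N]
      by (simp_all add: max.commute)
    then have "x + x' = (\<Sum>k<K. z k + z' k)" by (simp add: sum.distrib)
    then have "infconv r (x + x') \<le> (\<Sum>k<K. r k (z k + z' k))" by (rule infconv_le[OF r])
    also have "\<dots> \<le> (\<Sum>k<K. r k (z k)) + (\<Sum>k<K. r k (z' k))"
      unfolding sum.distrib[symmetric] by (intro sum_mono seminorm_add r)
    also have "(\<Sum>k<K. r k (z k)) = (\<Sum>k<N. r k (y k))"
      by (rule trans[OF sum.cong sum_lessThan_extend[of "\<lambda>k. r k (y k)" N N', symmetric]])
        (auto simp: seminorm_0[OF r] z_def K_def)
    also have "(\<Sum>k<K. r k (z' k)) = (\<Sum>k<N'. r k (y' k))"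
      by (rule trans[OF sum.cong sum_lessThan_extend[of "\<lambda>k. r k (y' k)" N' N, symmetric]])
        (auto simp: seminorm_0[OF r] z'_def K_def max.commute)
    finally show ?thesis using y y' by simp
  qed
  note * = this
  show "infconv r (x + x') \<le> infconv r x + infconv r x'"
  proof (rule field_le_epsilon)
    fix e :: real assume "e > 0"
    then show "infconv r (x + x') \<le> infconv r x + infconv r x' + e"
      using *[of "infconv r x + e/2" "infconv r x' + e/2"] by simp
  qed
next
  fix c x
  have *: "infconv r (scal c x) \<le> norm c * a" if a: "infconv r x < a" for a
  proof -
    obtain N y where y: "x = (\<Sum>k<N. y k)" "(\<Sum>k<N. r k (y k)) < a"
      using a infconv_lessD by metis
    then have "infconv r (scal c x) \<le> (\<Sum>k<N. r k (scal c (y k)))"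
      by (intro infconv_le[OF r]) (simp add: scale_sum_right)
    also have "\<dots> = norm c * (\<Sum>k<N. r k (y k))"
      by (simp add: seminorm_scal[OF r] sum_distrib_left)
    also have "\<dots> \<le> norm c * a" using y by (intro mult_left_mono) auto
    finally show ?thesis .
  qed
  show "infconv r (scal c x) \<le> norm c * infconv r x"
  proof (cases "c = 0")
    case False
    show ?thesis
    proof (rule field_le_epsilon)
      fix e :: real assume "e > 0"
      then show "infconv r (scal c x) \<le> norm c * infconv r x + e"
        using *[of "infconv r x + e / norm c"] False by (simp add: distrib_left)
    qed
  qed (use *[of "infconv r x + 1"] in simp)
qed

end

section \<open>Seminorms continuous on norm-bounded sets of a Saks space\<close>

locale mixed_saks_space = normed_space scal
  for scal :: "'k::real_normed_field \<Rightarrow> 'a::real_normed_vector \<Rightarrow> 'a" +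
  fixes \<tau> \<gamma> :: "'a topology" and P :: "('a \<Rightarrow> real) set"
  assumes saks: "saks_space scal \<tau> P"
    and mixed: "is_mixed_topology scal \<tau> \<gamma>"
    and seq_complete: "sequentially_complete \<gamma>"
    and C_seq: "C_sequential \<gamma>"
begin

lemma P_seminorm: "p \<in> P \<Longrightarrow> is_seminorm scal p"
  using saks by (auto simp: saks_space_def generates_def)

lemma P_nonempty: "P \<noteq> {}"
  using saks by (auto simp: saks_space_def directed_seminorms_def)

lemma P_le_norm: "p \<in> P \<Longrightarrow> p x \<le> norm x"
  using saks by (auto simp: saks_space_def intro: cSUP_upper)

lemma norm_leI: "(\<And>p. p \<in> P \<Longrightarrow> p x \<le> c) \<Longrightarrow> norm x \<le> c"
  using saks P_nonempty by (auto simp: saks_space_def intro: cSUP_least)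

lemma P_finite_dominated:
  assumes "finite F" "F \<subseteq> P"
  shows "\<exists>p\<in>P. \<exists>C>0. \<forall>f\<in>F. \<forall>x. f x \<le> C * p x"
  using assms
proof (induction F)
  case empty
  then show ?case using P_nonempty by (auto intro: exI[of _ "1::real"])
next
  case (insert f F)
  then obtain p C where p: "p \<in> P" "C > 0" "\<forall>f\<in>F. \<forall>x. f x \<le> C * p x" by auto
  obtain r D where r: "r \<in> P" "D \<ge> 0" "\<forall>x. max (f x) (p x) \<le> D * r x"
    using saks insert.prems p(1) unfolding saks_space_def directed_seminorms_def by blast
  have r0: "r x \<ge> 0" for x using seminorm_nonneg[OF P_seminorm[OF r(1)]] .
  \<comment> \<open>The constant covers \<open>D\<close>, which bounds f, and \<open>C * D\<close>,
    which bounds the members of F by way of p; the summand 1 makes it positive.\<close>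
  have 1: "f x \<le> (D + C * D + 1) * r x" for x
  proof -
    have "f x \<le> D * r x" using r by auto
    also have "\<dots> \<le> (D + C * D + 1) * r x" using r p r0 by (intro mult_right_mono) auto
    finally show ?thesis .
  qed
  have 2: "g x \<le> (D + C * D + 1) * r x" if "g \<in> F" for g x
  proof -
    have "g x \<le> C * p x" using p that by auto
    also have "\<dots> \<le> C * (D * r x)" using p r by (intro mult_left_mono) auto
    also have "\<dots> = (C * D) * r x" by simp
    also have "\<dots> \<le> (D + C * D + 1) * r x" using r p r0 by (intro mult_right_mono) auto
    finally show ?thesis .
  qed
  have "D + C * D + 1 > 0" using r p by (simp add: add_nonneg_pos)
  with 1 2 r(1) show ?case by blast
qed

lemma tau_eq: "\<tau> = seminorm_topology UNIV P"
  using saks by (auto simp: saks_space_def generates_def)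

lemma openin_tau:
  "openin \<tau> U \<longleftrightarrow> (\<forall>x\<in>U. \<exists>p\<in>P. \<exists>r>0. \<forall>y. p (y - x) < r \<longrightarrow> y \<in> U)"
  unfolding tau_eq by (rule openin_directed_seminorms[OF P_seminorm P_finite_dominated])

lemma openin_tau_ball: "p \<in> P \<Longrightarrow> openin \<tau> {y. p (y - x) < r}"
  unfolding tau_eq by (rule openin_seminorm_ball[OF _ P_seminorm])

lemma limitin_tau: "limitin \<tau> f x F \<longleftrightarrow> (\<forall>p\<in>P. ((\<lambda>i. p (f i - x)) \<longlongrightarrow> 0) F)"
  unfolding tau_eq by (rule limitin_directed_seminorms[OF P_seminorm P_finite_dominated])

lemma topspace_tau: "topspace \<tau> = UNIV"
  unfolding tau_eq by (rule topspace_seminorm_topology)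

text \<open>These seminorms will turn out to be exactly the \<open>\<gamma>\<close>-continuous ones.\<close>

definition G :: "('a \<Rightarrow> real) set" where
  "G = {q. is_seminorm scal q \<and>
     (\<forall>K e. e > 0 \<longrightarrow> (\<exists>p\<in>P. \<exists>d>0. \<forall>x. norm x \<le> K \<and> p x < d \<longrightarrow> q x < e))}"

lemma G_seminorm: "q \<in> G \<Longrightarrow> is_seminorm scal q"
  by (simp add: G_def)

lemma P_subset_G: "p \<in> P \<Longrightarrow> p \<in> G"
  by (auto simp: G_def P_seminorm)

lemma G_smallD:
  assumes "q \<in> G" "e > 0"
  obtains p d where "p \<in> P" "d > 0" "\<And>x. norm x \<le> K \<Longrightarrow> p x < d \<Longrightarrow> q x < e"
  using assms unfolding G_def by blast

lemma G_zero: "(\<lambda>x. 0) \<in> G"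
  using P_nonempty by (auto simp: G_def is_seminorm_def intro: exI[of _ "1::real"])

lemma G_add:
  assumes q: "q \<in> G" and q': "q' \<in> G"
  shows "(\<lambda>x. q x + q' x) \<in> G"
  unfolding G_def
proof (intro CollectI conjI allI impI)
  show "is_seminorm scal (\<lambda>x. q x + q' x)"
  proof (rule seminormI)
    show "q (x + y) + q' (x + y) \<le> q x + q' x + (q y + q' y)" for x y
      using seminorm_add[OF G_seminorm[OF q], of x y] seminorm_add[OF G_seminorm[OF q'], of x y] by simp
  qed (simp add: seminorm_scal[OF G_seminorm[OF q]] seminorm_scal[OF G_seminorm[OF q']] algebra_simps)
next
  fix K e :: real assume e: "e > 0"
  obtain p d where p: "p \<in> P" "d > 0" "\<And>x. norm x \<le> K \<Longrightarrow> p x < d \<Longrightarrow> q x < e/2"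
    using G_smallD[OF q, of "e/2" K] e by auto
  obtain p' d' where p': "p' \<in> P" "d' > 0" "\<And>x. norm x \<le> K \<Longrightarrow> p' x < d' \<Longrightarrow> q' x < e/2"
    using G_smallD[OF q', of "e/2" K] e by auto
  obtain r C where r: "r \<in> P" "C > 0" "\<forall>f\<in>{p,p'}. \<forall>x. f x \<le> C * r x"
    using P_finite_dominated[of "{p,p'}"] p p' by auto
  have "q x + q' x < e" if "norm x \<le> K" "r x < min d d' / C" for x
  proof -
    have "C * r x < min d d'" using that r by (simp add: field_simps)
    then have "p x < d" "p' x < d'" using r(3) by (auto intro: le_less_trans)
    then show ?thesis using p p' that by fastforce
  qed
  moreover have "min d d' / C > 0" using p p' r by auto
  ultimately show "\<exists>p\<in>P. \<exists>d>0. \<forall>x. norm x \<le> K \<and> p x < d \<longrightarrow> q x + q' x < e"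
    using r(1) by blast
qed

lemma G_finite_dominated:
  assumes "finite F" "F \<subseteq> G"
  shows "\<exists>q\<in>G. \<exists>C>0. \<forall>f\<in>F. \<forall>x. f x \<le> C * q x"
proof -
  have "\<exists>q\<in>G. \<forall>f\<in>F. \<forall>x. f x \<le> q x"
    using assms
  proof (induction F)
    case empty
    then show ?case using G_zero by auto
  next
    case (insert f F)
    then obtain q where q: "q \<in> G" "\<forall>f\<in>F. \<forall>x. f x \<le> q x" by auto
    have "(\<lambda>x. f x + q x) \<in> G" using insert q by (intro G_add) auto
    moreover have "g x \<le> f x + q x" if "g \<in> insert f F" for g x
    proof -
      have "f x \<ge> 0" "q x \<ge> 0" using insert.prems q by (auto intro: seminorm_nonneg G_seminorm)
      moreover have "g = f \<or> g x \<le> q x" using that q(2) by blast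
      ultimately show ?thesis by auto
    qed
    ultimately show ?case by (intro bexI[of _ "\<lambda>x. f x + q x"]) auto
  qed
  then obtain q where "q \<in> G" "\<forall>f\<in>F. \<forall>x. f x \<le> q x" by blast
  then show ?thesis by (intro bexI[of _ q] exI[of _ 1]) auto
qed

lemma G_mult: "q \<in> G \<Longrightarrow> c \<ge> 0 \<Longrightarrow> (\<lambda>x. c * q x) \<in> G"
  unfolding G_def
proof (intro CollectI conjI allI impI)
  assume q: "q \<in> {q. is_seminorm scal q \<and>
     (\<forall>K e. e > 0 \<longrightarrow> (\<exists>p\<in>P. \<exists>d>0. \<forall>x. norm x \<le> K \<and> p x < d \<longrightarrow> q x < e))}" and c: "c \<ge> 0"
  show "is_seminorm scal (\<lambda>x. c * q x)"
    using q c seminorm_add[of q]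
    by (intro seminormI) (auto simp: seminorm_scal distrib_left[symmetric] intro!: mult_left_mono)
  fix K e :: real assume e: "e > 0"
  have "e / (c + 1) > 0" using c e by simp
  then obtain p d where p: "p \<in> P" "d > 0" "\<forall>x. norm x \<le> K \<and> p x < d \<longrightarrow> q x < e / (c + 1)"
    using q by blast
  have "c * q x < e" if "q x < e / (c + 1)" for x
  proof -
    have "c * q x \<le> (c + 1) * q x" using q seminorm_nonneg[of q x] by (simp add: algebra_simps)
    also have "\<dots> < e" using that c by (simp add: field_simps)
    finally show ?thesis .
  qed
  then show "\<exists>p\<in>P. \<exists>d>0. \<forall>x. norm x \<le> K \<and> p x < d \<longrightarrow> c * q x < e"
    using p by blast
qed

lemma openin_seminorm_topology_G:
  "openin (seminorm_topology UNIV G) U \<longleftrightarrow> (\<forall>x\<in>U. \<exists>q\<in>G. \<exists>r>0. \<forall>y. q (y - x) < r \<longrightarrow> y \<in> U)"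
  by (rule openin_directed_seminorms[OF G_seminorm G_finite_dominated])

lemma openin_G_ball: "q \<in> G \<Longrightarrow> openin (seminorm_topology UNIV G) {y. q (y - x) < r}"
  by (rule openin_seminorm_ball[OF _ G_seminorm])

lemma topspace_seminorm_topology_G: "topspace (seminorm_topology UNIV G) = UNIV"
  by (rule topspace_seminorm_topology)

section \<open>The mixed topology as a seminorm topology\<close>

text \<open>The seminorms in P lie below the norm, so vectors of small norm meet the smallness
  condition that defines G; scaling does the rest.\<close>

lemma G_le_norm:
  assumes q: "q \<in> G"
  obtains C where "C > 0" "\<And>x. q x \<le> C * norm x"
proof -
  obtain p d where p: "p \<in> P" "d > 0" "\<And>x. norm x \<le> 1 \<Longrightarrow> p x < d \<Longrightarrow> q x < 1"
    using G_smallD[OF q zero_less_one, of 1] by metis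
  \<comment> \<open>Norm m keeps the scaled vector in the unit ball and, as \<open>p\<close> lies
    below the norm, its p-value strictly below d.\<close>
  define m where "m = min 1 (d / 2)"
  have m: "m > 0" "m \<le> 1" "m < d" using p by (auto simp: m_def)
  have "q x \<le> (1 / m) * norm x" for x
  proof (cases "x = 0")
    case True
    then show ?thesis by (simp add: seminorm_0[OF G_seminorm[OF q]])
  next
    case False
    let ?y = "(m / norm x) *\<^sub>R x"
    have n: "norm ?y = m" using False m by simp
    then have "p ?y < d" using P_le_norm[OF p(1), of ?y] m by simp
    then have "q ?y < 1" using p(3)[of ?y] n m by simp
    then show ?thesis using m False by (simp add: seminorm_scaleR[OF G_seminorm[OF q]] field_simps)
  qed
  then show thesis using m that[of "1 / m"] by simp
qed

lemma continuous_map_add_G: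
  "continuous_map (prod_topology (seminorm_topology UNIV G) (seminorm_topology UNIV G))
     (seminorm_topology UNIV G) (\<lambda>(x, y). x + y)"
  unfolding continuous_map_eq_topcontinuous_at topcontinuous_at_def
proof (intro ballI conjI allI impI)
  fix z U assume "openin (seminorm_topology UNIV G) U \<and> (case z of (x, y) \<Rightarrow> x + y) \<in> U"
  then obtain x y where z: "z = (x, y)" and U: "openin (seminorm_topology UNIV G) U" "x + y \<in> U"
    by (cases z) auto
  then obtain q r where q: "q \<in> G" "r > 0" "\<And>w. q (w - (x + y)) < r \<Longrightarrow> w \<in> U"
    unfolding openin_seminorm_topology_G by metis
  let ?V = "{w. q (w - x) < r/2} \<times> {w. q (w - y) < r/2}"
  have "openin (prod_topology (seminorm_topology UNIV G) (seminorm_topology UNIV G)) ?V"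
    unfolding openin_prod_Times_iff using openin_G_ball[OF q(1)] by blast
  moreover have "z \<in> ?V" using q z by (simp add: seminorm_0[OF G_seminorm])
  moreover have "a + b \<in> U" if "q (a - x) < r/2" "q (b - y) < r/2" for a b
  proof (rule q(3))
    have "q ((a - x) + (b - y)) \<le> q (a - x) + q (b - y)" by (rule seminorm_add[OF G_seminorm[OF q(1)]])
    then show "q (a + b - (x + y)) < r" using that by (simp add: algebra_simps)
  qed
  ultimately show "\<exists>V. openin (prod_topology (seminorm_topology UNIV G) (seminorm_topology UNIV G)) V \<and>
       z \<in> V \<and> (\<forall>y\<in>V. (case y of (x, y) \<Rightarrow> x + y) \<in> U)"
    by (intro exI[of _ ?V] conjI) auto
qed (auto simp: topspace_seminorm_topology_G)

lemma continuous_map_scal_G: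
  "continuous_map (prod_topology euclidean (seminorm_topology UNIV G))
     (seminorm_topology UNIV G) (\<lambda>(c, x). scal c x)"
  unfolding continuous_map_eq_topcontinuous_at topcontinuous_at_def
proof (intro ballI conjI allI impI)
  fix z U assume "openin (seminorm_topology UNIV G) U \<and> (case z of (c, x) \<Rightarrow> scal c x) \<in> U"
  then obtain c x where z: "z = (c, x)" and U: "openin (seminorm_topology UNIV G) U" "scal c x \<in> U"
    by (cases z) auto
  then obtain q r where q: "q \<in> G" "r > 0" "\<And>w. q (w - scal c x) < r \<Longrightarrow> w \<in> U"
    unfolding openin_seminorm_topology_G by metis
  note sn = G_seminorm[OF q(1)]
  define d where "d = min 1 (r / (2 * (norm c + 1)))"
  define e where "e = r / (2 * (q x + 1))"
  have d: "d > 0" "d \<le> 1" "(norm c + 1) * d \<le> r / 2" and e: "e > 0" "e * q x < r / 2"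
  proof -
    have c1: "norm c + 1 > 0" by (simp add: add_nonneg_pos)
    have x1: "q x + 1 > 0" using seminorm_nonneg[OF sn, of x] by simp
    show "d > 0" "d \<le> 1" using c1 q(2) by (auto simp: d_def)
    have "d \<le> r / (2 * (norm c + 1))" by (simp add: d_def)
    then show "(norm c + 1) * d \<le> r / 2" using c1 by (simp add: field_simps)
    show "e > 0" using x1 q(2) by (simp add: e_def)
    have "e * q x < e * (q x + 1)" using \<open>e > 0\<close> by simp
    also have "\<dots> = r / 2" using x1 by (simp add: e_def field_simps)
    finally show "e * q x < r / 2" .
  qed
  \<comment> \<open>The cap at 1 gives \<open>norm a \<le> norm c + 1\<close>, the factor against
    which d was chosen.\<close>
  define e' where "e' = min 1 e"
  let ?V = "ball c e' \<times> {w. q (w - x) < d}"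
  have "openin (prod_topology euclidean (seminorm_topology UNIV G)) ?V"
    by (simp add: openin_prod_Times_iff openin_G_ball q(1))
  moreover have "z \<in> ?V" using d e z by (simp add: seminorm_0[OF sn] e'_def)
  moreover have "scal a b \<in> U" if "a \<in> ball c e'" "q (b - x) < d" for a b
  proof (rule q(3))
    have ac: "norm (a - c) < e'" using that by (simp add: dist_norm norm_minus_commute)
    have na: "norm a \<le> norm c + 1"
      using norm_triangle_ineq[of "a - c" c] ac by (simp add: e'_def)
    have "scal a b - scal c x = scal a (b - x) + scal (a - c) x"
      by (simp add: scale_right_diff_distrib scale_left_diff_distrib)
    then have "q (scal a b - scal c x) \<le> norm a * q (b - x) + norm (a - c) * q x"
      using seminorm_add[OF sn, of "scal a (b - x)" "scal (a - c) x"] by (simp add: seminorm_scal[OF sn])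
    also have "\<dots> \<le> (norm c + 1) * d + e * q x"
      using na that ac seminorm_nonneg[OF sn] e(1) by (intro add_mono mult_mono) (auto simp: e'_def)
    also have "\<dots> < r" using d e by simp
    finally show "q (scal a b - scal c x) < r" .
  qed
  ultimately show "\<exists>V. openin (prod_topology euclidean (seminorm_topology UNIV G)) V \<and>
       z \<in> V \<and> (\<forall>y\<in>V. (case y of (c, x) \<Rightarrow> scal c x) \<in> U)"
    by (intro exI[of _ ?V] conjI) auto
qed (auto simp: topspace_seminorm_topology_G)

lemma tau_le_G: "openin \<tau> U \<Longrightarrow> openin (seminorm_topology UNIV G) U"
  unfolding openin_tau openin_seminorm_topology_G using P_subset_G by meson

text \<open>Differences of points of Z have norm at most 2K, and on that ball a single p in P
  controls a given q in G. Relative to Z, a q-ball therefore contains a p-ball.\<close>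

lemma subtopology_G_bounded:
  assumes "bounded Z"
  shows "subtopology (seminorm_topology UNIV G) Z = subtopology \<tau> Z"
proof (rule topology_eq[THEN iffD2], intro allI iffI)
  fix S assume "openin (subtopology \<tau> Z) S"
  then show "openin (subtopology (seminorm_topology UNIV G) Z) S"
    unfolding openin_subtopology using tau_le_G by blast
next
  fix S assume "openin (subtopology (seminorm_topology UNIV G) Z) S"
  then obtain U where U: "openin (seminorm_topology UNIV G) U" "S = U \<inter> Z"
    unfolding openin_subtopology by blast
  obtain K where K: "\<And>x. x \<in> Z \<Longrightarrow> norm x \<le> K" using assms by (auto simp: bounded_iff)
  have "\<exists>T. openin \<tau> T \<and> x \<in> T \<and> T \<inter> Z \<subseteq> S" if x: "x \<in> S" for x
  proof -
    obtain q r where q: "q \<in> G" "r > 0" "\<And>w. q (w - x) < r \<Longrightarrow> w \<in> U"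
      using U x unfolding openin_seminorm_topology_G by (metis IntD1)
    obtain p d where p: "p \<in> P" "d > 0" "\<And>x. norm x \<le> K + K \<Longrightarrow> p x < d \<Longrightarrow> q x < r"
      using G_smallD[OF q(1,2), of "K + K"] by metis
    let ?T = "{y. p (y - x) < d}"
    have "\<exists>r>0. \<forall>y. p (y - z) < r \<longrightarrow> y \<in> ?T" if z: "z \<in> ?T" for z
    proof (intro exI conjI allI impI)
      show "d - p (z - x) > 0" using z by simp
      show "y \<in> ?T" if "p (y - z) < d - p (z - x)" for y
        using that seminorm_add[OF P_seminorm[OF p(1)], of "y - z" "z - x"] by simp
    qed
    then have "openin \<tau> ?T" using p(1) unfolding openin_tau by blast
    moreover have "x \<in> ?T" using p by (simp add: seminorm_0[OF P_seminorm])
    moreover have "y \<in> S" if "p (y - x) < d" "y \<in> Z" for y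
    proof -
      have "norm (y - x) \<le> K + K"
        using K[of x] K[of y] U x that norm_triangle_ineq4[of y x] by auto
      then show ?thesis using that q(3) p(3) U by auto
    qed
    ultimately show ?thesis by blast
  qed
  then obtain T where T: "\<And>x. x \<in> S \<Longrightarrow> openin \<tau> (T x) \<and> x \<in> T x \<and> T x \<inter> Z \<subseteq> S" by metis
  have "S = (\<Union>x\<in>S. T x) \<inter> Z" using T U by blast
  moreover have "openin \<tau> (\<Union>x\<in>S. T x)" using T by blast
  ultimately show "openin (subtopology \<tau> Z) S" unfolding openin_subtopology by blast
qed

lemma G_le_open:
  assumes "openin (seminorm_topology UNIV G) U"
  shows "open U"
  unfolding open_dist
proof
  fix x assume "x \<in> U"
  then obtain q r where q: "q \<in> G" "r > 0" "\<And>w. q (w - x) < r \<Longrightarrow> w \<in> U"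
    using assms unfolding openin_seminorm_topology_G by metis
  obtain C where C: "C > 0" "\<And>x. q x \<le> C * norm x" using G_le_norm[OF q(1)] by metis
  have "y \<in> U" if "dist y x < r / C" for y
  proof (rule q(3))
    have "C * norm (y - x) < r" using that C by (simp add: dist_norm field_simps)
    then show "q (y - x) < r" using C(2)[of "y - x"] by simp
  qed
  then show "\<exists>e>0. \<forall>y. dist y x < e \<longrightarrow> y \<in> U" using q C by (intro exI[of _ "r / C"]) auto
qed

lemma mixed_candidate_G: "mixed_candidate scal \<tau> (seminorm_topology UNIV G)"
  unfolding mixed_candidate_def linear_topology_def
  using topspace_seminorm_topology_G continuous_map_add_G continuous_map_scal_G
    subtopology_G_bounded tau_le_G G_le_open by simp

lemma mixed_candidate_gamma: "mixed_candidate scal \<tau> \<gamma>"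
  using mixed by (simp add: is_mixed_topology_def)

lemma topspace_gamma: "topspace \<gamma> = UNIV"
  using mixed_candidate_gamma by (simp add: mixed_candidate_def linear_topology_def)

lemma gamma_translate:
  assumes "openin \<gamma> U"
  shows "openin \<gamma> {y. x + y \<in> U}"
proof -
  have add: "continuous_map (prod_topology \<gamma> \<gamma>) \<gamma> (\<lambda>(x, y). x + y)"
    using mixed_candidate_gamma by (simp add: mixed_candidate_def linear_topology_def)
  have "continuous_map \<gamma> (prod_topology \<gamma> \<gamma>) (\<lambda>y. (x, y))"
    by (simp add: continuous_map_pairedI topspace_gamma)
  from continuous_map_compose[OF this add] have "continuous_map \<gamma> \<gamma> (\<lambda>y. x + y)" by (simp add: o_def)
  from openin_continuous_map_preimage[OF this assms] show ?thesis by (simp add: topspace_gamma)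
qed

lemma gamma_halve:
  assumes "openin \<gamma> U" "0 \<in> U"
  shows "\<exists>W. openin \<gamma> W \<and> 0 \<in> W \<and> (\<forall>x\<in>W. \<forall>y\<in>W. x + y \<in> U)"
proof -
  have add: "continuous_map (prod_topology \<gamma> \<gamma>) \<gamma> (\<lambda>(x, y). x + y)"
    using mixed_candidate_gamma by (simp add: mixed_candidate_def linear_topology_def)
  let ?S = "{z. (case z of (x, y) \<Rightarrow> x + y) \<in> U}"
  have S: "openin (prod_topology \<gamma> \<gamma>) ?S"
    using openin_continuous_map_preimage[OF add assms(1)] by (simp add: topspace_gamma)
  have "(0, 0) \<in> ?S" using assms(2) by simp
  from S[unfolded openin_prod_topology_alt, rule_format, OF this]
  obtain V W where VW: "openin \<gamma> V" "openin \<gamma> W" "0 \<in> V" "0 \<in> W" "V \<times> W \<subseteq> ?S"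
    by auto
  have "x + y \<in> U" if "x \<in> V \<inter> W" "y \<in> V \<inter> W" for x y
    using subsetD[OF VW(5), of "(x, y)"] that by simp
  then show ?thesis using VW(1-4) by (intro exI[of _ "V \<inter> W"]) auto
qed

text \<open>The two topologies agree on the ball of radius K. The conclusion has the form of the
  condition that defines G.\<close>

lemma gamma_nhd_ball:
  assumes U: "openin \<gamma> U" "0 \<in> U"
  shows "\<exists>p\<in>P. \<exists>e>0. \<forall>x. norm x \<le> K \<and> p x < e \<longrightarrow> x \<in> U"
proof -
  have "subtopology \<gamma> (cball 0 K) = subtopology \<tau> (cball 0 K)"
    using mixed_candidate_gamma by (simp add: mixed_candidate_def)
  moreover have "openin (subtopology \<gamma> (cball 0 K)) (U \<inter> cball 0 K)"
    using U(1) by (auto simp: openin_subtopology)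
  ultimately obtain T where T: "openin \<tau> T" "U \<inter> cball 0 K = T \<inter> cball 0 K"
    by (auto simp: openin_subtopology)
  show ?thesis
  proof (cases "K \<ge> 0")
    case True
    then have "0 \<in> T" using T U by (metis Int_iff centre_in_cball)
    then obtain p e where p: "p \<in> P" "e > 0" "\<And>y. p (y - 0) < e \<Longrightarrow> y \<in> T"
      using T(1) unfolding openin_tau by metis
    have "x \<in> U" if "norm x \<le> K" "p x < e" for x
    proof -
      have "x \<in> T \<inter> cball 0 K" using that p(3)[of x] by simp
      then show ?thesis using T(2) by blast
    qed
    then show ?thesis using p by blast
  next
    case False
    \<comment> \<open>For negative K no vector satisfies the norm bound.\<close>
    then show ?thesis using P_nonempty by (metis all_not_in_conv norm_ge_zero order_trans zero_less_one)
  qed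
qed

text \<open>Sums of neighbourhoods \<open>{p\<^sub>k < e\<^sub>k} \<inter> {\<parallel>\<cdot>\<parallel> \<le> k + 1}\<close> fit into a given \<open>\<gamma>\<close>-neighbourhood of 0, and the
  unit ball of the inf-convolution of \<open>p\<^sub>k / e\<^sub>k + \<parallel>\<cdot>\<parallel> / (k + 1)\<close> consists of such sums.\<close>

lemma gamma_le_G:
  assumes U: "openin \<gamma> U"
  shows "openin (seminorm_topology UNIV G) U"
  unfolding openin_seminorm_topology_G
proof
  fix x assume x: "x \<in> U"
  let ?U = "{y. x + y \<in> U}"
  have U0: "openin \<gamma> ?U \<and> 0 \<in> ?U"
    using gamma_translate[OF U, of x] x by simp
  \<comment> \<open>With the premise on V inside \<open>?Q\<close>, a choice exists for every set V,
    so a single halving map h can be iterated.\<close>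
  let ?Q = "\<lambda>V W. openin \<gamma> V \<and> 0 \<in> V \<longrightarrow> openin \<gamma> W \<and> 0 \<in> W \<and> (\<forall>x\<in>W. \<forall>y\<in>W. x + y \<in> V)"
  have "\<exists>W. ?Q V W" for V
    using gamma_halve[of V] by (cases "openin \<gamma> V \<and> 0 \<in> V") auto
  then have "\<exists>h. \<forall>V. ?Q V (h V)" by (intro choice allI)
  then obtain h where h: "\<And>V. openin \<gamma> V \<and> 0 \<in> V \<Longrightarrow>
      openin \<gamma> (h V) \<and> 0 \<in> h V \<and> (\<forall>x\<in>h V. \<forall>y\<in>h V. x + y \<in> V)"
    by auto
  define W where "W n = (h ^^ n) ?U" for n
  have W1: "openin \<gamma> (W n) \<and> 0 \<in> W n" for n
  proof (induction n)
    case 0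
    show ?case using U0 by (simp add: W_def)
  next
    case (Suc n)
    then show ?case using h[of "W n"] by (simp add: W_def)
  qed
  have W: "W 0 = ?U" "\<And>n. openin \<gamma> (W n)" "\<And>n. 0 \<in> W n"
    "\<And>n x y. x \<in> W (Suc n) \<Longrightarrow> y \<in> W (Suc n) \<Longrightarrow> x + y \<in> W n"
    using W1 h[OF W1] by (simp_all add: W_def)
  have "\<exists>p e. p \<in> P \<and> e > 0 \<and> (\<forall>x. norm x \<le> real (Suc n) \<and> p x < e \<longrightarrow> x \<in> W (Suc n))" for n
    using gamma_nhd_ball[OF W(2)[of "Suc n"] W(3), of "real (Suc n)"] by blast
  then obtain p e where p: "\<And>n. p n \<in> P" "\<And>n. e n > (0::real)"
    "\<And>n x. norm x \<le> real (Suc n) \<Longrightarrow> p n x < e n \<Longrightarrow> x \<in> W (Suc n)" by metis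
  define r where "r n x = p n x / e n + norm x / real (Suc n)" for n x
  have sn: "is_seminorm scal (r n)" for n
  proof (rule seminormI)
    fix x y
    have "p n (x + y) / e n \<le> (p n x + p n y) / e n"
      using p(2)[of n] seminorm_add[OF P_seminorm[OF p(1)]] by (intro divide_right_mono) auto
    moreover have "norm (x + y) / real (Suc n) \<le> (norm x + norm y) / real (Suc n)"
      by (intro divide_right_mono norm_triangle_ineq) simp
    ultimately show "r n (x + y) \<le> r n x + r n y"
      unfolding r_def add_divide_distrib by linarith
  qed (simp add: r_def seminorm_scal[OF P_seminorm[OF p(1)]] norm_scal distrib_left)
  have rW: "y \<in> W (Suc n)" if "r n y < 1" for n y
  proof (rule p(3))
    have 1: "p n y / e n \<ge> 0" using p(2)[of n] seminorm_nonneg[OF P_seminorm[OF p(1)]] by simp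
    have 2: "norm y / real (Suc n) \<ge> 0" by simp
    have "norm y / real (Suc n) < 1" using that 1 unfolding r_def by linarith
    then show "norm y \<le> real (Suc n)" by (simp add: field_simps)
    have "p n y / e n < 1" using that 2 unfolding r_def by linarith
    then show "p n y < e n" using p(2)[of n] by (simp add: field_simps)
  qed
  define q where "q = infconv r"
  have "q \<in> G"
    unfolding G_def
  proof (intro CollectI conjI allI impI)
    show "is_seminorm scal q" unfolding q_def by (rule seminorm_infconv[OF sn])
    fix K d :: real assume d: "d > 0"
    \<comment> \<open>One component is enough: for large n the norm part of \<open>r n\<close> is at
      most d/2 on the ball of radius K, and a small value of \<open>p n\<close> controls the other
      part.\<close>
    obtain n where n: "real (Suc n) > 2 * \<bar>K\<bar> / d" using reals_Archimedean2 by (metis less_SucI less_trans of_nat_less_iff lessI)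
    have "q x < d" if "norm x \<le> K" "p n x < d * e n / 2" for x
    proof -
      have "q x \<le> r n x" unfolding q_def by (rule infconv_le_component[OF sn])
      also have "\<dots> < d / 2 + d / 2"
      proof -
        have "p n x / e n < d / 2" using that p(2)[of n] by (simp add: field_simps)
        moreover have "norm x / real (Suc n) \<le> d / 2"
        proof -
          have "2 * norm x \<le> d * real (Suc n)" using n d that by (simp add: field_simps)
          then show ?thesis by (simp add: field_simps)
        qed
        ultimately show ?thesis unfolding r_def by linarith
      qed
      finally show ?thesis by simp
    qed
    moreover have "d * e n / 2 > 0" using d p(2)[of n] by simp
    ultimately show "\<exists>p\<in>P. \<exists>da>0. \<forall>x. norm x \<le> K \<and> p x < da \<longrightarrow> q x < d" using p(1) by blast
  qed
  moreover have "y \<in> U" if y: "q (y - x) < 1" for y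
  proof -
    obtain N z where z: "y - x = (\<Sum>k<N. z k)" "(\<Sum>k<N. r k (z k)) < 1"
      using infconv_lessD y unfolding q_def by metis
    have zW: "z k \<in> W (Suc k)" if "k < N" for k
    proof (rule rW)
      have "r k (z k) \<le> (\<Sum>k<N. r k (z k))"
        using that by (intro member_le_sum) (auto simp: seminorm_nonneg[OF sn])
      then show "r k (z k) < 1" using z by simp
    qed
    \<comment> \<open>The sum is built from the right: \<open>z m\<close> and the tail after m both
      lie in \<open>W (Suc m)\<close>, hence their sum lies in \<open>W m\<close>.\<close>
    have "m \<le> N \<Longrightarrow> (\<Sum>k=m..<N. z k) \<in> W m" for m
    proof (induction rule: inc_induct)
      case base
      then show ?case using W(3) by simp
    next
      case (step m)
      then have "(\<Sum>k=m..<N. z k) = z m + (\<Sum>k=Suc m..<N. z k)" by (simp add: sum.atLeast_Suc_lessThan)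
      then show ?case using W(4) zW[of m] step by auto
    qed
    from this[of 0] have "y - x \<in> W 0" using z by (simp add: atLeast0LessThan)
    then show ?thesis using W(1) by simp
  qed
  ultimately show "\<exists>q\<in>G. \<exists>r>0. \<forall>y. q (y - x) < r \<longrightarrow> y \<in> U"
    by (intro bexI[of _ q] exI[of _ 1]) auto
qed

lemma gamma_eq: "\<gamma> = seminorm_topology UNIV G"
  using gamma_le_G mixed mixed_candidate_G by (auto simp: topology_eq is_mixed_topology_def)

lemma openin_gamma:
  "openin \<gamma> U \<longleftrightarrow> (\<forall>x\<in>U. \<exists>q\<in>G. \<exists>r>0. \<forall>y. q (y - x) < r \<longrightarrow> y \<in> U)"
  unfolding gamma_eq by (rule openin_seminorm_topology_G)

lemma openin_gamma_ball: "q \<in> G \<Longrightarrow> openin \<gamma> {y. q (y - x) < r}"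
  unfolding gamma_eq by (rule openin_G_ball)

lemma generates_G: "generates scal G \<gamma>"
  using G_seminorm gamma_eq by (simp add: generates_def)

section \<open>Convergence, density and equicontinuity\<close>

lemma limitin_gamma: "limitin \<gamma> f x F \<longleftrightarrow> (\<forall>q\<in>G. ((\<lambda>i. q (f i - x)) \<longlongrightarrow> 0) F)"
  unfolding gamma_eq by (rule limitin_directed_seminorms[OF G_seminorm G_finite_dominated])

lemma tau_nhd_0:
  assumes "openin \<tau> U" "0 \<in> U"
  shows "\<exists>p\<in>P. \<exists>r>0. \<forall>y. p y < r \<longrightarrow> y \<in> U"
  using bspec[OF assms(1)[unfolded openin_tau] assms(2)] by simp

lemma gamma_imp_tau: "limitin \<gamma> f x F \<Longrightarrow> limitin \<tau> f x F"
  by (auto simp: limitin_gamma limitin_tau P_subset_G)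

lemma tau_bounded_imp_gamma:
  assumes "limitin \<tau> f x F" and K: "\<forall>\<^sub>F i in F. norm (f i) \<le> K"
  shows "limitin \<gamma> f x F"
  unfolding limitin_gamma
proof (intro ballI tendstoI)
  fix q and e :: real assume q: "q \<in> G" and e: "e > 0"
  obtain p d where p: "p \<in> P" "d > 0" "\<And>y. norm y \<le> K + norm x \<Longrightarrow> p y < d \<Longrightarrow> q y < e"
    using G_smallD[OF q e, of "K + norm x"] by metis
  have "\<forall>\<^sub>F i in F. p (f i - x) < d"
    using assms(1) p by (intro order_tendstoD(2)[where y = 0]) (auto simp: limitin_tau)
  then show "\<forall>\<^sub>F i in F. dist (q (f i - x)) 0 < e"
    using K
  proof eventually_elim
    case (elim i)
    then show ?case
      using p(3)[of "f i - x"] norm_triangle_ineq4[of "f i" x]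
      by (simp add: seminorm_nonneg[OF G_seminorm[OF q]])
  qed
qed

text \<open>The seminorm \<open>sup\<^sub>k p\<^sub>k / (k + 1)\<close> is \<open>\<gamma>\<close>-continuous; a suitable choice of the \<open>p\<^sub>k\<close> detects
  unboundedness of a sequence.\<close>

lemma gamma_convergent_bounded:
  assumes L: "limitin \<gamma> s x sequentially"
  shows "bounded (range s)"
proof (rule ccontr)
  assume unb: "\<not> bounded (range s)"
  have unb': "\<exists>n\<ge>N. norm (s n - x) > c" for N c
  proof (rule ccontr)
    assume "\<not> (\<exists>n\<ge>N. norm (s n - x) > c)"
    then have c: "norm (s n - x) \<le> c" if "n \<ge> N" for n using that by (auto simp: not_less)
    have "norm (s n) \<le> max (c + norm x) (Max (insert 0 ((\<lambda>n. norm (s n)) ` {..<N})))" for n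
    proof (cases "n < N")
      case True
      then have "norm (s n) \<le> Max (insert 0 ((\<lambda>n. norm (s n)) ` {..<N}))" by (intro Max_ge) auto
      then show ?thesis by simp
    next
      case False
      then show ?thesis using c[of n] norm_triangle_ineq[of "s n - x" x] by simp
    qed
    then have "bounded (range s)" unfolding bounded_iff by blast
    then show False using unb by simp
  qed
  \<comment> \<open>The index is required to be at least k, so that large deviations from x occur
    arbitrarily late in the sequence.\<close>
  have "\<exists>n p. n \<ge> k \<and> p \<in> P \<and> p (s n - x) > real (k + 1)" for k
  proof -
    obtain n where n: "n \<ge> k" "norm (s n - x) > real (k + 1)" using unb' by blast
    have "\<exists>p\<in>P. p (s n - x) > real (k + 1)"
      using n(2) norm_leI[of "s n - x" "real (k + 1)"] by (meson not_less)
    then show ?thesis using n by blast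
  qed
  then obtain n p where np: "\<And>k. n k \<ge> k" "\<And>k. p k \<in> P" "\<And>k. p k (s (n k) - x) > real (k + 1)" by metis
  define f where "f k y = p k y / real (k + 1)" for k y
  define q where "q y = (SUP k. f k y)" for y
  have f_le: "f k y \<le> norm y / real (k + 1)" for k y
    using P_le_norm[OF np(2)] by (simp add: f_def divide_right_mono)
  have bdd: "bdd_above (range (\<lambda>k. f k y))" for y
  proof (rule bdd_aboveI2)
    show "f k y \<le> norm y" for k
    proof -
      have "norm y / real (k + 1) \<le> norm y / 1" by (intro divide_left_mono) auto
      then show ?thesis using f_le[of k y] by simp
    qed
  qed
  have fs: "is_seminorm scal (f k)" for k
  proof (rule seminormI)
    show "f k (y + z) \<le> f k y + f k z" for y z
      using seminorm_add[OF P_seminorm[OF np(2)], of k y z]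
      by (simp add: f_def add_divide_distrib[symmetric] divide_right_mono)
  qed (simp add: f_def seminorm_scal[OF P_seminorm[OF np(2)]])
  have "q \<in> G"
    unfolding G_def
  proof (intro CollectI conjI allI impI)
    show "is_seminorm scal q" unfolding q_def using fs bdd by (intro seminorm_SUP) auto
    fix K e :: real assume e: "e > 0"
    \<comment> \<open>Beyond m the weights 1/(k + 1) make the terms small on the norm ball; the
      finitely many earlier seminorms are dominated by one r in P.\<close>
    obtain m where m: "real m > 2 * \<bar>K\<bar> / e" using reals_Archimedean2 by blast
    obtain r C where r: "r \<in> P" "C > 0" "\<forall>g\<in>p ` {..m}. \<forall>y. g y \<le> C * r y"
      using P_finite_dominated[of "p ` {..m}"] np(2) by auto
    have "q y < e" if y: "norm y \<le> K" "r y < e / (2 * C)" for y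
    proof -
      have "f k y \<le> e / 2" for k
      proof (cases "k \<le> m")
        case True
        have "f k y \<le> p k y"
          using seminorm_nonneg[OF P_seminorm[OF np(2)], of k y] by (simp add: f_def divide_le_eq algebra_simps)
        also have "\<dots> \<le> C * r y" using r True by auto
        also have "\<dots> \<le> e / 2" using y r by (simp add: field_simps)
        finally show ?thesis .
      next
        case False
        then have "real m \<le> real (k + 1)" by simp
        then have "2 * \<bar>K\<bar> / e < real (k + 1)" using m by linarith
        then have "2 * \<bar>K\<bar> < e * real (k + 1)" using e by (simp add: field_simps)
        then have "norm y \<le> e / 2 * real (k + 1)" using y by simp
        then have "norm y / real (k + 1) \<le> e / 2" by (subst pos_divide_le_eq) auto
        then show ?thesis using f_le[of k y] by linarith
      qed
      then have "q y \<le> e / 2" unfolding q_def by (intro cSUP_least) auto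
      then show ?thesis using e by simp
    qed
    moreover have "e / (2 * C) > 0" using e r by simp
    ultimately show "\<exists>p\<in>P. \<exists>d>0. \<forall>x. norm x \<le> K \<and> p x < d \<longrightarrow> q x < e" using r(1) by blast
  qed
  then have "(\<lambda>i. q (s i - x)) \<longlonglongrightarrow> 0" using L by (simp add: limitin_gamma)
  then have "\<forall>\<^sub>F i in sequentially. q (s i - x) < 1" by (rule order_tendstoD(2)) simp
  then obtain N where N: "\<And>i. i \<ge> N \<Longrightarrow> q (s i - x) < 1" by (auto simp: eventually_sequentially)
  \<comment> \<open>The single term k = N already reaches 1 at the index \<open>n N\<close>, which
    is at least N.\<close>
  have "1 \<le> f N (s (n N) - x)" using np(3)[of N] by (simp add: f_def)
  also have "\<dots> \<le> q (s (n N) - x)" unfolding q_def by (intro cSUP_upper bdd) auto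
  finally show False using N[OF np(1)] by simp
qed

text \<open>This translates the notions built from norm-bounded \<tau>-convergent sequences, such as
  bi-density, bi-cores and bi-closedness, into sequential convergence for \<gamma>.\<close>

lemma gamma_seq_iff:
  "limitin \<gamma> s x sequentially \<longleftrightarrow> limitin \<tau> s x sequentially \<and> bounded (range s)"
proof
  assume R: "limitin \<tau> s x sequentially \<and> bounded (range s)"
  then obtain K where "\<forall>n. norm (s n) \<le> K" by (auto simp: bounded_iff)
  then show "limitin \<gamma> s x sequentially" using R by (intro tau_bounded_imp_gamma[of _ _ _ K]) auto
qed (use gamma_convergent_bounded gamma_imp_tau in auto)

text \<open>This is where the space being C-sequential enters.\<close>

lemma G_sequentialI:
  assumes q: "is_seminorm scal q"
    and seq: "\<And>s. bounded (range s) \<Longrightarrow> limitin \<tau> s 0 sequentially \<Longrightarrow> (\<lambda>n. q (s n)) \<longlonglongrightarrow> 0"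
  shows "q \<in> G"
proof -
  have op: "openin \<gamma> {x. q x < e}" for e
  proof -
    have "convex {x. q x < e}"
    proof (rule convexI)
      fix x y u v assume *: "x \<in> {x. q x < e}" "y \<in> {x. q x < e}" "0 \<le> (u::real)" "0 \<le> v" "u + v = 1"
      have "q (u *\<^sub>R x + v *\<^sub>R y) \<le> u * q x + v * q y"
        using seminorm_add[OF q, of "u *\<^sub>R x" "v *\<^sub>R y"] * by (simp add: seminorm_scaleR[OF q])
      also have "\<dots> < e" using * by (intro convex_bound_lt) auto
      finally show "u *\<^sub>R x + v *\<^sub>R y \<in> {x. q x < e}" by simp
    qed
    moreover have "sequentially_open \<gamma> {x. q x < e}"
      unfolding sequentially_open_def
    proof (intro ballI allI impI)
      fix x s assume x: "x \<in> {x. q x < e}" and s: "limitin \<gamma> s x sequentially"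
      have "limitin \<gamma> (\<lambda>n. s n - x) 0 sequentially" using s by (simp add: limitin_gamma)
      then have "(\<lambda>n. q (s n - x)) \<longlonglongrightarrow> 0" using seq gamma_seq_iff by blast
      then have "\<forall>\<^sub>F n in sequentially. q (s n - x) < e - q x" using x by (intro order_tendstoD(2)) auto
      then show "\<forall>\<^sub>F n in sequentially. s n \<in> {x. q x < e}"
      proof eventually_elim
        case (elim n)
        then show ?case using seminorm_add[OF q, of "s n - x" x] by simp
      qed
    qed
    ultimately show ?thesis using C_seq unfolding C_sequential_def by blast
  qed
  \<comment> \<open>Inside each norm ball, the \<gamma>-open q-ball contains a p-ball around 0 for
    some p in P; this is membership in G.\<close>
  show ?thesis
    unfolding G_def
  proof (intro CollectI conjI allI impI q)
    fix K e :: real assume "e > 0"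
    then have "0 \<in> {x. q x < e}" by (simp add: seminorm_0[OF q])
    from gamma_nhd_ball[OF op this, of K]
    show "\<exists>p\<in>P. \<exists>d>0. \<forall>x. norm x \<le> K \<and> p x < d \<longrightarrow> q x < e" by simp
  qed
qed

lemma gamma_limit_unique:
  assumes "limitin \<gamma> f x F" "limitin \<gamma> f y F" "F \<noteq> bot"
  shows "x = y"
proof -
  have "norm (x - y) \<le> 0"
  proof (rule norm_leI)
    fix p assume p: "p \<in> P"
    note sn = P_seminorm[OF p]
    have "((\<lambda>i. p (f i - x) + p (f i - y)) \<longlongrightarrow> 0 + 0) F"
      using assms p by (intro tendsto_add) (auto simp: limitin_gamma P_subset_G)
    moreover have "p (x - y) \<le> p (f i - x) + p (f i - y)" for i
      using seminorm_diff[OF sn, of "f i - y" "f i - x"] by simp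
    ultimately show "p (x - y) \<le> 0"
      using tendsto_lowerbound[of _ "0 + 0" F "p (x - y)"] assms(3) by auto
  qed
  then show ?thesis by simp
qed

lemma tau_limit_unique:
  assumes "limitin \<tau> f x F" "limitin \<tau> f y F" "F \<noteq> bot"
  shows "x = y"
  using assms saks limitin_Hausdorff_unique unfolding saks_space_def by metis

lemma G_separates: "(\<And>q. q \<in> G \<Longrightarrow> q x = 0) \<Longrightarrow> x = 0"
  using norm_leI[of x 0] P_subset_G by fastforce

text \<open>The norm is a supremum of \<tau>-continuous seminorms and hence lower semicontinuous for
  \<tau>.\<close>

lemma norm_limit_le:
  assumes "limitin \<tau> f x F" "F \<noteq> bot" "\<forall>\<^sub>F i in F. norm (f i) \<le> c"
  shows "norm x \<le> c"
proof (rule norm_leI)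
  fix p assume p: "p \<in> P"
  note sn = P_seminorm[OF p]
  have "((\<lambda>i. p (f i - x) + c) \<longlongrightarrow> 0 + c) F"
    using assms p by (intro tendsto_add) (auto simp: limitin_tau)
  moreover have "\<forall>\<^sub>F i in F. p x \<le> p (f i - x) + c"
    using assms(3)
  proof eventually_elim
    case (elim i)
    then show ?case using seminorm_diff[OF sn, of "f i" "f i - x"] P_le_norm[OF p, of "f i"] by simp
  qed
  ultimately show "p x \<le> c"
    using tendsto_lowerbound[of _ "0 + c" F "p x"] assms(2) by auto
qed

definition gCauchy :: "(nat \<Rightarrow> 'a) \<Rightarrow> bool" where
  "gCauchy s \<longleftrightarrow> (\<forall>q\<in>G. \<forall>e>0. \<exists>N. \<forall>m\<ge>N. \<forall>n\<ge>N. q (s m - s n) < e)"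

lemma gCauchyD: "gCauchy s \<Longrightarrow> q \<in> G \<Longrightarrow> e > 0 \<Longrightarrow> \<exists>N. \<forall>m\<ge>N. \<forall>n\<ge>N. q (s m - s n) < e"
  by (simp add: gCauchy_def)

lemma gCauchy_convergent:
  assumes "gCauchy s"
  obtains l where "limitin \<gamma> s l sequentially"
proof -
  have "\<exists>N. \<forall>m\<ge>N. \<forall>n\<ge>N. s m - s n \<in> U" if U: "openin \<gamma> U \<and> 0 \<in> U" for U
  proof -
    obtain q r where q: "q \<in> G" "r > 0" "\<And>y. q (y - 0) < r \<Longrightarrow> y \<in> U"
      using U unfolding openin_gamma by metis
    then show ?thesis using gCauchyD[OF assms q(1,2)] by (metis diff_zero)
  qed
  then show thesis using seq_complete that unfolding sequentially_complete_def by blast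
qed

lemma convergent_gCauchy:
  assumes "limitin \<gamma> s l sequentially"
  shows "gCauchy s"
  unfolding gCauchy_def
proof (intro ballI allI impI)
  fix q and e :: real assume q: "q \<in> G" and e: "e > 0"
  note sn = G_seminorm[OF q]
  have "\<forall>\<^sub>F i in sequentially. q (s i - l) < e/2"
    using assms q e by (intro order_tendstoD(2)[where y = 0]) (auto simp: limitin_gamma)
  then obtain N where N: "\<And>i. i \<ge> N \<Longrightarrow> q (s i - l) < e/2" by (auto simp: eventually_sequentially)
  have "q (s m - s n) < e" if "m \<ge> N" "n \<ge> N" for m n
    using N[of m] N[of n] that seminorm_diff[OF sn, of "s m - l" "s n - l"] by simp
  then show "\<exists>N. \<forall>m\<ge>N. \<forall>n\<ge>N. q (s m - s n) < e" by blast
qed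

lemma dense_gamma_iff:
  "dense_in_topology \<gamma> N \<longleftrightarrow> (\<forall>x. \<forall>q\<in>G. \<forall>e>0. \<exists>y\<in>N. q (y - x) < e)" (is "?L \<longleftrightarrow> ?R")
proof
  assume L: ?L
  show ?R
  proof (intro allI ballI impI)
    fix x q and e :: real assume q: "q \<in> G" and e: "e > 0"
    have cl: "x \<in> \<gamma> closure_of N" using L by (simp add: dense_in_topology_def topspace_gamma)
    have "x \<in> {y. q (y - x) < e}" using e by (simp add: seminorm_0[OF G_seminorm[OF q]])
    then show "\<exists>y\<in>N. q (y - x) < e"
      using conjunct2[OF cl[unfolded in_closure_of], rule_format, OF conjI[OF _ openin_gamma_ball[OF q, of x e]]]
      by auto
  qed
next
  assume R: ?R
  have "x \<in> \<gamma> closure_of N" for x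
    unfolding in_closure_of topspace_gamma
  proof (intro conjI allI impI UNIV_I)
    fix U assume "x \<in> U \<and> openin \<gamma> U"
    then obtain q r where q: "q \<in> G" "r > 0" "\<And>y. q (y - x) < r \<Longrightarrow> y \<in> U"
      unfolding openin_gamma by metis
    then show "\<exists>y. y \<in> N \<and> y \<in> U" using R by meson
  qed
  then show ?L by (auto simp: dense_in_topology_def topspace_gamma)
qed

lemma bi_dense_iff: "bi_dense \<tau> N \<longleftrightarrow> (\<forall>x. \<exists>s. range s \<subseteq> N \<and> limitin \<gamma> s x sequentially)"
  unfolding bi_dense_def gamma_seq_iff by blast

lemma bi_dense_imp_dense:
  assumes "bi_dense \<tau> N"
  shows "dense_in_topology \<gamma> N"
  unfolding dense_gamma_iff
proof (intro allI ballI impI)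
  fix x q and e :: real assume q: "q \<in> G" and e: "e > 0"
  obtain s where s: "range s \<subseteq> N" "limitin \<gamma> s x sequentially" using assms bi_dense_iff by blast
  have "\<forall>\<^sub>F i in sequentially. q (s i - x) < e"
    using s q e by (intro order_tendstoD(2)[where y = 0]) (auto simp: limitin_gamma)
  then obtain i where "q (s i - x) < e" by (auto simp: eventually_sequentially)
  then show "\<exists>y\<in>N. q (y - x) < e" using s by blast
qed

section \<open>Continuous linear maps and equicontinuous families\<close>

lemma lin_add: "Vector_Spaces.linear scal scal T \<Longrightarrow> T (x + y) = T x + T y"
  by (simp add: Vector_Spaces.linear_iff)

lemma lin_scal: "Vector_Spaces.linear scal scal T \<Longrightarrow> T (scal c x) = scal c (T x)"
  by (simp add: Vector_Spaces.linear_iff)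

lemma linI:
  "(\<And>x y. T (x + y) = T x + T y) \<Longrightarrow> (\<And>c x. T (scal c x) = scal c (T x)) \<Longrightarrow> Vector_Spaces.linear scal scal T"
  using vector_space_axioms by (simp add: Vector_Spaces.linear_iff)

lemma lin_scaleR: "Vector_Spaces.linear scal scal T \<Longrightarrow> T (r *\<^sub>R x) = r *\<^sub>R T x"
  using lin_scal[of T "of_real r" x] by (simp add: scal_of_real)

lemma lin_0: "Vector_Spaces.linear scal scal T \<Longrightarrow> T 0 = 0"
  using lin_scaleR[of T 0 0] by simp

lemma lin_minus: "Vector_Spaces.linear scal scal T \<Longrightarrow> T (- x) = - T x"
  using lin_scaleR[of T "-1" x] by simp

lemma lin_diff: "Vector_Spaces.linear scal scal T \<Longrightarrow> T (x - y) = T x - T y"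
  using lin_add[of T x "- y"] lin_minus[of T y] by simp

lemma lin_bounded_linear:
  assumes "Vector_Spaces.linear scal scal T" "\<And>x. norm (T x) \<le> K * norm x"
  shows "bounded_linear T"
  using assms by (intro bounded_linear_intro[of _ K]) (auto simp: lin_add lin_scaleR mult.commute)

text \<open>Continuity at 0 in seminorm form. No constant appears because G contains the nonnegative
  multiples of its members.\<close>

definition gcont :: "('a \<Rightarrow> 'a) \<Rightarrow> bool" where
  "gcont T \<longleftrightarrow> Vector_Spaces.linear scal scal T \<and> (\<forall>q\<in>G. \<exists>q'\<in>G. \<forall>x. q (T x) \<le> q' x)"

lemma gcont_linear: "gcont T \<Longrightarrow> Vector_Spaces.linear scal scal T"
  by (simp add: gcont_def)

lemma gcontD: "gcont T \<Longrightarrow> q \<in> G \<Longrightarrow> \<exists>q'\<in>G. \<forall>x. q (T x) \<le> q' x"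
  by (simp add: gcont_def)

lemma gcont_scal: "gcont (scal c)"
  unfolding gcont_def
proof (intro conjI ballI)
  show "Vector_Spaces.linear scal scal (scal c)"
    by (intro linI) (auto simp: scale_right_distrib scale_left_commute)
  fix q assume "q \<in> G"
  then show "\<exists>q'\<in>G. \<forall>x. q (scal c x) \<le> q' x"
    by (intro bexI[OF _ G_mult[of q "norm c"]]) (auto simp: seminorm_scal[OF G_seminorm])
qed

lemma gcont_limit:
  assumes T: "gcont T" and L: "limitin \<gamma> f x F"
  shows "limitin \<gamma> (\<lambda>i. T (f i)) (T x) F"
  unfolding limitin_gamma
proof
  fix q assume q: "q \<in> G"
  then obtain q' where q': "q' \<in> G" "\<And>x. q (T x) \<le> q' x" using gcontD[OF T] by blast
  show "((\<lambda>i. q (T (f i) - T x)) \<longlongrightarrow> 0) F"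
  proof (rule tendsto_sandwich[OF _ _ tendsto_const])
    show "((\<lambda>i. q' (f i - x)) \<longlongrightarrow> 0) F" using L q' by (simp add: limitin_gamma)
    show "\<forall>\<^sub>F i in F. q (T (f i) - T x) \<le> q' (f i - x)"
      using q' lin_diff[OF gcont_linear[OF T]] by (metis (mono_tags, lifting) always_eventually)
  qed (simp add: seminorm_nonneg[OF G_seminorm[OF q]])
qed

lemma gcont_continuous:
  assumes "gcont T"
  shows "continuous_operator scal \<gamma> T"
  unfolding continuous_operator_def
proof
  show "continuous_map \<gamma> \<gamma> T"
    unfolding continuous_map_eq_topcontinuous_at topcontinuous_at_def topspace_gamma
  proof (intro ballI conjI allI impI UNIV_I)
    fix x U assume "openin \<gamma> U \<and> T x \<in> U"
    then obtain q r where q: "q \<in> G" "r > 0" "\<And>y. q (y - T x) < r \<Longrightarrow> y \<in> U"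
      unfolding openin_gamma by metis
    obtain q' where q': "q' \<in> G" "\<And>x. q (T x) \<le> q' x" using gcontD[OF assms q(1)] by blast
    have "T y \<in> U" if "q' (y - x) < r" for y
      using q(3)[of "T y"] q'(2)[of "y - x"] that by (simp add: lin_diff[OF gcont_linear[OF assms]])
    then show "\<exists>V. openin \<gamma> V \<and> x \<in> V \<and> (\<forall>y\<in>V. T y \<in> U)"
      using openin_gamma_ball[OF q'(1), of x r] q(2) seminorm_0[OF G_seminorm[OF q'(1)]]
      by (intro exI[of _ "{y. q' (y - x) < r}"]) auto
  qed auto
qed (use assms gcont_linear in auto)

text \<open>The witness is \<open>sup\<^sub>j q \<circ> T\<^sub>j\<close>, which lies in \<open>G\<close>.\<close>

lemma equicontinuousI:
  assumes lin: "\<And>j. j \<in> J \<Longrightarrow> Vector_Spaces.linear scal scal (T j)"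
    and bound: "\<And>j x. j \<in> J \<Longrightarrow> norm (T j x) \<le> C * norm x"
    and small: "\<And>s p e. bounded (range s) \<Longrightarrow> limitin \<tau> s 0 sequentially \<Longrightarrow> p \<in> P \<Longrightarrow> e > 0 \<Longrightarrow>
       \<forall>\<^sub>F n in sequentially. \<forall>j\<in>J. p (T j (s n)) < e"
    and q: "q \<in> G"
  shows "\<exists>q'\<in>G. \<forall>j\<in>J. \<forall>x. q (T j x) \<le> q' x"
proof (cases "J = {}")
  case True
  then show ?thesis using q by auto
next
  case False
  note sn = G_seminorm[OF q]
  obtain D where D: "D > 0" "\<And>x. q x \<le> D * norm x" using G_le_norm[OF q] by metis
  define q' where "q' x = (SUP j\<in>J. q (T j x))" for x
  have bdd: "bdd_above ((\<lambda>j. q (T j x)) ` J)" for x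
  proof (rule bdd_aboveI2)
    show "q (T j x) \<le> D * (C * norm x)" if "j \<in> J" for j
      using D(2)[of "T j x"] bound[OF that, of x] D(1) by (meson less_imp_le mult_left_mono order_trans)
  qed
  have sn_j: "is_seminorm scal (\<lambda>x. q (T j x))" if "j \<in> J" for j
    using seminorm_add[OF sn] seminorm_scal[OF sn] by (intro seminormI) (auto simp: lin_add[OF lin[OF that]] lin_scal[OF lin[OF that]])
  have "q' \<in> G"
  proof (rule G_sequentialI)
    show "is_seminorm scal q'" unfolding q'_def using False sn_j bdd by (intro seminorm_SUP) auto
    fix s assume s: "bounded (range s)" "limitin \<tau> s 0 sequentially"
    obtain B where B: "\<And>n. norm (s n) \<le> B" using s(1) by (auto simp: bounded_iff)
    show "(\<lambda>n. q' (s n)) \<longlonglongrightarrow> 0"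
    proof (rule tendstoI)
      fix e :: real assume e: "e > 0"
      \<comment> \<open>All images lie in one norm ball, where a single p in P controls q; so
        smallness along the seminorms in P suffices. The absolute value makes the radius right
        whatever the sign of C.\<close>
      obtain p d where p: "p \<in> P" "d > 0" "\<And>y. norm y \<le> \<bar>C\<bar> * B \<Longrightarrow> p y < d \<Longrightarrow> q y < e/2"
        using G_smallD[OF q, of "e/2" "\<bar>C\<bar> * B"] e by (metis half_gt_zero)
      show "\<forall>\<^sub>F n in sequentially. dist (q' (s n)) 0 < e"
        using small[OF s p(1,2)]
      proof eventually_elim
        case (elim n)
        have "q (T j (s n)) \<le> e/2" if j: "j \<in> J" for j
        proof -
          have "norm (T j (s n)) \<le> C * norm (s n)" by (rule bound[OF j])
          also have "\<dots> \<le> \<bar>C\<bar> * B" using B[of n] by (intro mult_mono) auto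
          finally show ?thesis using p(3) elim j by fastforce
        qed
        then have "q' (s n) \<le> e/2" unfolding q'_def using False by (intro cSUP_least) auto
        moreover have "q' (s n) \<ge> 0"
          using seminorm_nonneg[OF seminorm_SUP[OF False sn_j bdd]] unfolding q'_def by simp
        ultimately show ?case using e by simp
      qed
    qed
  qed
  moreover have "q (T j x) \<le> q' x" if "j \<in> J" for j x
    unfolding q'_def using that by (intro cSUP_upper bdd)
  ultimately show ?thesis by blast
qed

lemma bi_equicontinuousD:
  assumes "bi_equicontinuous \<tau> J T" "bounded (range s)" "limitin \<tau> s 0 sequentially" "p \<in> P" "e > 0"
  shows "\<forall>\<^sub>F n in sequentially. \<forall>j\<in>J. p (T j (s n)) < e"
proof -
  have 0: "0 \<in> {y. p (y - 0) < e}" using assms seminorm_0[OF P_seminorm[OF assms(4)]] by simp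
  have "\<forall>\<^sub>F n in sequentially. \<forall>j\<in>J. T j (s n - 0) \<in> {y. p (y - 0) < e}"
    using assms(1)[unfolded bi_equicontinuous_def, rule_format, OF conjI[OF assms(2,3)]
        conjI[OF openin_tau_ball[OF assms(4)] 0]] .
  then show ?thesis by simp
qed

lemma bi_equicontinuousI:
  assumes lin: "\<And>j. j \<in> J \<Longrightarrow> Vector_Spaces.linear scal scal (T j)"
    and q: "\<And>q. q \<in> G \<Longrightarrow> \<exists>q'\<in>G. \<forall>j\<in>J. \<forall>x. q (T j x) \<le> q' x"
  shows "bi_equicontinuous \<tau> J T"
  unfolding bi_equicontinuous_def
proof (intro allI impI)
  fix s x U assume s: "bounded (range s) \<and> limitin \<tau> s x sequentially" and U: "openin \<tau> U \<and> 0 \<in> U"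
  then obtain p r where p: "p \<in> P" "r > 0" "\<And>y. p y < r \<Longrightarrow> y \<in> U" using tau_nhd_0 by metis
  obtain q' where q': "q' \<in> G" "\<And>j x. j \<in> J \<Longrightarrow> p (T j x) \<le> q' x" using q P_subset_G p(1) by metis
  have "limitin \<gamma> s x sequentially" using s gamma_seq_iff by blast
  then have "\<forall>\<^sub>F n in sequentially. q' (s n - x) < r"
    using q' p by (intro order_tendstoD(2)[where y = 0]) (auto simp: limitin_gamma)
  then show "\<forall>\<^sub>F n in sequentially. \<forall>j\<in>J. T j (s n - x) \<in> U"
    by eventually_elim (meson le_less_trans p(3) q'(2))
qed

lemma closure_of_prod_gamma:
  "(x, y) \<in> prod_topology \<gamma> \<gamma> closure_of W \<longleftrightarrow>
     (\<forall>q\<in>G. \<forall>e>0. \<exists>a b. (a, b) \<in> W \<and> q (a - x) < e \<and> q (b - y) < e)" (is "?L \<longleftrightarrow> ?R")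
proof
  assume L: ?L
  show ?R
  proof (intro ballI allI impI)
    fix q and e :: real assume q: "q \<in> G" and e: "e > 0"
    let ?V = "{a. q (a - x) < e} \<times> {b. q (b - y) < e}"
    have V: "openin (prod_topology \<gamma> \<gamma>) ?V"
      unfolding openin_prod_Times_iff using openin_gamma_ball[OF q] by blast
    have xy: "(x, y) \<in> ?V" using e by (simp add: seminorm_0[OF G_seminorm[OF q]])
    have "\<exists>z. z \<in> W \<and> z \<in> ?V"
      by (rule conjunct2[OF L[unfolded in_closure_of], rule_format, OF conjI[OF xy V]])
    then show "\<exists>a b. (a, b) \<in> W \<and> q (a - x) < e \<and> q (b - y) < e" by auto
  qed
next
  assume R: ?R
  show ?L
    unfolding in_closure_of
  proof (intro conjI allI impI)
    fix T assume "(x, y) \<in> T \<and> openin (prod_topology \<gamma> \<gamma>) T"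
    then have T: "openin (prod_topology \<gamma> \<gamma>) T" "(x, y) \<in> T" by auto
    from T(1)[unfolded openin_prod_topology_alt, rule_format, OF T(2)]
    obtain U V where UV: "openin \<gamma> U" "openin \<gamma> V" "x \<in> U" "y \<in> V" "U \<times> V \<subseteq> T"
      by auto
    obtain q r where q: "q \<in> G" "r > 0" "\<And>a. q (a - x) < r \<Longrightarrow> a \<in> U"
      using UV unfolding openin_gamma by metis
    obtain q' r' where q': "q' \<in> G" "r' > 0" "\<And>a. q' (a - y) < r' \<Longrightarrow> a \<in> V"
      using UV unfolding openin_gamma by metis
    define g where "g x = q x + q' x" for x
    have g: "g \<in> G" "\<forall>f\<in>{q,q'}. \<forall>x. f x \<le> g x"
      using G_add[OF q(1) q'(1)] seminorm_nonneg[OF G_seminorm] q(1) q'(1) by (auto simp: g_def[abs_def])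
    obtain a b where ab: "(a, b) \<in> W" "g (a - x) < min r r'" "g (b - y) < min r r'"
      using R[rule_format, OF g(1), of "min r r'"] q(2) q'(2) by auto
    have "q (a - x) < r" "q' (b - y) < r'"
      using ab(2,3) g(2) by (auto intro: le_less_trans)
    then have "a \<in> U" "b \<in> V" using q q' by auto
    then show "\<exists>z. z \<in> W \<and> z \<in> T" using ab UV by blast
  qed (simp add: topspace_gamma)
qed

text \<open>Limits of sequences need not exhaust the \<gamma>-closure of a graph, so closedness is
  phrased by approximation in one seminorm at a time. The same q serves both coordinates because G
  is closed under sums.\<close>

lemma gamma_closed_iff:
  "gamma_closed \<gamma> C \<longleftrightarrow> (\<forall>x y. (\<forall>q\<in>G. \<forall>e>0. \<exists>a\<in>dom C. q (a - x) < e \<and> q (the (C a) - y) < e) \<longrightarrow> C x = Some y)"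
proof -
  have graph: "(a, b) \<in> Map.graph C \<longleftrightarrow> a \<in> dom C \<and> b = the (C a)" for a b
    by (auto simp: Map.graph_def)
  have 1: "(\<exists>a b. (a \<in> dom C \<and> b = the (C a)) \<and> q (a - x) < e \<and> q (b - y) < e) \<longleftrightarrow>
      (\<exists>a\<in>dom C. q (a - x) < e \<and> q (the (C a) - y) < e)" for q x y and e :: real
    by blast
  have 2: "x \<in> dom C \<and> y = the (C x) \<longleftrightarrow> C x = Some y" for x y by auto
  have "gamma_closed \<gamma> C \<longleftrightarrow> prod_topology \<gamma> \<gamma> closure_of Map.graph C \<subseteq> Map.graph C"
    unfolding gamma_closed_def by (simp add: closure_of_subset_eq[symmetric] topspace_gamma)
  also have "\<dots> \<longleftrightarrow> (\<forall>x y. (x, y) \<in> prod_topology \<gamma> \<gamma> closure_of Map.graph C \<longrightarrow> (x, y) \<in> Map.graph C)"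
    by auto
  also have "\<dots> \<longleftrightarrow> (\<forall>x y. (\<forall>q\<in>G. \<forall>e>0. \<exists>a\<in>dom C. q (a - x) < e \<and> q (the (C a) - y) < e) \<longrightarrow> C x = Some y)"
    unfolding closure_of_prod_gamma graph 1 unfolding 2 ..
  finally show ?thesis .
qed

section \<open>Differentiation and primitives\<close>

lemma gamma_limit_add:
  assumes "limitin \<gamma> f x F" "limitin \<gamma> g y F"
  shows "limitin \<gamma> (\<lambda>i. f i + g i) (x + y) F"
  unfolding limitin_gamma
proof
  fix q assume q: "q \<in> G"
  have L: "((\<lambda>i. q (f i - x) + q (g i - y)) \<longlongrightarrow> 0 + 0) F"
    using assms q by (intro tendsto_add) (auto simp: limitin_gamma)
  show "((\<lambda>i. q (f i + g i - (x + y))) \<longlongrightarrow> 0) F"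
  proof (rule tendsto_sandwich[OF _ _ tendsto_const])
    show "((\<lambda>i. q (f i - x) + q (g i - y)) \<longlongrightarrow> 0) F" using L by simp
    show "\<forall>\<^sub>F i in F. q (f i + g i - (x + y)) \<le> q (f i - x) + q (g i - y)"
    proof (rule always_eventually, rule allI)
      show "q (f i + g i - (x + y)) \<le> q (f i - x) + q (g i - y)" for i
        using seminorm_add[OF G_seminorm[OF q], of "f i - x" "g i - y"] by (simp add: algebra_simps)
    qed
  qed (simp add: seminorm_nonneg[OF G_seminorm[OF q]])
qed

lemma gamma_limit_scal: "limitin \<gamma> f x F \<Longrightarrow> limitin \<gamma> (\<lambda>i. scal c (f i)) (scal c x) F"
  by (rule gcont_limit[OF gcont_scal])

lemma gamma_limit_scaleR: "limitin \<gamma> f x F \<Longrightarrow> limitin \<gamma> (\<lambda>i. r *\<^sub>R f i) (r *\<^sub>R x) F"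
  using gamma_limit_scal[of f x F "of_real r"] by (simp add: scal_of_real)

lemma gamma_limit_diff:
  assumes "limitin \<gamma> f x F" "limitin \<gamma> g y F"
  shows "limitin \<gamma> (\<lambda>i. f i - g i) (x - y) F"
  using gamma_limit_add[OF assms(1) gamma_limit_scaleR[OF assms(2), of "-1"]] by simp

lemma gamma_limit_const: "limitin \<gamma> (\<lambda>i. x) x F"
  by (simp add: topspace_gamma)

lemma seminorm_limit_le:
  assumes "q \<in> G" "limitin \<gamma> f x F" "F \<noteq> bot" "\<forall>\<^sub>F i in F. q (f i) \<le> c"
  shows "q x \<le> c"
proof -
  note sn = G_seminorm[OF assms(1)]
  have "((\<lambda>i. q (f i - x) + c) \<longlongrightarrow> 0 + c) F"
    using assms by (intro tendsto_add) (auto simp: limitin_gamma)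
  moreover have "\<forall>\<^sub>F i in F. q x \<le> q (f i - x) + c"
    using assms(4)
  proof eventually_elim
    case (elim i)
    then show ?case using seminorm_diff[OF sn, of "f i" "f i - x"] by simp
  qed
  ultimately show ?thesis
    using tendsto_lowerbound[of _ "0 + c" F "q x"] assms(3) by auto
qed

text \<open>The difference quotient is multiplied out, so \<open>s = t\<close> is allowed; the
  restriction \<open>s \<ge> 0\<close> makes this the right derivative at
  \<open>t = 0\<close>.\<close>

definition gderiv :: "(real \<Rightarrow> 'a) \<Rightarrow> 'a \<Rightarrow> real \<Rightarrow> bool" where
  "gderiv F y t \<longleftrightarrow> (\<forall>q\<in>G. \<forall>e>0. \<exists>d>0. \<forall>s\<ge>0. \<bar>s - t\<bar> < d \<longrightarrow> q (F s - F t - (s - t) *\<^sub>R y) \<le> e * \<bar>s - t\<bar>)"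

lemma gderivD:
  assumes "gderiv F y t" "q \<in> G" "e > 0"
  obtains d where "d > 0" "\<And>s. s \<ge> 0 \<Longrightarrow> \<bar>s - t\<bar> < d \<Longrightarrow> q (F s - F t - (s - t) *\<^sub>R y) \<le> e * \<bar>s - t\<bar>"
  using assms unfolding gderiv_def by meson

text \<open>A scalar majorant g takes the place of the integral of \<open>q (f t)\<close>. Near each
  point the estimate holds up to an arbitrarily small multiple of the length, and bisection chains
  such estimates over the interval.\<close>

lemma gderiv_mean_value:
  assumes ab: "0 \<le> a" "a \<le> b"
    and F: "\<And>t. a \<le> t \<Longrightarrow> t \<le> b \<Longrightarrow> gderiv F (f t) t"
    and q: "q \<in> G"
    and le: "\<And>t. a \<le> t \<Longrightarrow> t \<le> b \<Longrightarrow> q (f t) \<le> g' t"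
    and g: "\<And>t. a \<le> t \<Longrightarrow> t \<le> b \<Longrightarrow> (g has_real_derivative g' t) (at t within {a..b})"
  shows "q (F b - F a) \<le> g b - g a"
proof -
  note sn = G_seminorm[OF q]
  have main: "q (F b - F a) \<le> g b - g a + 2 * e * (b - a)" if e: "e > 0" for e
  proof -
    \<comment> \<open>The bisection principle also offers intervals that stick out of [a, b]; the
      premise of \<open>?Q\<close> discards them. The slope 2e accounts for one error from F and one
      from g.\<close>
    let ?Q = "\<lambda>u v. a \<le> u \<and> v \<le> b \<longrightarrow> q (F v - F u) \<le> g v - g u + 2 * e * (v - u)"
    have "?Q a b"
    proof (rule Bolzano[where P = ?Q, OF ab(2)])
      fix u v w assume *: "?Q u v" "?Q v w" "u \<le> v" "v \<le> w"
      show "?Q u w"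
      proof
        assume "a \<le> u \<and> w \<le> b"
        then have "q (F v - F u) \<le> g v - g u + 2 * e * (v - u)" "q (F w - F v) \<le> g w - g v + 2 * e * (w - v)"
          using * by auto
        moreover have "q (F w - F u) \<le> q (F w - F v) + q (F v - F u)"
          using seminorm_add[OF sn, of "F w - F v" "F v - F u"] by simp
        ultimately show "q (F w - F u) \<le> g w - g u + 2 * e * (w - u)" by (simp add: algebra_simps)
      qed
    next
      fix x assume x: "a \<le> x" "x \<le> b"
      obtain d where d: "d > 0" "\<And>s. s \<ge> 0 \<Longrightarrow> \<bar>s - x\<bar> < d \<Longrightarrow> q (F s - F x - (s - x) *\<^sub>R f x) \<le> e * \<bar>s - x\<bar>"
        using gderivD[OF F[OF x] q e] by metis
      obtain d' where d': "d' > 0"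
        "\<And>s. s \<in> {a..b} \<Longrightarrow> \<bar>s - x\<bar> < d' \<Longrightarrow> \<bar>g s - g x - g' x * (s - x)\<bar> \<le> e * \<bar>s - x\<bar>"
        using g[OF x] e unfolding has_field_derivative_def has_derivative_within_alt real_norm_def by metis
      have "?Q u v" if uv: "u \<le> x" "x \<le> v" "v - u < min d d'" for u v
      proof
        assume ab': "a \<le> u \<and> v \<le> b"
        have q1: "q (F v - F x - (v - x) *\<^sub>R f x) \<le> e * (v - x)"
          using d(2)[of v] uv ab ab' x by simp
        have q2: "q (F u - F x - (u - x) *\<^sub>R f x) \<le> e * (x - u)"
          using d(2)[of u] uv ab ab' by simp
        have g1: "\<bar>g v - g x - g' x * (v - x)\<bar> \<le> e * (v - x)" using d'(2)[of v] uv ab' by simp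
        have g2: "\<bar>g u - g x - g' x * (u - x)\<bar> \<le> e * (x - u)" using d'(2)[of u] uv ab' by simp
        let ?a = "F v - F x - (v - x) *\<^sub>R f x" and ?b = "F u - F x - (u - x) *\<^sub>R f x"
        have "F v - F u = (?a - ?b) + (v - u) *\<^sub>R f x" by (simp add: algebra_simps)
        then have "q (F v - F u) \<le> q (?a - ?b) + q ((v - u) *\<^sub>R f x)"
          using seminorm_add[OF sn, of "?a - ?b" "(v - u) *\<^sub>R f x"] by metis
        also have "\<dots> \<le> q ?a + q ?b + (v - u) * q (f x)"
          using seminorm_diff[OF sn, of ?a ?b] uv seminorm_scaleR[OF sn, of "v - u" "f x"]
          by (intro add_mono) auto
        also have "\<dots> \<le> e * (v - x) + e * (x - u) + (v - u) * g' x"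
          using q1 q2 le[OF x] uv by (intro add_mono mult_left_mono) auto
        also have "\<dots> \<le> g v - g u + 2 * e * (v - u)"
          using g1 g2 by (simp add: algebra_simps abs_le_iff)
        finally show "q (F v - F u) \<le> g v - g u + 2 * e * (v - u)" .
      qed
      then show "\<exists>d>0. \<forall>u v. u \<le> x \<and> x \<le> v \<and> v - u < d \<longrightarrow> ?Q u v"
        using d(1) d'(1) by (intro exI[of _ "min d d'"]) auto
    qed
    then show ?thesis by simp
  qed
  show ?thesis
  proof (rule field_le_epsilon)
    fix e :: real assume e: "e > 0"
    have "2 * (e / (2 * (b - a + 1))) * (b - a) \<le> e"
      using e ab by (simp add: field_simps)
    then show "q (F b - F a) \<le> g b - g a + e"
      using main[of "e / (2 * (b - a + 1))"] e ab by simp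
  qed
qed

lemma gderiv_mean_value_norm:
  assumes ab: "0 \<le> a" "a \<le> b"
    and F: "\<And>t. a \<le> t \<Longrightarrow> t \<le> b \<Longrightarrow> gderiv F (f t) t"
    and le: "\<And>t. a \<le> t \<Longrightarrow> t \<le> b \<Longrightarrow> norm (f t) \<le> g' t"
    and g: "\<And>t. a \<le> t \<Longrightarrow> t \<le> b \<Longrightarrow> (g has_real_derivative g' t) (at t within {a..b})"
  shows "norm (F b - F a) \<le> g b - g a"
  by (rule norm_leI, rule gderiv_mean_value[OF ab F P_subset_G _ g])
    (use le P_le_norm order_trans in blast)+

lemma gderiv_unique:
  assumes b: "0 \<le> b"
    and F: "\<And>t. 0 \<le> t \<Longrightarrow> t \<le> b \<Longrightarrow> gderiv F (f t) t"
    and H: "\<And>t. 0 \<le> t \<Longrightarrow> t \<le> b \<Longrightarrow> gderiv H (f t) t"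
    and "F 0 = H 0"
  shows "F b = H b"
proof -
  have D: "gderiv (\<lambda>s. F s - H s) 0 t" if t: "0 \<le> t" "t \<le> b" for t
    unfolding gderiv_def
  proof (intro ballI allI impI)
    fix q and e :: real assume q: "q \<in> G" and e: "e > 0"
    obtain d where d: "d > 0" "\<And>s. s \<ge> 0 \<Longrightarrow> \<bar>s - t\<bar> < d \<Longrightarrow> q (F s - F t - (s - t) *\<^sub>R f t) \<le> e/2 * \<bar>s - t\<bar>"
      using gderivD[OF F[OF t] q half_gt_zero[OF e]] by metis
    obtain d' where d': "d' > 0" "\<And>s. s \<ge> 0 \<Longrightarrow> \<bar>s - t\<bar> < d' \<Longrightarrow> q (H s - H t - (s - t) *\<^sub>R f t) \<le> e/2 * \<bar>s - t\<bar>"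
      using gderivD[OF H[OF t] q half_gt_zero[OF e]] by metis
    have "q (F s - H s - (F t - H t) - (s - t) *\<^sub>R 0) \<le> e * \<bar>s - t\<bar>" if "s \<ge> 0" "\<bar>s - t\<bar> < min d d'" for s
      using seminorm_diff[OF G_seminorm[OF q], of "F s - F t - (s - t) *\<^sub>R f t" "H s - H t - (s - t) *\<^sub>R f t"]
        d(2)[of s] d'(2)[of s] that by (simp add: algebra_simps)
    then show "\<exists>d>0. \<forall>s\<ge>0. \<bar>s - t\<bar> < d \<longrightarrow> q (F s - H s - (F t - H t) - (s - t) *\<^sub>R 0) \<le> e * \<bar>s - t\<bar>"
      using d(1) d'(1) by (intro exI[of _ "min d d'"]) auto
  qed
  have "norm ((F b - H b) - (F 0 - H 0)) \<le> (\<lambda>_. 0) b - (\<lambda>_. 0) 0"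
    by (rule gderiv_mean_value_norm[where f = "\<lambda>_. 0" and g' = "\<lambda>_. 0"]) (use b D in auto)
  then show ?thesis using assms(4) by simp
qed

lemma gderiv_gcont:
  assumes T: "gcont T" and F: "gderiv F y t"
  shows "gderiv (\<lambda>s. T (F s)) (T y) t"
  unfolding gderiv_def
proof (intro ballI allI impI)
  fix q and e :: real assume q: "q \<in> G" and e: "e > 0"
  obtain q' where q': "q' \<in> G" "\<And>x. q (T x) \<le> q' x" using gcontD[OF T q] by blast
  note l = gcont_linear[OF T]
  obtain d where d: "d > 0" "\<And>s. s \<ge> 0 \<Longrightarrow> \<bar>s - t\<bar> < d \<Longrightarrow> q' (F s - F t - (s - t) *\<^sub>R y) \<le> e * \<bar>s - t\<bar>"
    using gderivD[OF F q'(1) e] by metis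
  have "q (T (F s) - T (F t) - (s - t) *\<^sub>R T y) \<le> e * \<bar>s - t\<bar>" if "s \<ge> 0" "\<bar>s - t\<bar> < d" for s
  proof -
    have "T (F s) - T (F t) - (s - t) *\<^sub>R T y = T (F s - F t - (s - t) *\<^sub>R y)"
      by (simp add: lin_diff[OF l] lin_scaleR[OF l])
    then show ?thesis using d(2)[OF that] q'(2)[of "F s - F t - (s - t) *\<^sub>R y"] by simp
  qed
  then show "\<exists>d>0. \<forall>s\<ge>0. \<bar>s - t\<bar> < d \<longrightarrow> q (T (F s) - T (F t) - (s - t) *\<^sub>R T y) \<le> e * \<bar>s - t\<bar>"
    using d(1) by blast
qed

lemma gderiv_add:
  assumes F: "gderiv F x t" and H: "gderiv H y t"
  shows "gderiv (\<lambda>s. F s + H s) (x + y) t"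
  unfolding gderiv_def
proof (intro ballI allI impI)
  fix q and e :: real assume q: "q \<in> G" and e: "e > 0"
  obtain d where d: "d > 0" "\<And>s. s \<ge> 0 \<Longrightarrow> \<bar>s - t\<bar> < d \<Longrightarrow> q (F s - F t - (s - t) *\<^sub>R x) \<le> e/2 * \<bar>s - t\<bar>"
    using gderivD[OF F q half_gt_zero[OF e]] by metis
  obtain d' where d': "d' > 0" "\<And>s. s \<ge> 0 \<Longrightarrow> \<bar>s - t\<bar> < d' \<Longrightarrow> q (H s - H t - (s - t) *\<^sub>R y) \<le> e/2 * \<bar>s - t\<bar>"
    using gderivD[OF H q half_gt_zero[OF e]] by metis
  have "q (F s + H s - (F t + H t) - (s - t) *\<^sub>R (x + y)) \<le> e * \<bar>s - t\<bar>" if "s \<ge> 0" "\<bar>s - t\<bar> < min d d'" for s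
    using seminorm_add[OF G_seminorm[OF q], of "F s - F t - (s - t) *\<^sub>R x" "H s - H t - (s - t) *\<^sub>R y"]
      d(2)[of s] d'(2)[of s] that by (simp add: algebra_simps)
  then show "\<exists>d>0. \<forall>s\<ge>0. \<bar>s - t\<bar> < d \<longrightarrow> q (F s + H s - (F t + H t) - (s - t) *\<^sub>R (x + y)) \<le> e * \<bar>s - t\<bar>"
    using d(1) d'(1) by (intro exI[of _ "min d d'"]) auto
qed

lemma gderiv_const: "gderiv (\<lambda>s. x) 0 t"
  unfolding gderiv_def by (auto simp: seminorm_0[OF G_seminorm] intro: exI[of _ 1])

lemma gderiv_linear: "gderiv (\<lambda>s. s *\<^sub>R x) x t"
  unfolding gderiv_def by (auto simp: seminorm_0[OF G_seminorm] scaleR_diff_left intro: exI[of _ 1])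

lemma gderiv_diff: "gderiv F x t \<Longrightarrow> gderiv H y t \<Longrightarrow> gderiv (\<lambda>s. F s - H s) (x - y) t"
  using gderiv_add[OF _ gderiv_gcont[OF gcont_scal[of "-1"]], of F x t H y]
  by (simp add: scal_of_real[of "-1", simplified])

lemma gderiv_shift:
  assumes "gderiv F y (t + h)" "h \<ge> 0"
  shows "gderiv (\<lambda>s. F (s + h)) y t"
  unfolding gderiv_def
proof (intro ballI allI impI)
  fix q and e :: real assume q: "q \<in> G" and e: "e > 0"
  obtain d where d: "d > 0" "\<And>s. s \<ge> 0 \<Longrightarrow> \<bar>s - (t + h)\<bar> < d \<Longrightarrow> q (F s - F (t + h) - (s - (t + h)) *\<^sub>R y) \<le> e * \<bar>s - (t + h)\<bar>"
    using gderivD[OF assms(1) q e] by metis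
  have "q (F (s + h) - F (t + h) - (s - t) *\<^sub>R y) \<le> e * \<bar>s - t\<bar>" if "s \<ge> 0" "\<bar>s - t\<bar> < d" for s
    using d(2)[of "s + h"] that assms(2) by simp
  then show "\<exists>d>0. \<forall>s\<ge>0. \<bar>s - t\<bar> < d \<longrightarrow> q (F (s + h) - F (t + h) - (s - t) *\<^sub>R y) \<le> e * \<bar>s - t\<bar>"
    using d(1) by blast
qed

lemma gderiv_scaleR:
  assumes F: "gderiv F y t" and c: "(c has_real_derivative c') (at t)"
  shows "gderiv (\<lambda>s. c s *\<^sub>R F s) (c t *\<^sub>R y + c' *\<^sub>R F t) t"
  unfolding gderiv_def
proof (intro ballI allI impI)
  fix q and e :: real assume q: "q \<in> G" and e: "e > 0"
  note sn = G_seminorm[OF q]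
  \<comment> \<open>D adds up the coefficients of the three errors below: that of F, multiplied by
    \<open>c s\<close>; that of \<open>c s - c t\<close>, multiplied by y; and that of c, multiplied
    by \<open>F t\<close>.\<close>
  define D where "D = \<bar>c t\<bar> + 1 + q y + q (F t)"
  have D: "D > 0" using seminorm_nonneg[OF sn, of y] seminorm_nonneg[OF sn, of "F t"] by (simp add: D_def)
  define e' where "e' = e / D"
  have e': "e' > 0" "e' * D = e" using e D by (auto simp: e'_def)
  obtain d1 where d1: "d1 > 0" "\<And>s. s \<ge> 0 \<Longrightarrow> \<bar>s - t\<bar> < d1 \<Longrightarrow> q (F s - F t - (s - t) *\<^sub>R y) \<le> e' * \<bar>s - t\<bar>"
    using gderivD[OF F q e'(1)] by metis
  obtain d2 where d2: "d2 > 0" "\<And>s. \<bar>s - t\<bar> < d2 \<Longrightarrow> \<bar>c s - c t - c' * (s - t)\<bar> \<le> e' * \<bar>s - t\<bar>"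
    using c e'(1) unfolding has_field_derivative_def has_derivative_within_alt real_norm_def by (metis UNIV_I)
  have "isCont c t" using c by (rule DERIV_isCont)
  then have "\<exists>d>0. \<forall>s. \<bar>s - t\<bar> < d \<longrightarrow> \<bar>c s - c t\<bar> < min 1 e'"
    unfolding continuous_at_eps_delta dist_real_def using e'(1) by (elim allE[of _ "min 1 e'"] impE) auto
  then obtain d3 where d3: "d3 > 0" "\<And>s. \<bar>s - t\<bar> < d3 \<Longrightarrow> \<bar>c s - c t\<bar> < min 1 e'"
    by blast
  have "q (c s *\<^sub>R F s - c t *\<^sub>R F t - (s - t) *\<^sub>R (c t *\<^sub>R y + c' *\<^sub>R F t)) \<le> e * \<bar>s - t\<bar>"
    if s: "s \<ge> 0" "\<bar>s - t\<bar> < min d1 (min d2 d3)" for s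
  proof -
    let ?a = "c s *\<^sub>R (F s - F t - (s - t) *\<^sub>R y)" and ?b = "((c s - c t) * (s - t)) *\<^sub>R y"
      and ?c = "(c s - c t - c' * (s - t)) *\<^sub>R F t"
    have cs: "\<bar>c s\<bar> \<le> \<bar>c t\<bar> + 1" using d3(2)[of s] s by linarith
    have "q ?a \<le> (\<bar>c t\<bar> + 1) * (e' * \<bar>s - t\<bar>)"
      using d1(2)[of s] s cs seminorm_nonneg[OF sn] by (auto simp: seminorm_scaleR[OF sn] intro!: mult_mono)
    moreover have "q ?b \<le> e' * \<bar>s - t\<bar> * q y"
      using d3(2)[of s] s seminorm_nonneg[OF sn, of y]
      by (auto simp: seminorm_scaleR[OF sn] abs_mult intro!: mult_right_mono)
    moreover have "q ?c \<le> e' * \<bar>s - t\<bar> * q (F t)"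
      using d2(2)[of s] s seminorm_nonneg[OF sn, of "F t"]
      by (auto simp: seminorm_scaleR[OF sn] intro!: mult_right_mono)
    moreover have "q (?a + ?b + ?c) \<le> q ?a + q ?b + q ?c"
      using seminorm_add[OF sn, of "?a + ?b" ?c] seminorm_add[OF sn, of ?a ?b] by simp
    moreover have "?a + ?b + ?c = c s *\<^sub>R F s - c t *\<^sub>R F t - (s - t) *\<^sub>R (c t *\<^sub>R y + c' *\<^sub>R F t)"
      by (simp add: algebra_simps)
    moreover have "(\<bar>c t\<bar> + 1) * (e' * \<bar>s - t\<bar>) + e' * \<bar>s - t\<bar> * q y + e' * \<bar>s - t\<bar> * q (F t) = e' * D * \<bar>s - t\<bar>"
      by (simp add: D_def algebra_simps)
    ultimately show ?thesis using e'(2) by simp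
  qed
  then show "\<exists>d>0. \<forall>s\<ge>0. \<bar>s - t\<bar> < d \<longrightarrow>
      q (c s *\<^sub>R F s - c t *\<^sub>R F t - (s - t) *\<^sub>R (c t *\<^sub>R y + c' *\<^sub>R F t)) \<le> e * \<bar>s - t\<bar>"
    using d1(1) d2(1) d3(1) by (intro exI[of _ "min d1 (min d2 d3)"]) auto
qed

section \<open>Primitives as limits of Riemann sums\<close>

definition gcts :: "(real \<Rightarrow> 'a) \<Rightarrow> bool" where
  "gcts f \<longleftrightarrow> (\<forall>t\<ge>0. \<forall>q\<in>G. \<forall>e>0. \<exists>d>0. \<forall>s\<ge>0. \<bar>s - t\<bar> < d \<longrightarrow> q (f s - f t) < e)"

lemma gctsD:
  assumes "gcts f" "t \<ge> 0" "q \<in> G" "e > 0"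
  obtains d where "d > 0" "\<And>s. s \<ge> 0 \<Longrightarrow> \<bar>s - t\<bar> < d \<Longrightarrow> q (f s - f t) < e"
  using assms unfolding gcts_def by meson

text \<open>\<open>riemann f N\<close> is the primitive of the step function that takes the value \<open>f (k / (N + 1))\<close> on
  \<open>[k / (N + 1), (k + 1) / (N + 1))\<close> for \<open>k < (N + 1)\<^sup>2\<close>.\<close>

definition riemann :: "(real \<Rightarrow> 'a) \<Rightarrow> nat \<Rightarrow> real \<Rightarrow> 'a" where
  "riemann f N t = (\<Sum>k<(N + 1) * (N + 1).
     (min t (real (Suc k) / real (N + 1)) - min t (real k / real (N + 1))) *\<^sub>R f (real k / real (N + 1)))"

lemma riemann_0: "riemann f N 0 = 0"
  by (simp add: riemann_def min_def)

text \<open>The increment over [u, v] is a weighted sum of node values, the weights being the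
  overlaps of the cells with [u, v]. A cell that overlaps [u, v] has its left node at most one mesh
  width to the left of u; hence the range of s in the hypothesis.\<close>

lemma riemann_increment:
  assumes uv: "0 \<le> u" "u \<le> v" "v \<le> real (N + 1)" and q: "q \<in> G"
    and B: "\<And>s. s \<ge> 0 \<Longrightarrow> u - 1 / real (N + 1) \<le> s \<Longrightarrow> s \<le> v \<Longrightarrow> q (f s - y) \<le> B"
  shows "q (riemann f N v - riemann f N u - (v - u) *\<^sub>R y) \<le> (v - u) * B"
proof -
  note sn = G_seminorm[OF q]
  define n where "n = real (N + 1)"
  define K where "K = (N + 1) * (N + 1)"
  have n: "n > 0" by (simp add: n_def)
  define a where "a k = real k / n" for k
  have a_Suc: "a (Suc k) = a k + 1 / n" for k by (simp add: a_def add_divide_distrib)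
  have am: "a k < a (Suc k)" for k using n by (simp add: a_Suc)
  have a0: "a k \<ge> 0" for k using n by (simp add: a_def)
  \<comment> \<open>Length of the part of the k-th cell that lies in [u, v].\<close>
  define w where "w k = (min v (a (Suc k)) - min v (a k)) - (min u (a (Suc k)) - min u (a k))" for k
  have tel: "(\<Sum>k<K. min t (a (Suc k)) - min t (a k)) = t" if "0 \<le> t" "t \<le> n" for t
  proof -
    \<comment> \<open>The cells reach exactly up to N + 1, so they cover [0, v] whenever
      \<open>v \<le> real (N + 1)\<close>.\<close>
    have "real K = n * n" unfolding K_def n_def of_nat_mult ..
    then have "a K = n" using n by (simp add: a_def)
    then show ?thesis
      unfolding sum_lessThan_telescope[of "\<lambda>k. min t (a k)"] using that by (simp add: a_def)
  qed
  have sum_w: "(\<Sum>k<K. w k) = v - u"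
    unfolding w_def sum_subtractf using tel[of v] tel[of u] uv n_def by (simp add: sum_subtractf)
  have w0: "w k \<ge> 0" for k using uv am[of k] by (auto simp: w_def min_def)
  have wq: "w k * q (f (a k) - y) \<le> w k * B" for k
  proof (cases "a k \<le> v \<and> u \<le> a (Suc k)")
    case True
    then have "q (f (a k) - y) \<le> B" using B[of "a k"] a0 a_Suc[of k] by (auto simp: n_def)
    then show ?thesis by (intro mult_left_mono w0)
  next
    case False
    then have "w k = 0" using uv am[of k] by (auto simp: w_def min_def)
    then show ?thesis by simp
  qed
  have "riemann f N v - riemann f N u = (\<Sum>k<K. w k *\<^sub>R f (a k))"
    unfolding riemann_def K_def[symmetric] n_def[symmetric] a_def[symmetric] w_def
    by (simp add: sum_subtractf[symmetric] scaleR_diff_left)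
  moreover have "(v - u) *\<^sub>R y = (\<Sum>k<K. w k *\<^sub>R y)" by (simp add: sum_w[symmetric] scaleR_sum_left)
  ultimately have "riemann f N v - riemann f N u - (v - u) *\<^sub>R y = (\<Sum>k<K. w k *\<^sub>R (f (a k) - y))"
    by (simp add: sum_subtractf[symmetric] scaleR_diff_right)
  then have "q (riemann f N v - riemann f N u - (v - u) *\<^sub>R y) \<le> (\<Sum>k<K. w k * q (f (a k) - y))"
    using seminorm_sum[OF sn, of "\<lambda>k. w k *\<^sub>R (f (a k) - y)" "{..<K}"] w0
    by (simp add: seminorm_scaleR[OF sn])
  also have "\<dots> \<le> (\<Sum>k<K. w k * B)" by (intro sum_mono wq)
  also have "\<dots> = (v - u) * B" by (simp add: sum_w[symmetric] sum_distrib_right)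
  finally show ?thesis .
qed

text \<open>The bound is uniform in N and so serves twice: it compares two Riemann sums, and it
  survives the limit, where it becomes the derivative.\<close>

lemma riemann_local:
  assumes f: "gcts f" and t: "t \<ge> 0" and q: "q \<in> G" and e: "e > 0"
  obtains d N0 where "d > 0"
    "\<And>u v N. 0 \<le> u \<Longrightarrow> u \<le> t \<Longrightarrow> t \<le> v \<Longrightarrow> v - u < d \<Longrightarrow> N \<ge> N0 \<Longrightarrow>
       q (riemann f N v - riemann f N u - (v - u) *\<^sub>R f t) \<le> (v - u) * e"
proof -
  obtain d where d: "d > 0" "\<And>s. s \<ge> 0 \<Longrightarrow> \<bar>s - t\<bar> < d \<Longrightarrow> q (f s - f t) < e"
    using gctsD[OF f t q e] by metis
  \<comment> \<open>The first bound on N0 pushes the mesh below d/2; the second makes the cells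
    cover [0, t + d].\<close>
  obtain N0 where N0: "real N0 > max (2 / d) (t + d)" using reals_Archimedean2 by blast
  show thesis
  proof (rule that[of "d / 2" N0])
    fix u v N assume *: "0 \<le> u" "u \<le> t" "t \<le> v" "v - u < d / 2" "N \<ge> (N0::nat)"
    have N: "real (N + 1) > 2 / d" "real (N + 1) > t + d" using N0 *(5) by auto
    have "1 / real (N + 1) < d / 2"
      using N(1) d(1) by (simp add: field_simps)
    then have "q (f s - f t) \<le> e" if s: "s \<ge> 0" "u - 1 / real (N + 1) \<le> s" "s \<le> v" for s
    proof -
      assume n: "1 / real (N + 1) < d / 2"
      have "\<bar>s - t\<bar> < d" using n s * by linarith
      then show ?thesis using d(2)[OF s(1)] by simp
    qed
    then show "q (riemann f N v - riemann f N u - (v - u) *\<^sub>R f t) \<le> (v - u) * e"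
      using * N d(1) by (intro riemann_increment q) auto
  qed (use d in auto)
qed

text \<open>Near a point x both sums grow by almost \<open>(v - u) *\<^sub>R f x\<close>. Chaining
  these local comparisons by bisection does the work of uniform continuity on [0, t].\<close>

lemma riemann_Cauchy:
  assumes f: "gcts f" and t: "t \<ge> 0"
  shows "gCauchy (\<lambda>N. riemann f N t)"
  unfolding gCauchy_def
proof (intro ballI allI impI)
  fix q and e :: real assume q: "q \<in> G" and e: "e > 0"
  note sn = G_seminorm[OF q]
  define e' where "e' = e / (4 * (t + 1))"
  have e': "e' > 0" "2 * e' * t < e"
  proof -
    show "e' > 0" using e t by (simp add: e'_def)
    have "e' * (4 * (t + 1)) = e" using t by (simp add: e'_def)
    then have "e = 4 * (e' * t) + 4 * e'" by (simp add: algebra_simps)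
    moreover have "e' * t \<ge> 0" using \<open>e' > 0\<close> t by simp
    ultimately show "2 * e' * t < e" using \<open>e' > 0\<close> by simp
  qed
  let ?R = "riemann f"
  let ?Q = "\<lambda>u v. 0 \<le> u \<longrightarrow> (\<exists>N0. \<forall>N\<ge>N0. \<forall>M\<ge>N0. q ((?R N v - ?R N u) - (?R M v - ?R M u)) \<le> 2 * e' * (v - u))"
  have "?Q 0 t"
  proof (rule Bolzano[where P = ?Q, OF t])
    fix u v w assume *: "?Q u v" "?Q v w" "u \<le> v" "v \<le> w"
    show "?Q u w"
    proof
      assume u: "0 \<le> u"
      obtain N1 where N1: "\<And>N M. N \<ge> N1 \<Longrightarrow> M \<ge> N1 \<Longrightarrow> q ((?R N v - ?R N u) - (?R M v - ?R M u)) \<le> 2 * e' * (v - u)"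
        using *(1) u by blast
      obtain N2 where N2: "\<And>N M. N \<ge> N2 \<Longrightarrow> M \<ge> N2 \<Longrightarrow> q ((?R N w - ?R N v) - (?R M w - ?R M v)) \<le> 2 * e' * (w - v)"
        using *(2,3) u by (meson order_trans)
      have "q ((?R N w - ?R N u) - (?R M w - ?R M u)) \<le> 2 * e' * (w - u)" if "N \<ge> max N1 N2" "M \<ge> max N1 N2" for N M
        using seminorm_add[OF sn, of "(?R N v - ?R N u) - (?R M v - ?R M u)" "(?R N w - ?R N v) - (?R M w - ?R M v)"]
          N1[of N M] N2[of N M] that by (simp add: algebra_simps)
      then show "\<exists>N0. \<forall>N\<ge>N0. \<forall>M\<ge>N0. q ((?R N w - ?R N u) - (?R M w - ?R M u)) \<le> 2 * e' * (w - u)" by blast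
    qed
  next
    fix x assume x: "0 \<le> x" "x \<le> t"
    obtain d N0 where d: "d > 0"
      "\<And>u v N. 0 \<le> u \<Longrightarrow> u \<le> x \<Longrightarrow> x \<le> v \<Longrightarrow> v - u < d \<Longrightarrow> N \<ge> N0 \<Longrightarrow>
         q (?R N v - ?R N u - (v - u) *\<^sub>R f x) \<le> (v - u) * e'"
      using riemann_local[OF f x(1) q e'(1)] by metis
    have "q ((?R N v - ?R N u) - (?R M v - ?R M u)) \<le> 2 * e' * (v - u)"
      if "0 \<le> u" "u \<le> x" "x \<le> v" "v - u < d" "N \<ge> N0" "M \<ge> N0" for u v N M
      using seminorm_diff[OF sn, of "?R N v - ?R N u - (v - u) *\<^sub>R f x" "?R M v - ?R M u - (v - u) *\<^sub>R f x"]
        d(2)[of u v N] d(2)[of u v M] that by (simp add: algebra_simps)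
    then show "\<exists>d>0. \<forall>u v. u \<le> x \<and> x \<le> v \<and> v - u < d \<longrightarrow> ?Q u v"
      using d(1) by (intro exI[of _ d]) blast
  qed
  then obtain N0 where "\<And>N M. N \<ge> N0 \<Longrightarrow> M \<ge> N0 \<Longrightarrow> q (?R N t - ?R M t) \<le> 2 * e' * t"
    by (auto simp: riemann_0)
  then show "\<exists>N0. \<forall>m\<ge>N0. \<forall>n\<ge>N0. q (?R m t - ?R n t) < e" using e'(2) by (meson le_less_trans)
qed

text \<open>Sequential completeness supplies the limit of the Riemann sums at each time, and the
  local estimate on intervals around t passes to it.\<close>

lemma primitive_exists:
  assumes f: "gcts f"
  shows "\<exists>F. F 0 = 0 \<and> (\<forall>t\<ge>0. gderiv F (f t) t)"
proof -
  let ?R = "riemann f"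
  have "\<exists>l. limitin \<gamma> (\<lambda>N. ?R N t) l sequentially" if t: "t \<ge> 0" for t
    using gCauchy_convergent[OF riemann_Cauchy[OF f t]] by blast
  then obtain F where F: "\<And>t. t \<ge> 0 \<Longrightarrow> limitin \<gamma> (\<lambda>N. ?R N t) (F t) sequentially" by metis
  have "F 0 = 0"
    using gamma_limit_unique[OF F[of 0], of 0] gamma_limit_const[of 0] by (simp add: riemann_0)
  moreover have "gderiv F (f t) t" if t: "t \<ge> 0" for t
    unfolding gderiv_def
  proof (intro ballI allI impI)
    fix q and e :: real assume q: "q \<in> G" and e: "e > 0"
    note sn = G_seminorm[OF q]
    obtain d N0 where d: "d > 0"
      "\<And>u v N. 0 \<le> u \<Longrightarrow> u \<le> t \<Longrightarrow> t \<le> v \<Longrightarrow> v - u < d \<Longrightarrow> N \<ge> N0 \<Longrightarrow>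
         q (?R N v - ?R N u - (v - u) *\<^sub>R f t) \<le> (v - u) * e"
      using riemann_local[OF f t q e] by metis
    have est: "q (F v - F u - (v - u) *\<^sub>R f t) \<le> (v - u) * e" if uv: "0 \<le> u" "u \<le> t" "t \<le> v" "v - u < d" for u v
    proof (rule seminorm_limit_le[OF q])
      show "limitin \<gamma> (\<lambda>N. ?R N v - ?R N u - (v - u) *\<^sub>R f t) (F v - F u - (v - u) *\<^sub>R f t) sequentially"
        using uv by (intro gamma_limit_diff F gamma_limit_const) auto
      show "\<forall>\<^sub>F N in sequentially. q (?R N v - ?R N u - (v - u) *\<^sub>R f t) \<le> (v - u) * e"
        using d(2)[OF uv] unfolding eventually_sequentially by blast
    qed simp
    have "q (F s - F t - (s - t) *\<^sub>R f t) \<le> e * \<bar>s - t\<bar>" if s: "s \<ge> 0" "\<bar>s - t\<bar> < d" for s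
    proof (cases "s \<ge> t")
      case True
      then show ?thesis using est[of t s] s t by (simp add: mult.commute)
    next
      case False
      then have "q (F t - F s - (t - s) *\<^sub>R f t) \<le> e * \<bar>s - t\<bar>"
        using est[of s t] s t by (simp add: mult.commute)
      moreover have "F s - F t - (s - t) *\<^sub>R f t = - (F t - F s - (t - s) *\<^sub>R f t)"
        by (simp add: algebra_simps)
      ultimately show ?thesis using seminorm_minus[OF sn] by metis
    qed
    then show "\<exists>d>0. \<forall>s\<ge>0. \<bar>s - t\<bar> < d \<longrightarrow> q (F s - F t - (s - t) *\<^sub>R f t) \<le> e * \<bar>s - t\<bar>"
      using d(1) by blast
  qed
  ultimately show ?thesis by blast
qed

section \<open>Laplace transforms of bounded semigroups\<close>

lemma norm_imp_gamma_limit: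
  assumes "((\<lambda>i. norm (f i - x)) \<longlongrightarrow> 0) F"
  shows "limitin \<gamma> f x F"
  unfolding limitin_gamma
proof
  fix q assume q: "q \<in> G"
  obtain C where C: "C > 0" "\<And>x. q x \<le> C * norm x" using G_le_norm[OF q] by metis
  show "((\<lambda>i. q (f i - x)) \<longlongrightarrow> 0) F"
  proof (rule tendsto_sandwich[OF _ _ tendsto_const])
    show "((\<lambda>i. C * norm (f i - x)) \<longlongrightarrow> 0) F" using tendsto_mult_left[OF assms, of C] by simp
  qed (auto simp: seminorm_nonneg[OF G_seminorm[OF q]] C)
qed

lemma gamma_limit_compose:
  assumes "limitin \<gamma> f x F" "filterlim g F H"
  shows "limitin \<gamma> (\<lambda>i. f (g i)) x H"
  unfolding limitin_gamma
proof
  fix q assume "q \<in> G"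
  then have "((\<lambda>i. q (f i - x)) \<longlongrightarrow> 0) F" using assms(1) by (simp add: limitin_gamma)
  from filterlim_compose[OF this assms(2)] show "((\<lambda>i. q (f (g i) - x)) \<longlongrightarrow> 0) H" .
qed

lemma gderiv_cong:
  assumes "gderiv F y t" "t \<ge> 0" "\<And>s. s \<ge> 0 \<Longrightarrow> H s = F s" "z = y"
  shows "gderiv H z t"
  using assms unfolding gderiv_def by auto

lemma gcts_scaleR:
  assumes f: "gcts f" and c: "continuous_on {0..} (c :: real \<Rightarrow> real)"
  shows "gcts (\<lambda>t. c t *\<^sub>R f t)"
  unfolding gcts_def
proof (intro allI ballI impI)
  fix t :: real and q and e :: real assume t: "t \<ge> 0" and q: "q \<in> G" and e: "e > 0"
  note sn = G_seminorm[OF q]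
  define D where "D = \<bar>c t\<bar> + 1 + q (f t)"
  have D: "D > 0" using seminorm_nonneg[OF sn, of "f t"] by (simp add: D_def)
  define e' where "e' = min 1 (e / (2 * D))"
  have e': "e' > 0" "e' \<le> 1" "e' * D \<le> e / 2"
    using e D by (auto simp: e'_def min_def field_simps)
  obtain d where d: "d > 0" "\<And>s. s \<ge> 0 \<Longrightarrow> \<bar>s - t\<bar> < d \<Longrightarrow> q (f s - f t) < e'"
    using gctsD[OF f t q e'(1)] by metis
  have "\<exists>d>0. \<forall>s\<in>{0..}. dist s t < d \<longrightarrow> dist (c s) (c t) < e'"
    using c t e'(1) unfolding continuous_on_iff by auto
  then obtain d' where d': "d' > 0" "\<And>s. s \<ge> 0 \<Longrightarrow> \<bar>s - t\<bar> < d' \<Longrightarrow> \<bar>c s - c t\<bar> < e'"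
    by (auto simp: dist_real_def)
  have "q (c s *\<^sub>R f s - c t *\<^sub>R f t) < e" if s: "s \<ge> 0" "\<bar>s - t\<bar> < min d d'" for s
  proof -
    have cs: "\<bar>c s\<bar> \<le> \<bar>c t\<bar> + 1" using d'(2)[of s] s e'(2) by linarith
    have "c s *\<^sub>R f s - c t *\<^sub>R f t = c s *\<^sub>R (f s - f t) + (c s - c t) *\<^sub>R f t"
      by (simp add: algebra_simps)
    then have "q (c s *\<^sub>R f s - c t *\<^sub>R f t) \<le> \<bar>c s\<bar> * q (f s - f t) + \<bar>c s - c t\<bar> * q (f t)"
      using seminorm_add[OF sn, of "c s *\<^sub>R (f s - f t)" "(c s - c t) *\<^sub>R f t"]
      by (simp add: seminorm_scaleR[OF sn])
    also have "\<dots> \<le> (\<bar>c t\<bar> + 1) * e' + e' * q (f t)"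
      using cs d(2)[of s] d'(2)[of s] s seminorm_nonneg[OF sn] e'(1) by (intro add_mono mult_mono) auto
    also have "\<dots> = e' * D" by (simp add: D_def algebra_simps)
    finally show ?thesis using e'(3) e by linarith
  qed
  then show "\<exists>d>0. \<forall>s\<ge>0. \<bar>s - t\<bar> < d \<longrightarrow> q (c s *\<^sub>R f s - c t *\<^sub>R f t) < e"
    using d(1) d'(1) by (intro exI[of _ "min d d'"]) auto
qed

text \<open>The norm bound is global in time, \<gamma>-equicontinuity only local; this is why tails
  of Laplace integrals are treated in norm.\<close>

definition bounded_semigroup :: "real \<Rightarrow> (real \<Rightarrow> 'a \<Rightarrow> 'a) \<Rightarrow> bool" where
  "bounded_semigroup M T \<longleftrightarrow> (\<forall>t\<ge>0. gcont (T t)) \<and> (\<forall>x. T 0 x = x)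
     \<and> (\<forall>s\<ge>0. \<forall>t\<ge>0. \<forall>x. T (s + t) x = T s (T t x))
     \<and> (\<forall>t\<ge>0. \<forall>x. norm (T t x) \<le> M * norm x)
     \<and> (\<forall>x. gcts (\<lambda>t. T t x))
     \<and> (\<forall>q\<in>G. \<forall>b. \<exists>q'\<in>G. \<forall>t\<in>{0..b}. \<forall>x. q (T t x) \<le> q' x)"

text \<open>The integral of \<open>exp (- \<mu> * s) *\<^sub>R T s x\<close> over [0, t]. Its values
  at nonnegative times are unique, so the choice is harmless.\<close>

definition prim :: "(real \<Rightarrow> 'a \<Rightarrow> 'a) \<Rightarrow> real \<Rightarrow> 'a \<Rightarrow> real \<Rightarrow> 'a" where
  "prim T \<mu> x = (SOME F. F 0 = 0 \<and> (\<forall>t\<ge>0. gderiv F (exp (- \<mu> * t) *\<^sub>R T t x) t))"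

text \<open>\<open>lap T \<mu> x\<close> is the Laplace transform \<open>\<integral>\<^sub>0\<^sup>\<infinity> e\<^sup>-\<^sup>\<mu>\<^sup>t T(t)x dt\<close>.\<close>

definition lap :: "(real \<Rightarrow> 'a \<Rightarrow> 'a) \<Rightarrow> real \<Rightarrow> 'a \<Rightarrow> 'a" where
  "lap T \<mu> x = (SOME l. limitin \<gamma> (prim T \<mu> x) l at_top)"

text \<open>The resolvent of the generator at \<open>1 / h\<close>, scaled to a backward Euler step of size \<open>h\<close>.\<close>

definition euler :: "(real \<Rightarrow> 'a \<Rightarrow> 'a) \<Rightarrow> real \<Rightarrow> 'a \<Rightarrow> 'a" where
  "euler T h x = (1 / h) *\<^sub>R lap T (1 / h) x"

context
  fixes M :: real and T :: "real \<Rightarrow> 'a \<Rightarrow> 'a"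
  assumes sg: "bounded_semigroup M T" and M: "M \<ge> 0"
begin

lemma sg_gcont: "t \<ge> 0 \<Longrightarrow> gcont (T t)"
  and sg_0: "T 0 x = x"
  and sg_add: "s \<ge> 0 \<Longrightarrow> t \<ge> 0 \<Longrightarrow> T (s + t) x = T s (T t x)"
  and sg_norm: "t \<ge> 0 \<Longrightarrow> norm (T t x) \<le> M * norm x"
  and sg_gcts: "gcts (\<lambda>t. T t x)"
  and sg_equicont: "q \<in> G \<Longrightarrow> \<exists>q'\<in>G. \<forall>t\<in>{0..b}. \<forall>x. q (T t x) \<le> q' x"
  using sg by (simp_all add: bounded_semigroup_def)

lemma sg_linear: "t \<ge> 0 \<Longrightarrow> Vector_Spaces.linear scal scal (T t)"
  using sg_gcont gcont_linear by blast

lemma prim: "prim T \<mu> x 0 = 0 \<and> (\<forall>t\<ge>0. gderiv (prim T \<mu> x) (exp (- \<mu> * t) *\<^sub>R T t x) t)"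
proof -
  have "gcts (\<lambda>t. exp (- \<mu> * t) *\<^sub>R T t x)" by (intro gcts_scaleR sg_gcts continuous_intros)
  from someI_ex[OF primitive_exists[OF this]] show ?thesis unfolding prim_def .
qed

lemma prim_0: "prim T \<mu> x 0 = 0"
  using prim by blast

lemma prim_deriv: "t \<ge> 0 \<Longrightarrow> gderiv (prim T \<mu> x) (exp (- \<mu> * t) *\<^sub>R T t x) t"
  using prim by blast

lemma prim_unique:
  assumes "\<And>t. t \<ge> 0 \<Longrightarrow> gderiv F (exp (- \<mu> * t) *\<^sub>R T t x) t" "F 0 = 0" "t \<ge> 0"
  shows "prim T \<mu> x t = F t"
  by (rule gderiv_unique[OF assms(3)]) (use assms prim_deriv prim_0 in auto)

text \<open>The estimate is by a bound B of the whole orbit instead of M times the norm of x; this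
  is what lets powers of the resolvent be estimated without powers of M.\<close>

lemma prim_norm:
  assumes \<mu>: "\<mu> > 0" and B: "\<And>t. t \<ge> 0 \<Longrightarrow> norm (T t x) \<le> B" and ab: "0 \<le> a" "a \<le> b"
  shows "norm (prim T \<mu> x b - prim T \<mu> x a) \<le> B / \<mu> * (exp (- \<mu> * a) - exp (- \<mu> * b))"
proof -
  have "norm (prim T \<mu> x b - prim T \<mu> x a) \<le> (\<lambda>t. - (B / \<mu>) * exp (- \<mu> * t)) b - (\<lambda>t. - (B / \<mu>) * exp (- \<mu> * t)) a"
  proof (rule gderiv_mean_value_norm[OF ab])
    fix t assume t: "a \<le> t" "t \<le> b"
    show "gderiv (prim T \<mu> x) (exp (- \<mu> * t) *\<^sub>R T t x) t" using prim_deriv t ab by simp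
    show "norm (exp (- \<mu> * t) *\<^sub>R T t x) \<le> B * exp (- \<mu> * t)" using B[of t] t ab by simp
    show "((\<lambda>t. - (B / \<mu>) * exp (- \<mu> * t)) has_real_derivative B * exp (- \<mu> * t)) (at t within {a..b})"
      using \<mu> by (auto intro!: derivative_eq_intros)
  qed
  then show ?thesis by (simp add: algebra_simps)
qed

text \<open>As completeness is sequential, the limit is first taken along the integers. The norm
  estimate of the increments then upgrades it to a limit over real times.\<close>

lemma lap_exists:
  assumes \<mu>: "\<mu> > 0"
  shows "\<exists>l. limitin \<gamma> (prim T \<mu> x) l at_top"
proof -
  define K where "K = M * norm x / \<mu>"
  have K: "K \<ge> 0" using M \<mu> by (simp add: K_def)
  have bound: "norm (prim T \<mu> x b - prim T \<mu> x a) \<le> K * exp (- \<mu> * a)" if ab: "0 \<le> a" "a \<le> b" for a b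
  proof -
    have "norm (prim T \<mu> x b - prim T \<mu> x a) \<le> K * (exp (- \<mu> * a) - exp (- \<mu> * b))"
      unfolding K_def by (rule prim_norm[OF \<mu> sg_norm ab])
    also have "\<dots> \<le> K * exp (- \<mu> * a)" using K by (intro mult_left_mono) auto
    finally show ?thesis .
  qed
  have lim0: "((\<lambda>a. K * exp (- \<mu> * a)) \<longlongrightarrow> 0) at_top"
    using \<mu> by real_asymp
  have "gCauchy (\<lambda>n. prim T \<mu> x (real n))"
    unfolding gCauchy_def
  proof (intro ballI allI impI)
    fix q and e :: real assume q: "q \<in> G" and e: "e > 0"
    obtain C where C: "C > 0" "\<And>x. q x \<le> C * norm x" using G_le_norm[OF q] by metis
    have "\<forall>\<^sub>F a in at_top. K * exp (- \<mu> * a) < e / C"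
      using lim0 e C by (intro order_tendstoD(2)) auto
    then obtain a0 where a0: "\<And>a. a \<ge> a0 \<Longrightarrow> K * exp (- \<mu> * a) < e / C"
      by (auto simp: eventually_at_top_linorder)
    obtain N where N: "real N \<ge> a0" using real_arch_simple by blast
    have le: "q (prim T \<mu> x (real n) - prim T \<mu> x (real m)) < e" if "m \<ge> N" "n \<ge> m" for m n
    proof -
      have "norm (prim T \<mu> x (real n) - prim T \<mu> x (real m)) < e / C"
        using bound[of "real m" "real n"] a0[of "real m"] N that by simp
      then have "C * norm (prim T \<mu> x (real n) - prim T \<mu> x (real m)) < e"
        using C(1) by (simp add: field_simps)
      then show ?thesis using C(2) le_less_trans by blast
    qed
    have "q (prim T \<mu> x (real m) - prim T \<mu> x (real n)) < e" if "m \<ge> N" "n \<ge> N" for m n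
      using le[of m n] le[of n m] that
      by (cases "m \<le> n") (auto simp: seminorm_minus_commute[OF G_seminorm[OF q], of "prim T \<mu> x (real m)"])
    then show "\<exists>N. \<forall>m\<ge>N. \<forall>n\<ge>N. q (prim T \<mu> x (real m) - prim T \<mu> x (real n)) < e" by blast
  qed
  then obtain l where l: "limitin \<gamma> (\<lambda>n. prim T \<mu> x (real n)) l sequentially"
    by (rule gCauchy_convergent)
  have "norm (prim T \<mu> x a - l) \<le> K * exp (- \<mu> * a)" if a: "a \<ge> 0" for a
  proof (rule norm_limit_le)
    show "limitin \<tau> (\<lambda>n. prim T \<mu> x a - prim T \<mu> x (real n)) (prim T \<mu> x a - l) sequentially"
      by (intro gamma_imp_tau gamma_limit_diff gamma_limit_const l)
    have "norm (prim T \<mu> x a - prim T \<mu> x (real n)) \<le> K * exp (- \<mu> * a)" if "n \<ge> nat \<lceil>a\<rceil>" for n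
      using bound[of a "real n"] a that by (simp add: norm_minus_commute nat_le_iff ceiling_le_iff)
    then show "\<forall>\<^sub>F n in sequentially. norm (prim T \<mu> x a - prim T \<mu> x (real n)) \<le> K * exp (- \<mu> * a)"
      unfolding eventually_sequentially by blast
  qed simp
  then have "((\<lambda>a. norm (prim T \<mu> x a - l)) \<longlongrightarrow> 0) at_top"
    using lim0 by (intro tendsto_sandwich[OF _ _ tendsto_const lim0])
      (auto simp: eventually_at_top_linorder)
  then show ?thesis using norm_imp_gamma_limit by blast
qed

lemma lap_limit: "\<mu> > 0 \<Longrightarrow> limitin \<gamma> (prim T \<mu> x) (lap T \<mu> x) at_top"
  unfolding lap_def using someI_ex[OF lap_exists] .

lemma lap_unique: "\<mu> > 0 \<Longrightarrow> limitin \<gamma> (prim T \<mu> x) l at_top \<Longrightarrow> lap T \<mu> x = l"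
  using gamma_limit_unique[OF lap_limit] by (simp add: trivial_limit_at_top_linorder)

text \<open>Identities for Laplace transforms reduce to exhibiting a primitive that vanishes at 0
  and finding its limit at infinity.\<close>

lemma lap_eqI:
  assumes \<mu>: "\<mu> > 0" and F: "\<And>t. t \<ge> 0 \<Longrightarrow> gderiv F (exp (- \<mu> * t) *\<^sub>R T t x) t" "F 0 = 0"
    and l: "limitin \<gamma> F l at_top"
  shows "lap T \<mu> x = l"
proof (rule lap_unique[OF \<mu>])
  have "\<forall>\<^sub>F t in at_top. F t = prim T \<mu> x t"
    using prim_unique[OF F] by (intro eventually_mono[OF eventually_ge_at_top[of 0]]) simp
  then show "limitin \<gamma> (prim T \<mu> x) l at_top" using l limitin_transform_eventually by metis
qed

lemma lap_tail:
  assumes \<mu>: "\<mu> > 0" and B: "\<And>t. t \<ge> 0 \<Longrightarrow> norm (T t x) \<le> B" and b: "b \<ge> 0"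
  shows "norm (lap T \<mu> x - prim T \<mu> x b) \<le> B / \<mu> * exp (- \<mu> * b)"
proof (rule norm_limit_le)
  show "limitin \<tau> (\<lambda>a. prim T \<mu> x a - prim T \<mu> x b) (lap T \<mu> x - prim T \<mu> x b) at_top"
    by (intro gamma_imp_tau gamma_limit_diff gamma_limit_const lap_limit \<mu>)
  have B0: "B \<ge> 0" using B[of 0] norm_ge_zero order_trans by blast
  have "norm (prim T \<mu> x a - prim T \<mu> x b) \<le> B / \<mu> * exp (- \<mu> * b)" if "a \<ge> b" for a
  proof -
    have "norm (prim T \<mu> x a - prim T \<mu> x b) \<le> B / \<mu> * (exp (- \<mu> * b) - exp (- \<mu> * a))"
      by (rule prim_norm[OF \<mu> B b that])
    also have "\<dots> \<le> B / \<mu> * exp (- \<mu> * b)" using B0 \<mu> by (intro mult_left_mono) auto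
    finally show ?thesis .
  qed
  then show "\<forall>\<^sub>F a in at_top. norm (prim T \<mu> x a - prim T \<mu> x b) \<le> B / \<mu> * exp (- \<mu> * b)"
    unfolding eventually_at_top_linorder by blast
qed (simp add: trivial_limit_at_top_linorder)

lemma lap_norm_sup: "\<mu> > 0 \<Longrightarrow> (\<And>t. t \<ge> 0 \<Longrightarrow> norm (T t x) \<le> B) \<Longrightarrow> norm (lap T \<mu> x) \<le> B / \<mu>"
  using lap_tail[of \<mu> x B 0] by (simp add: prim_0)

lemma lap_norm: "\<mu> > 0 \<Longrightarrow> norm (lap T \<mu> x) \<le> M / \<mu> * norm x"
  using lap_norm_sup[of \<mu> x "M * norm x"] sg_norm by simp

lemma lap_add: "\<mu> > 0 \<Longrightarrow> lap T \<mu> (x + y) = lap T \<mu> x + lap T \<mu> y"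
proof (rule lap_eqI[where F = "\<lambda>t. prim T \<mu> x t + prim T \<mu> y t"])
  show "gderiv (\<lambda>t. prim T \<mu> x t + prim T \<mu> y t) (exp (- \<mu> * t) *\<^sub>R T t (x + y)) t" if t: "t \<ge> 0" for t
    using gderiv_add[OF prim_deriv[OF t, of \<mu> x] prim_deriv[OF t, of \<mu> y]]
    by (simp only: lin_add[OF sg_linear[OF t]] scaleR_add_right)
qed (auto simp: prim_0 intro!: gamma_limit_add lap_limit)

lemma lap_commute:
  assumes \<mu>: "\<mu> > 0" and A: "gcont A" "\<And>t x. t \<ge> 0 \<Longrightarrow> T t (A x) = A (T t x)"
  shows "lap T \<mu> (A x) = A (lap T \<mu> x)"
proof (rule lap_eqI[OF \<mu>, where F = "\<lambda>t. A (prim T \<mu> x t)"])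
  show "gderiv (\<lambda>t. A (prim T \<mu> x t)) (exp (- \<mu> * t) *\<^sub>R T t (A x)) t" if "t \<ge> 0" for t
    using gderiv_gcont[OF A(1) prim_deriv[OF that]] A(2)[OF that]
    by (simp add: lin_scaleR[OF gcont_linear[OF A(1)]])
  show "A (prim T \<mu> x 0) = 0" by (simp add: prim_0 lin_0[OF gcont_linear[OF A(1)]])
  show "limitin \<gamma> (\<lambda>t. A (prim T \<mu> x t)) (A (lap T \<mu> x)) at_top"
    by (rule gcont_limit[OF A(1) lap_limit[OF \<mu>]])
qed

lemma lap_scal: "\<mu> > 0 \<Longrightarrow> lap T \<mu> (scal c x) = scal c (lap T \<mu> x)"
  by (rule lap_commute[OF _ gcont_scal]) (simp_all add: lin_scal[OF sg_linear])

lemma lap_linear: "\<mu> > 0 \<Longrightarrow> Vector_Spaces.linear scal scal (lap T \<mu>)"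
  by (intro linI lap_add lap_scal)

lemma sg_commute: "s \<ge> 0 \<Longrightarrow> t \<ge> 0 \<Longrightarrow> T s (T t x) = T t (T s x)"
  by (metis add.commute sg_add)

lemma lap_sg: "\<mu> > 0 \<Longrightarrow> s \<ge> 0 \<Longrightarrow> T s (lap T \<mu> x) = lap T \<mu> (T s x)"
  by (rule lap_commute[symmetric]) (simp_all add: sg_gcont sg_commute)

text \<open>A substitution in the Laplace integral: shifting time by h turns it into an integral
  over [h, \<infinity>).\<close>

lemma lap_shift:
  assumes \<mu>: "\<mu> > 0" and h: "h \<ge> 0"
  shows "T h (lap T \<mu> x) = exp (\<mu> * h) *\<^sub>R (lap T \<mu> x - prim T \<mu> x h)"
  unfolding lap_sg[OF \<mu> h]
proof (rule lap_eqI[OF \<mu>, where F = "\<lambda>t. exp (\<mu> * h) *\<^sub>R (prim T \<mu> x (t + h) - prim T \<mu> x h)"])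
  fix t :: real assume t: "t \<ge> 0"
  have "gderiv (\<lambda>t. prim T \<mu> x (t + h)) (exp (- \<mu> * (t + h)) *\<^sub>R T (t + h) x) t"
    using t h by (intro gderiv_shift prim_deriv) auto
  then have "gderiv (\<lambda>t. prim T \<mu> x (t + h) - prim T \<mu> x h) (exp (- \<mu> * (t + h)) *\<^sub>R T (t + h) x - 0) t"
    by (intro gderiv_diff gderiv_const)
  from gderiv_gcont[OF gcont_scal[of "of_real (exp (\<mu> * h))"] this]
  have "gderiv (\<lambda>t. exp (\<mu> * h) *\<^sub>R (prim T \<mu> x (t + h) - prim T \<mu> x h))
      ((exp (\<mu> * h) * exp (- \<mu> * (t + h))) *\<^sub>R T (t + h) x) t"
    by (simp add: scal_of_real)
  moreover have "exp (\<mu> * h) * exp (- \<mu> * (t + h)) = exp (- \<mu> * t)"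
    by (simp add: exp_add[symmetric] algebra_simps)
  ultimately show "gderiv (\<lambda>t. exp (\<mu> * h) *\<^sub>R (prim T \<mu> x (t + h) - prim T \<mu> x h)) (exp (- \<mu> * t) *\<^sub>R T t (T h x)) t"
    using t h by (simp add: sg_add)
next
  have "filterlim (\<lambda>t::real. t + h) at_top at_top" by real_asymp
  then have "limitin \<gamma> (\<lambda>t. prim T \<mu> x (t + h)) (lap T \<mu> x) at_top"
    by (rule gamma_limit_compose[OF lap_limit[OF \<mu>]])
  then show "limitin \<gamma> (\<lambda>t. exp (\<mu> * h) *\<^sub>R (prim T \<mu> x (t + h) - prim T \<mu> x h))
      (exp (\<mu> * h) *\<^sub>R (lap T \<mu> x - prim T \<mu> x h)) at_top"
    by (intro gamma_limit_scaleR gamma_limit_diff gamma_limit_const)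
qed simp

text \<open>By the shift formula the orbit is a scalar exponential times a constant minus a
  primitive, so the product rule applies. For the generator A and its resolvent R at \<mu> this says
  A R = \<mu> R - 1.\<close>

lemma lap_orbit_deriv:
  assumes \<mu>: "\<mu> > 0" and t: "t \<ge> 0"
  shows "gderiv (\<lambda>t. T t (lap T \<mu> x)) (T t (\<mu> *\<^sub>R lap T \<mu> x - x)) t"
proof -
  have "gderiv (\<lambda>t. lap T \<mu> x - prim T \<mu> x t) (0 - exp (- \<mu> * t) *\<^sub>R T t x) t"
    by (intro gderiv_diff gderiv_const prim_deriv t)
  moreover have "((\<lambda>t. exp (\<mu> * t)) has_real_derivative \<mu> * exp (\<mu> * t)) (at t)"
    by (auto intro!: derivative_eq_intros)
  ultimately have D: "gderiv (\<lambda>t. exp (\<mu> * t) *\<^sub>R (lap T \<mu> x - prim T \<mu> x t))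
     (exp (\<mu> * t) *\<^sub>R (0 - exp (- \<mu> * t) *\<^sub>R T t x) + (\<mu> * exp (\<mu> * t)) *\<^sub>R (lap T \<mu> x - prim T \<mu> x t)) t"
    by (rule gderiv_scaleR)
  have 1: "exp (\<mu> * t) *\<^sub>R (0 - exp (- \<mu> * t) *\<^sub>R T t x) + (\<mu> * exp (\<mu> * t)) *\<^sub>R (lap T \<mu> x - prim T \<mu> x t)
      = \<mu> *\<^sub>R T t (lap T \<mu> x) - T t x"
    unfolding lap_shift[OF \<mu> t] by (simp add: exp_minus)
  have 2: "\<mu> *\<^sub>R T t (lap T \<mu> x) - T t x = T t (\<mu> *\<^sub>R lap T \<mu> x - x)"
    by (simp add: lin_diff[OF sg_linear[OF t]] lin_scaleR[OF sg_linear[OF t]])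
  show ?thesis
    by (rule gderiv_cong[OF D t lap_shift[OF \<mu>] trans[OF 2[symmetric] 1[symmetric]]])
qed

text \<open>Here z plays the role of the generator applied to y. The function
  \<open>y - exp (- \<mu> * t) *\<^sub>R T t y\<close> is the primitive belonging to
  \<open>\<mu> *\<^sub>R y - z\<close> and tends to y, so the resolvent is a left inverse.\<close>

lemma lap_inverse:
  assumes \<mu>: "\<mu> > 0" and y: "\<And>t. t \<ge> 0 \<Longrightarrow> gderiv (\<lambda>t. T t y) (T t z) t"
  shows "lap T \<mu> (\<mu> *\<^sub>R y - z) = y"
proof (rule lap_eqI[OF \<mu>, where F = "\<lambda>t. y - exp (- \<mu> * t) *\<^sub>R T t y"])
  fix t :: real assume t: "t \<ge> 0"
  have "((\<lambda>t. exp (- \<mu> * t)) has_real_derivative - \<mu> * exp (- \<mu> * t)) (at t)"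
    by (auto intro!: derivative_eq_intros)
  from gderiv_diff[OF gderiv_const[of y] gderiv_scaleR[OF y[OF t] this]]
  have "gderiv (\<lambda>t. y - exp (- \<mu> * t) *\<^sub>R T t y)
      (0 - (exp (- \<mu> * t) *\<^sub>R T t z + (- \<mu> * exp (- \<mu> * t)) *\<^sub>R T t y)) t" .
  moreover have "0 - (exp (- \<mu> * t) *\<^sub>R T t z + (- \<mu> * exp (- \<mu> * t)) *\<^sub>R T t y)
      = exp (- \<mu> * t) *\<^sub>R T t (\<mu> *\<^sub>R y - z)"
    by (simp add: lin_diff[OF sg_linear[OF t]] lin_scaleR[OF sg_linear[OF t]] algebra_simps)
  ultimately show "gderiv (\<lambda>t. y - exp (- \<mu> * t) *\<^sub>R T t y) (exp (- \<mu> * t) *\<^sub>R T t (\<mu> *\<^sub>R y - z)) t" by simp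
next
  have lim: "((\<lambda>t. M * norm y * exp (- \<mu> * t)) \<longlongrightarrow> 0) at_top" using \<mu> by real_asymp
  have le: "norm (y - exp (- \<mu> * t) *\<^sub>R T t y - y) \<le> M * norm y * exp (- \<mu> * t)" if "t \<ge> 0" for t
  proof -
    have "norm (y - exp (- \<mu> * t) *\<^sub>R T t y - y) = exp (- \<mu> * t) * norm (T t y)" by simp
    also have "\<dots> \<le> exp (- \<mu> * t) * (M * norm y)" by (intro mult_left_mono sg_norm that) simp
    finally show ?thesis by (simp add: mult.commute)
  qed
  have "((\<lambda>t. norm (y - exp (- \<mu> * t) *\<^sub>R T t y - y)) \<longlongrightarrow> 0) at_top"
  proof (rule tendsto_sandwich[OF _ _ tendsto_const lim])
    show "\<forall>\<^sub>F t in at_top. norm (y - exp (- \<mu> * t) *\<^sub>R T t y - y) \<le> M * norm y * exp (- \<mu> * t)"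
      by (rule eventually_mono[OF eventually_ge_at_top[of 0] le])
  qed simp
  then show "limitin \<gamma> (\<lambda>t. y - exp (- \<mu> * t) *\<^sub>R T t y) y at_top" by (rule norm_imp_gamma_limit)
qed (simp add: sg_0)

text \<open>The resolvent at \<nu> produces a differentiable orbit, to which the left inverse
  property at \<mu> applies.\<close>

lemma resolvent_identity:
  assumes "\<mu> > 0" "\<nu> > 0"
  shows "lap T \<mu> x = lap T \<nu> x + (\<nu> - \<mu>) *\<^sub>R lap T \<mu> (lap T \<nu> x)"
proof -
  have "lap T \<mu> (\<mu> *\<^sub>R lap T \<nu> x - (\<nu> *\<^sub>R lap T \<nu> x - x)) = lap T \<nu> x"
    by (intro lap_inverse lap_orbit_deriv assms)
  moreover have "\<mu> *\<^sub>R lap T \<nu> x - (\<nu> *\<^sub>R lap T \<nu> x - x) = x - (\<nu> - \<mu>) *\<^sub>R lap T \<nu> x"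
    by (simp add: algebra_simps)
  ultimately show ?thesis
    by (simp add: lin_diff[OF lap_linear[OF assms(1)]] lin_scaleR[OF lap_linear[OF assms(1)]] diff_eq_eq)
qed

lemma orbit_lipschitz:
  assumes "\<And>t. t \<ge> 0 \<Longrightarrow> gderiv (\<lambda>t. T t y) (T t z) t" "0 \<le> s" "s \<le> t"
  shows "norm (T t y - T s y) \<le> M * norm z * (t - s)"
proof -
  have "norm (T t y - T s y) \<le> (\<lambda>t. M * norm z * t) t - (\<lambda>t. M * norm z * t) s"
    by (rule gderiv_mean_value_norm[OF assms(2,3), where f = "\<lambda>t. T t z" and g' = "\<lambda>t. M * norm z"])
      (use assms sg_norm in \<open>auto intro!: derivative_eq_intros\<close>)
  then show ?thesis by (simp add: algebra_simps)
qed

text \<open>The constant depends on M and the norm of x, but neither on \<mu> nor on T. This makes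
  orbits equicontinuous in time uniformly over a family of semigroups.\<close>

lemma lap_lipschitz:
  assumes \<mu>: "\<mu> > 0" and st: "0 \<le> s" "0 \<le> t"
  shows "norm (T t (lap T \<mu> x) - T s (lap T \<mu> x)) \<le> M * (M + 1) * norm x * \<bar>t - s\<bar>"
proof -
  define z where "z = \<mu> *\<^sub>R lap T \<mu> x - x"
  have "norm z \<le> (M + 1) * norm x"
    using norm_triangle_ineq4[of "\<mu> *\<^sub>R lap T \<mu> x" x] lap_norm[OF \<mu>, of x] \<mu>
    by (simp add: z_def field_simps)
  then have "M * norm z * \<bar>t - s\<bar> \<le> M * ((M + 1) * norm x) * \<bar>t - s\<bar>"
    using M by (intro mult_right_mono mult_left_mono) auto
  moreover have "norm (T t (lap T \<mu> x) - T s (lap T \<mu> x)) \<le> M * norm z * \<bar>t - s\<bar>"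
    using orbit_lipschitz[OF lap_orbit_deriv[OF \<mu>, of _ x], of s t] orbit_lipschitz[OF lap_orbit_deriv[OF \<mu>, of _ x], of t s] st
    by (cases "s \<le> t") (auto simp: z_def norm_minus_commute[of "T t (lap T \<mu> x)"])
  ultimately show ?thesis by (simp add: mult.assoc)
qed

lemma lap_lap_commute:
  assumes "\<mu> > 0" "\<nu> > 0"
  shows "lap T \<mu> (lap T \<nu> x) = lap T \<nu> (lap T \<mu> x)"
proof (cases "\<mu> = \<nu>")
  case False
  have "(\<nu> - \<mu>) *\<^sub>R lap T \<mu> (lap T \<nu> x) = lap T \<mu> x - lap T \<nu> x"
    using resolvent_identity[OF assms, of x] by simp
  also have "\<dots> = (\<nu> - \<mu>) *\<^sub>R lap T \<nu> (lap T \<mu> x)"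
    using resolvent_identity[OF assms(2,1), of x] by (simp add: algebra_simps)
  finally show ?thesis using False by simp
qed simp

section \<open>Backward Euler approximation\<close>

lemma euler_linear: "h > 0 \<Longrightarrow> Vector_Spaces.linear scal scal (euler T h)"
  unfolding euler_def using lap_linear[of "1 / h"]
  by (intro linI) (auto simp: lin_add lin_scal scaleR_add_right scal_of_real[symmetric] scale_left_commute)

lemma euler_sg: "h > 0 \<Longrightarrow> s \<ge> 0 \<Longrightarrow> T s (euler T h x) = euler T h (T s x)"
  by (simp add: euler_def lin_scaleR[OF sg_linear] lap_sg)

lemma euler_lap: "h > 0 \<Longrightarrow> \<mu> > 0 \<Longrightarrow> euler T h (lap T \<mu> x) = lap T \<mu> (euler T h x)"
  by (simp add: euler_def lin_scaleR[OF lap_linear] lap_lap_commute)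

text \<open>The induction carries the bound for the entire orbit, that is for the norm sup_s
  |T(s)x|, with respect to which an Euler step is a contraction. Hence M enters once and not once
  per step.\<close>

lemma euler_pow_norm:
  assumes h: "h > 0" and s: "s \<ge> 0"
  shows "norm (T s ((euler T h ^^ k) x)) \<le> M * norm x"
  using s
proof (induction k arbitrary: s)
  case 0
  then show ?case by (simp add: sg_norm)
next
  case (Suc k)
  let ?y = "(euler T h ^^ k) x"
  have "norm (lap T (1 / h) (T s ?y)) \<le> M * norm x / (1 / h)"
    using h Suc.IH Suc.prems by (intro lap_norm_sup) (auto simp: sg_add[symmetric])
  then show ?case
    using h Suc.prems by (simp add: euler_sg) (simp add: euler_def field_simps)
qed

text \<open>With A the generator and y the doubly smoothed vector, both terms expand as y + h A y up
  to a remainder governed by A^2 y; the factor 2 stands for the two remainders.\<close>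

lemma euler_local_error:
  assumes h: "h > 0" and \<mu>: "\<mu> > 0"
  shows "norm (T h (lap T \<mu> (lap T \<mu> x)) - euler T h (lap T \<mu> (lap T \<mu> x))) \<le> 2 * M * (M + 1)\<^sup>2 * h\<^sup>2 * norm x"
proof -
  let ?L = "lap T \<mu>"
  note lin = lap_linear[OF \<mu>]
  define u where "u = ?L x"
  define y where "y = ?L u"
  \<comment> \<open>In terms of the generator A these are w = A u, z1 = A y and z2 = A z1, all by A
    R = \<mu> R - 1.\<close>
  define w where "w = \<mu> *\<^sub>R u - x"
  define z1 where "z1 = \<mu> *\<^sub>R y - u"
  define z2 where "z2 = \<mu> *\<^sub>R z1 - w"
  have z1: "z1 = ?L w" by (simp add: z1_def w_def y_def u_def lin_diff[OF lin] lin_scaleR[OF lin])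
  have bound: "norm (\<mu> *\<^sub>R ?L v - v) \<le> (M + 1) * norm v" for v
    using norm_triangle_ineq4[of "\<mu> *\<^sub>R ?L v" v] lap_norm[OF \<mu>, of v] \<mu> by (simp add: field_simps)
  have "norm w \<le> (M + 1) * norm x" using bound[of x] by (simp add: w_def u_def)
  moreover have "norm z2 \<le> (M + 1) * norm w" using bound[of w] by (simp add: z2_def z1)
  moreover have "(M + 1) * norm w \<le> (M + 1) * ((M + 1) * norm x)"
    using \<open>norm w \<le> _\<close> M by (intro mult_left_mono) auto
  ultimately have nz2: "norm z2 \<le> (M + 1)\<^sup>2 * norm x"
    by (simp add: power2_eq_square mult.assoc)
  have dy: "gderiv (\<lambda>t. T t y) (T t z1) t" if "t \<ge> 0" for t
    using lap_orbit_deriv[OF \<mu> that, of u] by (simp add: y_def z1_def)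
  have dz: "gderiv (\<lambda>t. T t z1) (T t z2) t" if "t \<ge> 0" for t
    using lap_orbit_deriv[OF \<mu> that, of w] by (simp add: z1[symmetric] z2_def)
  have "norm ((\<lambda>t. T t y - t *\<^sub>R z1) h - (\<lambda>t. T t y - t *\<^sub>R z1) 0) \<le> (\<lambda>t. M * norm z2 * t\<^sup>2 / 2) h - (\<lambda>t. M * norm z2 * t\<^sup>2 / 2) 0"
  proof (rule gderiv_mean_value_norm[where f = "\<lambda>t. T t z1 - z1" and g' = "\<lambda>t. M * norm z2 * t"])
    fix t assume t: "0 \<le> t" "t \<le> h"
    show "gderiv (\<lambda>t. T t y - t *\<^sub>R z1) (T t z1 - z1) t" by (intro gderiv_diff dy gderiv_linear t)
    show "norm (T t z1 - z1) \<le> M * norm z2 * t"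
      using orbit_lipschitz[OF dz, of 0 t] t by (simp add: sg_0)
    show "((\<lambda>t. M * norm z2 * t\<^sup>2 / 2) has_real_derivative M * norm z2 * t) (at t within {0..h})"
      by (auto intro!: derivative_eq_intros)
  qed (use h in auto)
  then have "norm (T h y - y - h *\<^sub>R z1) \<le> M * norm z2 * h\<^sup>2 / 2"
    by (simp add: sg_0 algebra_simps)
  moreover have "M * norm z2 * h\<^sup>2 \<ge> 0" using M by simp
  ultimately have 1: "norm (T h y - y - h *\<^sub>R z1) \<le> M * norm z2 * h\<^sup>2" by linarith
  have h': "1 / h > 0" using h by simp
  note lin' = lap_linear[OF h']
  \<comment> \<open>The left inverse property, used once for y and once for z1, gives the
    second-order expansion of the Euler step.\<close>
  have "lap T (1 / h) ((1 / h) *\<^sub>R y - z1) = y" by (rule lap_inverse[OF h' dy])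
  then have "euler T h y = y + lap T (1 / h) z1"
    by (simp add: euler_def lin_diff[OF lin'] lin_scaleR[OF lin'] diff_eq_eq)
  moreover have "lap T (1 / h) ((1 / h) *\<^sub>R z1 - z2) = z1" by (rule lap_inverse[OF h' dz])
  then have "(1 / h) *\<^sub>R lap T (1 / h) z1 = z1 + lap T (1 / h) z2"
    by (simp add: lin_diff[OF lin'] lin_scaleR[OF lin'] diff_eq_eq)
  then have "h *\<^sub>R ((1 / h) *\<^sub>R lap T (1 / h) z1) = h *\<^sub>R (z1 + lap T (1 / h) z2)" by simp
  then have "lap T (1 / h) z1 = h *\<^sub>R z1 + h *\<^sub>R lap T (1 / h) z2"
    using h by (simp add: scaleR_add_right)
  ultimately have "euler T h y - y - h *\<^sub>R z1 = h *\<^sub>R lap T (1 / h) z2" by simp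
  moreover have "norm (h *\<^sub>R lap T (1 / h) z2) \<le> h * (M * h * norm z2)"
    using lap_norm[OF h', of z2] h by simp
  ultimately have 2: "norm (euler T h y - y - h *\<^sub>R z1) \<le> M * norm z2 * h\<^sup>2"
    by (simp add: power2_eq_square algebra_simps)
  have "norm (T h y - euler T h y) \<le> norm (T h y - y - h *\<^sub>R z1) + norm (euler T h y - y - h *\<^sub>R z1)"
    using norm_triangle_ineq4[of "T h y - y - h *\<^sub>R z1" "euler T h y - y - h *\<^sub>R z1"] by simp
  also have "\<dots> \<le> 2 * M * h\<^sup>2 * norm z2" using 1 2 by (simp add: algebra_simps)
  also have "\<dots> \<le> 2 * M * h\<^sup>2 * ((M + 1)\<^sup>2 * norm x)"
    using nz2 M by (intro mult_left_mono) auto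
  finally show ?thesis by (simp add: y_def u_def algebra_simps)
qed

text \<open>Telescoping over the steps. Euler steps commute with the resolvent, so the i-th iterate
  of the starting vector is again doubly smoothed, now from the i-th iterate of x; this is why all
  iterates of x are to be bounded.\<close>

lemma euler_global_error_aux:
  assumes h: "h > 0" and \<mu>: "\<mu> > 0" and B: "\<And>i. norm ((euler T h ^^ i) x) \<le> B"
  shows "norm (T (real k * h) (lap T \<mu> (lap T \<mu> x)) - (euler T h ^^ k) (lap T \<mu> (lap T \<mu> x)))
    \<le> real k * (M * (2 * M * (M + 1)\<^sup>2 * h\<^sup>2 * B))"
  using B
proof (induction k arbitrary: x)
  case 0
  then show ?case by (simp add: sg_0)
next
  case (Suc k)
  let ?y = "lap T \<mu> (lap T \<mu> x)" and ?V = "euler T h"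
  define C where "C = 2 * M * (M + 1)\<^sup>2 * h\<^sup>2"
  have C: "C \<ge> 0" using M by (simp add: C_def)
  have k: "real k * h \<ge> 0" using h by simp
  have Vy: "?V ?y = lap T \<mu> (lap T \<mu> (?V x))" using h \<mu> by (simp add: euler_lap)
  have "T (real (Suc k) * h) ?y = T (real k * h) (T h ?y)"
    using sg_add[OF k, of h ?y] h by (simp add: algebra_simps)
  then have "T (real (Suc k) * h) ?y - (?V ^^ Suc k) ?y
     = T (real k * h) (T h ?y - ?V ?y) + (T (real k * h) (?V ?y) - (?V ^^ k) (?V ?y))"
    by (simp add: lin_diff[OF sg_linear[OF k]] funpow_swap1)
  moreover have "norm (T (real k * h) (T h ?y - ?V ?y)) \<le> M * (C * B)"
  proof -
    have "norm (T h ?y - ?V ?y) \<le> C * norm x" unfolding C_def by (rule euler_local_error[OF h \<mu>])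
    also have "\<dots> \<le> C * B" using Suc.prems[of 0] C by (intro mult_left_mono) auto
    finally show ?thesis using sg_norm[OF k, of "T h ?y - ?V ?y"] M by (meson mult_left_mono order_trans)
  qed
  moreover have "norm (T (real k * h) (?V ?y) - (?V ^^ k) (?V ?y)) \<le> real k * (M * (C * B))"
    unfolding Vy C_def
  proof (rule Suc.IH)
    show "norm ((?V ^^ i) (?V x)) \<le> B" for i using Suc.prems[of "Suc i"] by (simp add: funpow_swap1)
  qed
  ultimately have "norm (T (real (Suc k) * h) ?y - (?V ^^ Suc k) ?y) \<le> M * (C * B) + real k * (M * (C * B))"
    using norm_triangle_mono by metis
  then show ?case unfolding C_def[symmetric] by (simp add: algebra_simps)
qed

text \<open>k steps with an error of order (t/k)^2 each leave order 1/k. One factor M comes from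
  transporting errors by the semigroup, one from the local error and one from the bound on the
  iterates.\<close>

lemma euler_global_error:
  assumes t: "t > 0" and k: "k > 0" and \<mu>: "\<mu> > 0"
  shows "norm (T t (lap T \<mu> (lap T \<mu> x)) - (euler T (t / real k) ^^ k) (lap T \<mu> (lap T \<mu> x)))
    \<le> 2 * M ^ 3 * (M + 1)\<^sup>2 * t\<^sup>2 * norm x / real k"
proof -
  have h: "t / real k > 0" using t k by simp
  have "norm (T (real k * (t / real k)) (lap T \<mu> (lap T \<mu> x)) - (euler T (t / real k) ^^ k) (lap T \<mu> (lap T \<mu> x)))
    \<le> real k * (M * (2 * M * (M + 1)\<^sup>2 * (t / real k)\<^sup>2 * (M * norm x)))"
    using euler_pow_norm[OF h, of 0] by (intro euler_global_error_aux[OF h \<mu>]) (simp add: sg_0)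
  also have "\<dots> = 2 * M ^ 3 * (M + 1)\<^sup>2 * t\<^sup>2 * norm x / real k"
    using k by (simp add: power2_eq_square power3_eq_cube)
  finally show ?thesis using k by simp
qed

end

text \<open>Local equicontinuity controls \<open>\<integral>\<^sub>0\<^sup>b\<close>; the tail is small in norm on bounded sets.\<close>

lemma lap_equicontinuous:
  assumes sg: "\<And>j. j \<in> J \<Longrightarrow> bounded_semigroup M (T j)" and M: "M \<ge> 0" and \<mu>: "\<mu> > 0"
    and eq: "\<And>q b. q \<in> G \<Longrightarrow> \<exists>q'\<in>G. \<forall>j\<in>J. \<forall>t\<in>{0..b}. \<forall>x. q (T j t x) \<le> q' x"
    and q: "q \<in> G"
  shows "\<exists>q'\<in>G. \<forall>j\<in>J. \<forall>x. q (lap (T j) \<mu> x) \<le> q' x"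
proof (rule equicontinuousI[OF _ _ _ q])
  fix j assume j: "j \<in> J"
  show "Vector_Spaces.linear scal scal (lap (T j) \<mu>)" by (rule lap_linear[OF sg[OF j] M \<mu>])
  show "norm (lap (T j) \<mu> x) \<le> M / \<mu> * norm x" for x by (rule lap_norm[OF sg[OF j] M \<mu>])
next
  fix s p and e :: real
  assume s: "bounded (range s)" "limitin \<tau> s 0 sequentially" and p: "p \<in> P" and e: "e > 0"
  note pG = P_subset_G[OF p]
  note sn = P_seminorm[OF p]
  obtain B where B: "\<And>n. norm (s n) \<le> B" using s(1) by (auto simp: bounded_iff)
  have "((\<lambda>b. M * B / \<mu> * exp (- \<mu> * b)) \<longlongrightarrow> 0) at_top" using \<mu> by real_asymp
  then have "\<forall>\<^sub>F b in at_top. M * B / \<mu> * exp (- \<mu> * b) < e / 2 \<and> b \<ge> 0"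
    using e by (intro eventually_conj order_tendstoD(2) eventually_ge_at_top) auto
  then obtain b where b: "M * B / \<mu> * exp (- \<mu> * b) < e / 2" "b \<ge> 0"
    by (auto simp: eventually_at_top_linorder)
  obtain q' where q': "q' \<in> G" "\<And>j t x. j \<in> J \<Longrightarrow> 0 \<le> t \<Longrightarrow> t \<le> b \<Longrightarrow> p (T j t x) \<le> q' x"
    using eq[OF pG, of b] by (metis atLeastAtMost_iff)
  have "limitin \<gamma> s 0 sequentially" using s by (simp add: gamma_seq_iff)
  then have "(\<lambda>n. q' (s n) * b) \<longlonglongrightarrow> 0"
    using q' tendsto_mult_right[of "\<lambda>n. q' (s n)" 0 sequentially b] by (simp add: limitin_gamma)
  then have "\<forall>\<^sub>F n in sequentially. q' (s n) * b < e / 2" using e by (intro order_tendstoD(2)) auto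
  then show "\<forall>\<^sub>F n in sequentially. \<forall>j\<in>J. p (lap (T j) \<mu> (s n)) < e"
  proof eventually_elim
    case (elim n)
    show ?case
    proof
      fix j assume j: "j \<in> J"
      note bs = sg[OF j] M
      have "norm (lap (T j) \<mu> (s n) - prim (T j) \<mu> (s n) b) \<le> M * B / \<mu> * exp (- \<mu> * b)"
      proof (rule lap_tail[OF bs \<mu> _ b(2)])
        show "norm (T j t (s n)) \<le> M * B" if "t \<ge> 0" for t
          using sg_norm[OF bs that, of "s n"] B[of n] M by (meson mult_left_mono order_trans)
      qed
      then have 1: "p (lap (T j) \<mu> (s n) - prim (T j) \<mu> (s n) b) < e / 2"
        using P_le_norm[OF p] b(1) by (meson le_less_trans order_trans)
      have "p (prim (T j) \<mu> (s n) b - prim (T j) \<mu> (s n) 0) \<le> (\<lambda>t. q' (s n) * t) b - (\<lambda>t. q' (s n) * t) 0"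
      proof (rule gderiv_mean_value[OF _ b(2) prim_deriv[OF bs] pG])
        fix t assume t: "0 \<le> t" "t \<le> b"
        have "exp (- \<mu> * t) * p (T j t (s n)) \<le> 1 * q' (s n)"
          using q'(2)[OF j t, of "s n"] \<mu> t seminorm_nonneg[OF sn] by (intro mult_mono) auto
        then show "p (exp (- \<mu> * t) *\<^sub>R T j t (s n)) \<le> q' (s n)" by (simp add: seminorm_scaleR[OF sn])
        show "((\<lambda>t. q' (s n) * t) has_real_derivative q' (s n)) (at t within {0..b})"
          by (auto intro!: derivative_eq_intros)
      qed auto
      then have 2: "p (prim (T j) \<mu> (s n) b) < e / 2" using elim by (simp add: prim_0[OF bs])
      show "p (lap (T j) \<mu> (s n)) < e"
        using 1 2 seminorm_add[OF sn, of "lap (T j) \<mu> (s n) - prim (T j) \<mu> (s n) b" "prim (T j) \<mu> (s n) b"] by simp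
    qed
  qed
qed

lemma lap_gcont:
  assumes sg: "bounded_semigroup M T" and M: "M \<ge> 0" and \<mu>: "\<mu> > 0"
  shows "gcont (lap T \<mu>)"
  unfolding gcont_def
proof (intro conjI ballI)
  show "Vector_Spaces.linear scal scal (lap T \<mu>)" by (rule lap_linear[OF sg M \<mu>])
  show "\<exists>q'\<in>G. \<forall>x. q (lap T \<mu> x) \<le> q' x" if "q \<in> G" for q
    using lap_equicontinuous[of "{()}" M "\<lambda>_. T" \<mu> q] sg M \<mu> that sg_equicont[OF sg M] by simp
qed

section \<open>Convergence of bounded semigroups\<close>

text \<open>The approximating sequence may change with q and e. So vectors need to be approximated
  in one seminorm at a time only, which is what \<gamma>-density provides.\<close>

lemma gCauchy_approx:
  assumes "\<And>q e. q \<in> G \<Longrightarrow> e > 0 \<Longrightarrow> \<exists>s' N. gCauchy s' \<and> (\<forall>n\<ge>N. q (s n - s' n) \<le> e)"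
  shows "gCauchy s"
  unfolding gCauchy_def
proof (intro ballI allI impI)
  fix q and e :: real assume q: "q \<in> G" and e: "e > 0"
  note sn = G_seminorm[OF q]
  obtain s' N where s': "gCauchy s'" "\<And>n. n \<ge> N \<Longrightarrow> q (s n - s' n) \<le> e/4"
    using assms[OF q, of "e/4"] e by auto
  obtain N' where N': "\<And>m n. m \<ge> N' \<Longrightarrow> n \<ge> N' \<Longrightarrow> q (s' m - s' n) < e/4"
    using gCauchyD[OF s'(1) q, of "e/4"] e by auto
  have "q (s m - s n) < e" if "m \<ge> max N N'" "n \<ge> max N N'" for m n
  proof -
    have "q (s m - s n) \<le> q (s m - s' m) + q (s' m - s' n) + q (s n - s' n)"
      using seminorm_add[OF sn, of "s m - s' m" "s' m - s' n"]
        seminorm_diff[OF sn, of "s m - s' m + (s' m - s' n)" "s n - s' n"] by simp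
    also have "\<dots> \<le> e/4 + e/4 + e/4" using s'(2)[of m] s'(2)[of n] N'[of m n] that by (intro add_mono) auto
    also have "\<dots> < e" using e by simp
    finally show ?thesis .
  qed
  then show "\<exists>N. \<forall>m\<ge>N. \<forall>n\<ge>N. q (s m - s n) < e" by blast
qed

definition equicont :: "(nat \<Rightarrow> 'a \<Rightarrow> 'a) \<Rightarrow> bool" where
  "equicont A \<longleftrightarrow> (\<forall>n. Vector_Spaces.linear scal scal (A n)) \<and> (\<forall>q\<in>G. \<exists>q'\<in>G. \<forall>n x. q (A n x) \<le> q' x)"

lemma equicontD: "equicont A \<Longrightarrow> q \<in> G \<Longrightarrow> \<exists>q'\<in>G. \<forall>n x. q (A n x) \<le> q' x"
  by (simp add: equicont_def)

lemma equicont_linear: "equicont A \<Longrightarrow> Vector_Spaces.linear scal scal (A n)"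
  by (simp add: equicont_def)

lemma equicont_small:
  assumes A: "equicont A" and s: "limitin \<gamma> s l sequentially" and q: "q \<in> G" and e: "e > 0"
  shows "\<exists>N. \<forall>n\<ge>N. q (A n (s n) - A n l) < e"
proof -
  obtain q' where q': "q' \<in> G" "\<And>n x. q (A n x) \<le> q' x" using equicontD[OF A q] by blast
  have "\<forall>\<^sub>F n in sequentially. q' (s n - l) < e"
    using s q' e by (intro order_tendstoD(2)[where y = 0]) (auto simp: limitin_gamma)
  moreover have "q (A n (s n) - A n l) \<le> q' (s n - l)" for n
    using q'(2)[of n "s n - l"] by (simp add: lin_diff[OF equicont_linear[OF A]])
  ultimately show ?thesis unfolding eventually_sequentially by (meson le_less_trans)
qed

lemma equicont_gCauchy:
  assumes A: "equicont A" and s: "gCauchy s" and c: "\<And>x. gCauchy (\<lambda>n. A n x)"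
  shows "gCauchy (\<lambda>n. A n (s n))"
proof (rule gCauchy_approx)
  fix q and e :: real assume q: "q \<in> G" and e: "e > 0"
  obtain l where l: "limitin \<gamma> s l sequentially" using gCauchy_convergent[OF s] by blast
  obtain N where N: "\<And>n. n \<ge> N \<Longrightarrow> q (A n (s n) - A n l) < e" using equicont_small[OF A l q e] by blast
  then show "\<exists>s' N. gCauchy s' \<and> (\<forall>n\<ge>N. q (A n (s n) - s' n) \<le> e)"
    using c[of l] by (intro exI[of _ "\<lambda>n. A n l"] exI[of _ N]) (auto intro: less_imp_le)
qed

lemma equicont_limit:
  assumes A: "equicont A" and s: "limitin \<gamma> s l sequentially" and c: "limitin \<gamma> (\<lambda>n. A n l) z sequentially"
  shows "limitin \<gamma> (\<lambda>n. A n (s n)) z sequentially"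
proof -
  have "limitin \<gamma> (\<lambda>n. A n (s n) - A n l) 0 sequentially"
    unfolding limitin_gamma
  proof (intro ballI tendstoI)
    fix q and e :: real assume q: "q \<in> G" and e: "e > 0"
    show "\<forall>\<^sub>F n in sequentially. dist (q (A n (s n) - A n l - 0)) 0 < e"
      using equicont_small[OF A s q e] seminorm_nonneg[OF G_seminorm[OF q]]
      unfolding eventually_sequentially by simp
  qed
  from gamma_limit_add[OF this c] show ?thesis by simp
qed

lemma limit_gcont:
  assumes A: "equicont A" and L: "\<And>x. limitin \<gamma> (\<lambda>n. A n x) (R x) sequentially"
  shows "gcont R"
  unfolding gcont_def
proof (intro conjI ballI)
  note lin = equicont_linear[OF A]
  show "Vector_Spaces.linear scal scal R"
  proof (rule linI)
    show "R (x + y) = R x + R y" for x y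
      using gamma_limit_unique[OF L[of "x + y"]] gamma_limit_add[OF L[of x] L[of y]] by (simp add: lin_add[OF lin])
    show "R (scal c x) = scal c (R x)" for c x
      using gamma_limit_unique[OF L[of "scal c x"]] gamma_limit_scal[OF L[of x], of c] by (simp add: lin_scal[OF lin])
  qed
  fix q assume q: "q \<in> G"
  then obtain q' where q': "q' \<in> G" "\<And>n x. q (A n x) \<le> q' x" using equicontD[OF A] by blast
  have "q (R x) \<le> q' x" for x by (rule seminorm_limit_le[OF q L]) (simp_all add: q')
  then show "\<exists>q'\<in>G. \<forall>x. q (R x) \<le> q' x" using q' by blast
qed

context
  fixes M :: real and T :: "nat \<Rightarrow> real \<Rightarrow> 'a \<Rightarrow> 'a"
  assumes sg: "\<And>n. bounded_semigroup M (T n)" and M: "M \<ge> 1"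
    and eqc: "\<And>q b. q \<in> G \<Longrightarrow> \<exists>q'\<in>G. \<forall>n. \<forall>t\<in>{0..b}. \<forall>x. q (T n t x) \<le> q' x"
begin

lemma M0: "M \<ge> 0"
  using M by simp

lemma T_equicont: "t \<ge> 0 \<Longrightarrow> equicont (\<lambda>n. T n t)"
  unfolding equicont_def
proof (intro conjI allI ballI)
  assume t: "t \<ge> 0"
  show "Vector_Spaces.linear scal scal (T n t)" for n by (rule sg_linear[OF sg M0 t])
  fix q assume "q \<in> G"
  from eqc[OF this, of t] obtain q' where "q' \<in> G" "\<forall>n. \<forall>t\<in>{0..t}. \<forall>x. q (T n t x) \<le> q' x" by blast
  then show "\<exists>q'\<in>G. \<forall>n x. q (T n t x) \<le> q' x" using t by (intro bexI[of _ q']) auto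
qed

lemma laps_equicont: "\<mu> > 0 \<Longrightarrow> equicont (\<lambda>n. lap (T n) \<mu>)"
  unfolding equicont_def
proof (intro conjI allI ballI)
  assume \<mu>: "\<mu> > 0"
  show "Vector_Spaces.linear scal scal (lap (T n) \<mu>)" for n by (rule lap_linear[OF sg M0 \<mu>])
  fix q assume q: "q \<in> G"
  show "\<exists>q'\<in>G. \<forall>n x. q (lap (T n) \<mu> x) \<le> q' x"
    using lap_equicontinuous[of UNIV M T \<mu> q] sg M0 \<mu> eqc q by simp
qed

section \<open>Continuation of resolvent convergence to larger points\<close>

definition lapconv :: "real \<Rightarrow> bool" where
  "lapconv \<mu> \<longleftrightarrow> (\<forall>x. gCauchy (\<lambda>n. lap (T n) \<mu> x))"

text \<open>By the resolvent identity, the oscillation of \<open>lap (T n) \<nu> x\<close> in \<open>n\<close> is at most \<open>\<nu> - \<mu>\<close> times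
  the one at \<open>lim\<^sub>n lap (T n) \<mu> x\<close>; iterating this contracts it to zero.\<close>

lemma lapconv_step:
  assumes c: "lapconv \<mu>" and \<mu>: "\<mu> > 0" and \<nu>: "\<mu> \<le> \<nu>" and small: "(\<nu> - \<mu>) * M / \<mu> \<le> 1 / 2"
  shows "lapconv \<nu>"
  unfolding lapconv_def gCauchy_def
proof (intro allI ballI impI)
  fix x0 :: 'a and q and e0 :: real assume q: "q \<in> G" and e0: "e0 > 0"
  note sn = G_seminorm[OF q]
  have \<nu>0: "\<nu> > 0" using \<mu> \<nu> by simp
  define R where "R n = lap (T n) \<mu>" for n
  define Q where "Q n = lap (T n) \<nu>" for n
  have linQ: "Vector_Spaces.linear scal scal (Q n)" for n unfolding Q_def by (rule lap_linear[OF sg M0 \<nu>0])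
  have Qeq: "equicont Q" unfolding Q_def by (rule laps_equicont[OF \<nu>0])
  obtain C where C: "C > 0" "\<And>x. q x \<le> C * norm x" using G_le_norm[OF q] by metis
  \<comment> \<open>Start of the contraction: the norm bounds of two resolvents alone keep the
    oscillation in q below D times the norm of x.\<close>
  define D where "D = 2 * C * (M / \<nu>)"
  have D: "D \<ge> 0" using C M0 \<nu>0 by (simp add: D_def)
  have osc: "\<exists>N. \<forall>m\<ge>N. \<forall>n\<ge>N. q (Q m x - Q n x) \<le> e + D * norm x / 2 ^ k" if "e > 0" for k e x
    using that
  proof (induction k arbitrary: x e)
    case 0
    have "q (Q m x - Q n x) \<le> e + D * norm x" for m n
    proof -
      have "norm (Q m x - Q n x) \<le> M / \<nu> * norm x + M / \<nu> * norm x"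
        using norm_triangle_ineq4[of "Q m x" "Q n x"] lap_norm[OF sg M0 \<nu>0, of m x] lap_norm[OF sg M0 \<nu>0, of n x]
        unfolding Q_def by linarith
      then have "C * norm (Q m x - Q n x) \<le> C * (M / \<nu> * norm x + M / \<nu> * norm x)"
        using C by (intro mult_left_mono) auto
      also have "\<dots> = D * norm x" by (simp add: D_def)
      finally show ?thesis using C(2)[of "Q m x - Q n x"] \<open>e > 0\<close> by linarith
    qed
    then show ?case by auto
  next
    case (Suc k)
    define d where "d = \<nu> - \<mu>"
    have d: "d \<ge> 0" using \<nu> by (simp add: d_def)
    obtain r where r: "limitin \<gamma> (\<lambda>n. R n x) r sequentially"
      using c gCauchy_convergent unfolding lapconv_def R_def by blast
    have nr: "norm r \<le> M / \<mu> * norm x"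
      by (rule norm_limit_le[OF gamma_imp_tau[OF r] _ always_eventually])
        (use lap_norm[OF sg M0 \<mu>] R_def in auto)
    \<comment> \<open>The errors below sum up to e' + 3 d e', which this choice keeps within
      e.\<close>
    define e' where "e' = e / (4 * (1 + d))"
    have "e' * (4 * (1 + d)) = e" using d by (simp add: e'_def)
    then have e': "e' > 0" "4 * e' + 4 * (d * e') = e"
      using Suc.prems d by (simp add: e'_def, simp add: algebra_simps)
    obtain N1 where N1: "\<And>m n. m \<ge> N1 \<Longrightarrow> n \<ge> N1 \<Longrightarrow> q (R m x - R n x) < e'"
      using gCauchyD[OF convergent_gCauchy[OF r] q e'(1)] by blast
    obtain N2 where N2: "\<And>n. n \<ge> N2 \<Longrightarrow> q (Q n (R n x) - Q n r) < e'"
      using equicont_small[OF Qeq r q e'(1)] by blast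
    obtain N3 where N3: "\<And>m n. m \<ge> N3 \<Longrightarrow> n \<ge> N3 \<Longrightarrow> q (Q m r - Q n r) \<le> e' + D * norm r / 2 ^ k"
      using Suc.IH[OF e'(1)] by blast
    \<comment> \<open>The identity is arranged so that the unknown resolvent acts on
      \<open>R n x\<close>, which converges to r; the oscillation at x is thus reduced to that at
      r.\<close>
    have res: "Q n x = R n x - d *\<^sub>R Q n (R n x)" for n
      using resolvent_identity[OF sg M0 \<nu>0 \<mu>, of n x] unfolding Q_def R_def d_def
      by (simp add: scaleR_diff_left)
    have "q (Q m x - Q n x) \<le> e + D * norm x / 2 ^ Suc k" if mn: "m \<ge> max N1 (max N2 N3)" "n \<ge> max N1 (max N2 N3)" for m n
    proof -
      let ?a = "Q m (R m x) - Q m r" and ?b = "Q n (R n x) - Q n r" and ?c = "Q m r - Q n r"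
      have "Q m x - Q n x = (R m x - R n x) - d *\<^sub>R (?a - ?b + ?c)"
        by (simp add: res algebra_simps)
      then have "q (Q m x - Q n x) \<le> q (R m x - R n x) + d * q (?a - ?b + ?c)"
        using seminorm_diff[OF sn, of "R m x - R n x" "d *\<^sub>R (?a - ?b + ?c)"] d by (simp add: seminorm_scaleR[OF sn])
      also have "\<dots> \<le> e' + d * (e' + e' + (e' + D * norm r / 2 ^ k))"
      proof (intro add_mono mult_left_mono)
        show "q (R m x - R n x) \<le> e'" using N1[of m n] mn by simp
        have "q (?a - ?b + ?c) \<le> q ?a + q ?b + q ?c"
          using seminorm_add[OF sn, of "?a - ?b" ?c] seminorm_diff[OF sn, of ?a ?b] by linarith
        then show "q (?a - ?b + ?c) \<le> e' + e' + (e' + D * norm r / 2 ^ k)"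
          using N2[of m] N2[of n] N3[of m n] mn by simp
      qed (rule d)
      also have "\<dots> \<le> e + D * (d * norm r) / 2 ^ k"
      proof -
        have "d * e' \<ge> 0" using d e'(1) by simp
        have "e' + d * (e' + e' + (e' + D * norm r / 2 ^ k)) = e' + 3 * (d * e') + D * (d * norm r) / 2 ^ k"
          by (simp add: algebra_simps)
        then show ?thesis using e' \<open>d * e' \<ge> 0\<close> by linarith
      qed
      \<comment> \<open>The step length was limited so that d times the norm of r is at most half
        the norm of x; this is the contraction factor.\<close>
      also have "\<dots> \<le> e + D * (norm x / 2) / 2 ^ k"
      proof -
        have "d * norm r \<le> d * (M / \<mu> * norm x)" using d nr by (intro mult_left_mono)
        also have "\<dots> = (d * M / \<mu>) * norm x" by simp
        also have "\<dots> \<le> 1 / 2 * norm x" using small by (intro mult_right_mono) (auto simp: d_def)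
        finally show ?thesis using D by (intro add_left_mono divide_right_mono mult_left_mono) auto
      qed
      finally show ?thesis by simp
    qed
    then show ?case by blast
  qed
  have "(\<lambda>k. D * norm x0 / 2 ^ k) \<longlonglongrightarrow> 0" by real_asymp
  then have "\<forall>\<^sub>F k in sequentially. D * norm x0 / 2 ^ k < e0 / 2" using e0 by (intro order_tendstoD(2)) auto
  then obtain k where k: "D * norm x0 / 2 ^ k < e0 / 2" by (auto simp: eventually_sequentially)
  obtain N where N: "\<And>m n. m \<ge> N \<Longrightarrow> n \<ge> N \<Longrightarrow> q (Q m x0 - Q n x0) \<le> e0 / 2 + D * norm x0 / 2 ^ k"
    using osc[of "e0 / 2" x0 k] e0 by auto
  have "q (Q m x0 - Q n x0) < e0" if "m \<ge> N" "n \<ge> N" for m n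
    using N[OF that] k by linarith
  then show "\<exists>N. \<forall>m\<ge>N. \<forall>n\<ge>N. q (lap (T m) \<nu> x0 - lap (T n) \<nu> x0) < e0"
    unfolding Q_def by blast
qed

text \<open>The admissible step length \<mu> / (2 M) increases with \<mu>, so a step that is
  admissible at the start remains so, and finitely many equal steps reach \<nu>.\<close>

lemma lapconv_ge:
  assumes c: "lapconv \<mu>" and \<mu>: "\<mu> > 0" and \<nu>: "\<mu> \<le> \<nu>"
  shows "lapconv \<nu>"
proof -
  obtain J :: nat where J: "real J > 2 * M * (\<nu> - \<mu>) / \<mu>" using reals_Archimedean2 by blast
  have "2 * M * (\<nu> - \<mu>) / \<mu> \<ge> 0" using M0 \<mu> \<nu> by simp
  then have J0: "real J > 0" using J by linarith
  define d where "d = (\<nu> - \<mu>) / real J"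
  have d: "d \<ge> 0" using \<nu> J0 by (simp add: d_def)
  have dM: "d * M / \<mu> \<le> 1 / 2" using J J0 \<mu> by (simp add: d_def field_simps)
  have "lapconv (\<mu> + real j * d)" for j
  proof (induction j)
    case (Suc j)
    have le: "\<mu> \<le> \<mu> + real j * d" using d by simp
    have "(\<mu> + real (Suc j) * d - (\<mu> + real j * d)) * M / (\<mu> + real j * d) = d * M / (\<mu> + real j * d)"
      by (simp add: algebra_simps)
    also have "\<dots> \<le> d * M / \<mu>"
      using le d M0 \<mu> by (intro divide_left_mono mult_pos_pos mult_nonneg_nonneg add_pos_nonneg) auto
    also note dM
    finally have small: "(\<mu> + real (Suc j) * d - (\<mu> + real j * d)) * M / (\<mu> + real j * d) \<le> 1 / 2" .
    show ?case
    proof (rule lapconv_step[OF Suc.IH _ _ small])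
      show "\<mu> + real j * d > 0" using le \<mu> by linarith
      show "\<mu> + real j * d \<le> \<mu> + real (Suc j) * d" using d by (simp add: algebra_simps)
    qed
  qed (simp add: c)
  from this[of J] show ?thesis using J0 by (simp add: d_def)
qed

lemma euler_gCauchy:
  assumes c: "lapconv (1 / h)" and h: "h > 0" and s: "gCauchy s"
  shows "gCauchy (\<lambda>n. (euler (T n) h ^^ k) (s n))"
proof (induction k)
  case (Suc k)
  have h': "1 / h > 0" using h by simp
  have eq: "equicont (\<lambda>n. euler (T n) h)"
    unfolding equicont_def
  proof (intro conjI allI ballI)
    show "Vector_Spaces.linear scal scal (euler (T n) h)" for n by (rule euler_linear[OF sg M0 h])
    fix q assume q: "q \<in> G"
    obtain q' where q': "q' \<in> G" "\<And>n x. q (lap (T n) (1 / h) x) \<le> q' x"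
      using equicontD[OF laps_equicont[OF h'] q] by blast
    have "q (euler (T n) h x) \<le> 1 / h * q' x" for n x
      using mult_left_mono[OF q'(2)[of n x], of "1 / h"] h by (simp add: euler_def seminorm_scaleR[OF G_seminorm[OF q]])
    then show "\<exists>q'\<in>G. \<forall>n x. q (euler (T n) h x) \<le> q' x" using G_mult[OF q'(1), of "1 / h"] h by force
  qed
  have ce: "gCauchy (\<lambda>n. euler (T n) h x)" for x
  proof -
    have "gCauchy (\<lambda>n. lap (T n) (1 / h) x)" using c by (simp add: lapconv_def)
    then obtain l where "limitin \<gamma> (\<lambda>n. lap (T n) (1 / h) x) l sequentially" by (rule gCauchy_convergent)
    from convergent_gCauchy[OF gamma_limit_scaleR[OF this, of "1 / h"]] show ?thesis by (simp add: euler_def)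
  qed
  from equicont_gCauchy[OF eq Suc.IH ce] show ?case by simp
qed (simp add: s)

section \<open>The limit semigroup\<close>

context
  fixes \<mu> :: real and R :: "'a \<Rightarrow> 'a"
  assumes \<mu>: "\<mu> > 0" and R: "\<And>x. limitin \<gamma> (\<lambda>n. lap (T n) \<mu> x) (R x) sequentially"
    and dense: "dense_in_topology \<gamma> (range R)"
begin

lemma lapconv_mu: "lapconv \<mu>"
  unfolding lapconv_def using convergent_gCauchy[OF R] by blast

lemma R_gcont: "gcont R"
  by (rule limit_gcont[OF laps_equicont[OF \<mu>] R])

lemma lap_lap_limit: "limitin \<gamma> (\<lambda>n. lap (T n) \<mu> (lap (T n) \<mu> x)) (R (R x)) sequentially"
  by (rule equicont_limit[OF laps_equicont[OF \<mu>] R R])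

lemma dense_R2:
  assumes q: "q \<in> G" and e: "e > 0"
  shows "\<exists>y. q (R (R y) - x) < e"
proof -
  obtain q' where q': "q' \<in> G" "\<And>x. q (R x) \<le> q' x" using gcontD[OF R_gcont q] by blast
  obtain z where z: "q (R z - x) < e/2" using dense[unfolded dense_gamma_iff, rule_format, OF q, of "e/2" x] e by auto
  obtain y where y: "q' (R y - z) < e/2" using dense[unfolded dense_gamma_iff, rule_format, OF q'(1), of "e/2" z] e by auto
  have "q (R (R y) - R z) < e/2"
    using q'(2)[of "R y - z"] y by (simp add: lin_diff[OF gcont_linear[OF R_gcont]])
  then have "q (R (R y) - x) < e"
    using z seminorm_add[OF G_seminorm[OF q], of "R (R y) - R z" "R z - x"] by simp
  then show ?thesis by blast
qed

text \<open>The Euler error bound holds for vectors smoothed by the n-th resolvent itself, so the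
  argument of \<open>T n t\<close> varies with n instead of being \<open>R (R y)\<close>.\<close>

lemma T_gCauchy_lap_lap:
  assumes t: "t \<ge> 0"
  shows "gCauchy (\<lambda>n. T n t (lap (T n) \<mu> (lap (T n) \<mu> y)))"
proof (cases "t = 0")
  \<comment> \<open>At t = 0 the Euler step would have size 0.\<close>
  case True
  then show ?thesis using convergent_gCauchy[OF lap_lap_limit[of y]] by (simp add: sg_0[OF sg M0])
next
  case False
  then have t0: "t > 0" using t by simp
  define K where "K = 2 * M ^ 3 * (M + 1)\<^sup>2 * t\<^sup>2 * norm y"
  show ?thesis
  proof (rule gCauchy_approx)
    fix q and e :: real assume q: "q \<in> G" and e: "e > 0"
    obtain C where C: "C > 0" "\<And>x. q x \<le> C * norm x" using G_le_norm[OF q] by metis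
    \<comment> \<open>k beyond t \<mu> puts 1/h = k/t to the right of \<mu>, where the resolvents
      converge; k beyond C K / e makes the Euler error in q at most e.\<close>
    obtain k where k: "real k > max 1 (max (t * \<mu>) (C * K / e))" using reals_Archimedean2 by blast
    have k0: "k > 0" using k by (simp add: gr0I)
    have h: "t / real k > 0" using t0 k0 by simp
    have "\<mu> \<le> 1 / (t / real k)" using k t0 by (simp add: field_simps)
    then have c: "lapconv (1 / (t / real k))" by (rule lapconv_ge[OF lapconv_mu \<mu>])
    let ?s' = "\<lambda>n. (euler (T n) (t / real k) ^^ k) (lap (T n) \<mu> (lap (T n) \<mu> y))"
    have "gCauchy ?s'" by (rule euler_gCauchy[OF c h convergent_gCauchy[OF lap_lap_limit]])
    moreover have "q (T n t (lap (T n) \<mu> (lap (T n) \<mu> y)) - ?s' n) \<le> e" for n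
    proof -
      have "norm (T n t (lap (T n) \<mu> (lap (T n) \<mu> y)) - ?s' n) \<le> K / real k"
        unfolding K_def by (rule euler_global_error[OF sg M0 t0 k0 \<mu>])
      then have "C * norm (T n t (lap (T n) \<mu> (lap (T n) \<mu> y)) - ?s' n) \<le> C * (K / real k)"
        using C by (intro mult_left_mono) auto
      also have "\<dots> \<le> e" using k e k0 by (simp add: field_simps)
      finally show ?thesis using C(2) order_trans by blast
    qed
    ultimately show "\<exists>s' N. gCauchy s' \<and> (\<forall>n\<ge>N. q (T n t (lap (T n) \<mu> (lap (T n) \<mu> y)) - s' n) \<le> e)" by blast
  qed
qed

text \<open>x is close to some \<open>R (R y)\<close>, which for large n is close to the n-th double
  resolvent of y; equicontinuity carries both errors through \<open>T n t\<close>.\<close>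

lemma T_gCauchy:
  assumes t: "t \<ge> 0"
  shows "gCauchy (\<lambda>n. T n t x)"
proof (rule gCauchy_approx)
  fix q and e :: real assume q: "q \<in> G" and e: "e > 0"
  obtain q' where q': "q' \<in> G" "\<And>n x. q (T n t x) \<le> q' x" using equicontD[OF T_equicont[OF t] q] by blast
  note sn' = G_seminorm[OF q'(1)]
  obtain y where y: "q' (R (R y) - x) < e/2" using dense_R2[OF q'(1), of "e/2" x] e by auto
  have "\<forall>\<^sub>F n in sequentially. q' (lap (T n) \<mu> (lap (T n) \<mu> y) - R (R y)) < e/2"
    using lap_lap_limit[of y] q' e by (intro order_tendstoD(2)[where y = 0]) (auto simp: limitin_gamma)
  then obtain N where N: "\<And>n. n \<ge> N \<Longrightarrow> q' (lap (T n) \<mu> (lap (T n) \<mu> y) - R (R y)) < e/2"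
    by (auto simp: eventually_sequentially)
  let ?s' = "\<lambda>n. T n t (lap (T n) \<mu> (lap (T n) \<mu> y))"
  have "q (T n t x - ?s' n) \<le> e" if "n \<ge> N" for n
  proof -
    let ?z = "lap (T n) \<mu> (lap (T n) \<mu> y)"
    have "q (T n t x - ?s' n) \<le> q' (x - ?z)"
      using q'(2)[of n "x - ?z"] by (simp add: lin_diff[OF sg_linear[OF sg M0 t]])
    also have "\<dots> = q' ((?z - R (R y)) + (R (R y) - x))"
      using seminorm_minus_commute[OF sn', of x ?z] by simp
    also have "\<dots> \<le> e" using seminorm_add[OF sn', of "?z - R (R y)" "R (R y) - x"] N[OF that] y by simp
    finally show ?thesis .
  qed
  then show "\<exists>s' N. gCauchy s' \<and> (\<forall>n\<ge>N. q (T n t x - s' n) \<le> e)" using T_gCauchy_lap_lap[OF t] by blast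
qed

definition Tlim :: "real \<Rightarrow> 'a \<Rightarrow> 'a" where
  "Tlim t x = (SOME l. limitin \<gamma> (\<lambda>n. T n t x) l sequentially)"

lemma Tlim: "t \<ge> 0 \<Longrightarrow> limitin \<gamma> (\<lambda>n. T n t x) (Tlim t x) sequentially"
  unfolding Tlim_def using gCauchy_convergent[OF T_gCauchy] someI_ex by metis

text \<open>The orbits of \<open>lap (T n) \<mu> y\<close> are Lipschitz with a constant independent
  of n, and these vectors are close to x for large n; the latter is the origin of N.\<close>

lemma T_uniformly_equicts:
  assumes t0: "t0 \<ge> 0" and q: "q \<in> G" and e: "e > 0"
  shows "\<exists>d>0. \<exists>N. \<forall>n\<ge>N. \<forall>t\<ge>0. \<bar>t - t0\<bar> < d \<longrightarrow> q (T n t x - T n t0 x) \<le> e"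
proof -
  note sn = G_seminorm[OF q]
  obtain q' where q': "q' \<in> G" "\<And>n t x. 0 \<le> t \<Longrightarrow> t \<le> t0 + 1 \<Longrightarrow> q (T n t x) \<le> q' x"
    using eqc[OF q, of "t0 + 1"] by (metis atLeastAtMost_iff)
  note sn' = G_seminorm[OF q'(1)]
  \<comment> \<open>Two errors e/6 bring x within e/3 of \<open>lap (T n) \<mu> y\<close>. This is
    spent once at t and once at t0; the Lipschitz estimate takes the last third.\<close>
  obtain y where y: "q' (R y - x) < e/6"
    using dense[unfolded dense_gamma_iff, rule_format, OF q'(1), of "e/6" x] e by auto
  have "\<forall>\<^sub>F n in sequentially. q' (lap (T n) \<mu> y - R y) < e/6"
    using R[of y] q' e by (intro order_tendstoD(2)[where y = 0]) (auto simp: limitin_gamma)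
  then obtain N where N: "\<And>n. n \<ge> N \<Longrightarrow> q' (lap (T n) \<mu> y - R y) < e/6"
    by (auto simp: eventually_sequentially)
  obtain C where C: "C > 0" "\<And>x. q x \<le> C * norm x" using G_le_norm[OF q] by metis
  define K where "K = C * (M * (M + 1) * norm y) + 1"
  have K: "K > 0" using C M0 by (simp add: K_def add_nonneg_pos)
  define d where "d = min 1 (e / (3 * K))"
  have d: "d > 0" "d \<le> 1" "K * d \<le> e/3" using e K by (auto simp: d_def min_def field_simps)
  have "q (T n t x - T n t0 x) \<le> e" if n: "n \<ge> N" and t: "t \<ge> 0" "\<bar>t - t0\<bar> < d" for n t
  proof -
    let ?z = "lap (T n) \<mu> y"
    have xz: "q' (x - ?z) \<le> e/3"
      using seminorm_add[OF sn', of "?z - R y" "R y - x"] seminorm_minus_commute[OF sn', of x ?z] N[OF n] y by simp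
    have tb: "t \<le> t0 + 1" using t d by linarith
    have 1: "q (T n t (x - ?z)) \<le> e/3" using q'(2)[of t n "x - ?z"] t(1) d tb xz by linarith
    have 2: "q (T n t0 (x - ?z)) \<le> e/3" using q'(2)[of t0 n "x - ?z"] t0 xz by auto
    have "norm (T n t ?z - T n t0 ?z) \<le> M * (M + 1) * norm y * \<bar>t - t0\<bar>"
      by (rule lap_lipschitz[OF sg M0 \<mu> t0 t(1)])
    then have "C * norm (T n t ?z - T n t0 ?z) \<le> C * (M * (M + 1) * norm y * \<bar>t - t0\<bar>)"
      using C by (intro mult_left_mono) auto
    also have "\<dots> = C * (M * (M + 1) * norm y) * \<bar>t - t0\<bar>" by simp
    also have "\<dots> \<le> K * d" using t C M0 K by (intro mult_mono) (auto simp: K_def)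
    finally have 3: "q (T n t ?z - T n t0 ?z) \<le> e/3" using C(2)[of "T n t ?z - T n t0 ?z"] d by linarith
    have "T n t x - T n t0 x = (T n t (x - ?z) - T n t0 (x - ?z)) + (T n t ?z - T n t0 ?z)"
      by (simp add: lin_diff[OF sg_linear[OF sg M0 t(1)]] lin_diff[OF sg_linear[OF sg M0 t0]])
    then have "q (T n t x - T n t0 x) \<le> q (T n t (x - ?z)) + q (T n t0 (x - ?z)) + q (T n t ?z - T n t0 ?z)"
      using seminorm_add[OF sn, of "T n t (x - ?z) - T n t0 (x - ?z)" "T n t ?z - T n t0 ?z"]
        seminorm_diff[OF sn, of "T n t (x - ?z)" "T n t0 (x - ?z)"] by simp
    then show ?thesis using 1 2 3 by simp
  qed
  then show ?thesis using d(1) by blast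
qed

lemma Tlim_cts:
  assumes t0: "t0 \<ge> 0" and q: "q \<in> G" and e: "e > 0"
  shows "\<exists>d>0. \<forall>t\<ge>0. \<bar>t - t0\<bar> < d \<longrightarrow> q (Tlim t x - Tlim t0 x) \<le> e"
proof -
  obtain d N where d: "d > 0" "\<And>n t. n \<ge> N \<Longrightarrow> t \<ge> 0 \<Longrightarrow> \<bar>t - t0\<bar> < d \<Longrightarrow> q (T n t x - T n t0 x) \<le> e"
    using T_uniformly_equicts[OF t0 q e, of x] by metis
  have "q (Tlim t x - Tlim t0 x) \<le> e" if "t \<ge> 0" "\<bar>t - t0\<bar> < d" for t
  proof (rule seminorm_limit_le[OF q gamma_limit_diff[OF Tlim Tlim]])
    show "\<forall>\<^sub>F n in sequentially. q (T n t x - T n t0 x) \<le> e"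
      using d(2)[OF _ that] unfolding eventually_sequentially by blast
  qed (use that t0 in auto)
  then show ?thesis using d(1) by blast
qed

lemma Tlim_bounded_semigroup: "bounded_semigroup M Tlim"
  unfolding bounded_semigroup_def
proof (intro conjI allI ballI impI)
  show "gcont (Tlim t)" if "t \<ge> 0" for t by (rule limit_gcont[OF T_equicont[OF that] Tlim[OF that]])
  show "Tlim 0 x = x" for x
    using gamma_limit_unique[OF Tlim[of 0 x] _ sequentially_bot] gamma_limit_const[of x] by (simp add: sg_0[OF sg M0])
  show "Tlim (s + t) x = Tlim s (Tlim t x)" if st: "s \<ge> 0" "t \<ge> 0" for s t x
  proof (rule gamma_limit_unique)
    show "limitin \<gamma> (\<lambda>n. T n (s + t) x) (Tlim (s + t) x) sequentially" using st by (intro Tlim) simp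
    have "limitin \<gamma> (\<lambda>n. T n s (T n t x)) (Tlim s (Tlim t x)) sequentially"
      by (rule equicont_limit[OF T_equicont[OF st(1)] Tlim[OF st(2)] Tlim[OF st(1)]])
    then show "limitin \<gamma> (\<lambda>n. T n (s + t) x) (Tlim s (Tlim t x)) sequentially"
      by (simp add: sg_add[OF sg M0 st])
  qed simp
  show "norm (Tlim t x) \<le> M * norm x" if "t \<ge> 0" for t x
    by (rule norm_limit_le[OF gamma_imp_tau[OF Tlim[OF that]]]) (simp_all add: sg_norm[OF sg M0 that])
  show "gcts (\<lambda>t. Tlim t x)" for x
    unfolding gcts_def
  proof (intro allI ballI impI)
    fix t :: real and q and e :: real assume t: "t \<ge> 0" and q: "q \<in> G" and e: "e > 0"
    obtain d where "d > 0" "\<And>s. s \<ge> 0 \<Longrightarrow> \<bar>s - t\<bar> < d \<Longrightarrow> q (Tlim s x - Tlim t x) \<le> e/2"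
      using Tlim_cts[OF t q, of "e/2" x] e by auto
    then show "\<exists>d>0. \<forall>s\<ge>0. \<bar>s - t\<bar> < d \<longrightarrow> q (Tlim s x - Tlim t x) < e"
      using e by (intro exI[of _ d]) fastforce
  qed
  fix q and b :: real assume q: "q \<in> G"
  obtain q' where q': "q' \<in> G" "\<And>n t x. 0 \<le> t \<Longrightarrow> t \<le> b \<Longrightarrow> q (T n t x) \<le> q' x"
    using eqc[OF q, of b] by (metis atLeastAtMost_iff)
  have "q (Tlim t x) \<le> q' x" if "0 \<le> t" "t \<le> b" for t x
    by (rule seminorm_limit_le[OF q Tlim[OF that(1)]]) (simp_all add: q'(2)[OF that])
  then show "\<exists>q'\<in>G. \<forall>t\<in>{0..b}. \<forall>x. q (Tlim t x) \<le> q' x"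
    using q'(1) by (intro bexI[of _ q']) auto
qed

text \<open>Convergence at t0 and equicontinuity in time give uniform convergence near t0; bisection
  covers [0, b].\<close>

lemma Tlim_uniform:
  assumes b: "b \<ge> 0" and q: "q \<in> G" and e: "e > 0"
  shows "\<exists>N. \<forall>n\<ge>N. \<forall>t\<in>{0..b}. q (T n t x - Tlim t x) \<le> e"
proof -
  note sn = G_seminorm[OF q]
  let ?Q = "\<lambda>u v. 0 \<le> u \<longrightarrow> (\<exists>N. \<forall>n\<ge>N. \<forall>t\<in>{u..v}. q (T n t x - Tlim t x) \<le> e)"
  have "?Q 0 b"
  proof (rule Bolzano[where P = ?Q, OF b])
    fix u v w assume *: "?Q u v" "?Q v w" "u \<le> v" "v \<le> w"
    show "?Q u w"
    proof
      assume u: "0 \<le> u"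
      obtain N1 where N1: "\<And>n t. n \<ge> N1 \<Longrightarrow> t \<in> {u..v} \<Longrightarrow> q (T n t x - Tlim t x) \<le> e" using *(1) u by blast
      obtain N2 where N2: "\<And>n t. n \<ge> N2 \<Longrightarrow> t \<in> {v..w} \<Longrightarrow> q (T n t x - Tlim t x) \<le> e" using *(2,3) u by fastforce
      have "q (T n t x - Tlim t x) \<le> e" if "n \<ge> max N1 N2" "t \<in> {u..w}" for n t
        using N1[of n t] N2[of n t] that by (cases "t \<le> v") auto
      then show "\<exists>N. \<forall>n\<ge>N. \<forall>t\<in>{u..w}. q (T n t x - Tlim t x) \<le> e" by blast
    qed
  next
    fix t0 assume t0: "0 \<le> t0" "t0 \<le> b"
    have e3: "e/3 > 0" using e by simp
    obtain d N where d: "d > 0" "\<And>n t. n \<ge> N \<Longrightarrow> t \<ge> 0 \<Longrightarrow> \<bar>t - t0\<bar> < d \<Longrightarrow> q (T n t x - T n t0 x) \<le> e/3"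
      using T_uniformly_equicts[OF t0(1) q e3, of x] by metis
    obtain d' where d': "d' > 0" "\<And>t. t \<ge> 0 \<Longrightarrow> \<bar>t - t0\<bar> < d' \<Longrightarrow> q (Tlim t x - Tlim t0 x) \<le> e/3"
      using Tlim_cts[OF t0(1) q e3, of x] by metis
    have "\<forall>\<^sub>F n in sequentially. q (T n t0 x - Tlim t0 x) < e/3"
      using Tlim[OF t0(1), of x] q e3 by (intro order_tendstoD(2)[where y = 0]) (auto simp: limitin_gamma)
    then obtain N' where N': "\<And>n. n \<ge> N' \<Longrightarrow> q (T n t0 x - Tlim t0 x) < e/3"
      by (auto simp: eventually_sequentially)
    have est: "q (T n t x - Tlim t x) \<le> e" if n: "n \<ge> max N N'" and t: "t \<ge> 0" "\<bar>t - t0\<bar> < min d d'" for n t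
    proof -
      have "T n t x - Tlim t x = (T n t x - T n t0 x) + (T n t0 x - Tlim t0 x) - (Tlim t x - Tlim t0 x)" by simp
      then have "q (T n t x - Tlim t x) \<le> q (T n t x - T n t0 x) + q (T n t0 x - Tlim t0 x) + q (Tlim t x - Tlim t0 x)"
        using seminorm_diff[OF sn, of "(T n t x - T n t0 x) + (T n t0 x - Tlim t0 x)" "Tlim t x - Tlim t0 x"]
          seminorm_add[OF sn, of "T n t x - T n t0 x" "T n t0 x - Tlim t0 x"] by simp
      then show ?thesis using d(2)[of n t] d'(2)[of t] N'[of n] n t by simp
    qed
    have "?Q u v" if uv: "u \<le> t0" "t0 \<le> v" "v - u < min d d'" for u v
    proof
      assume u: "0 \<le> u"
      have "q (T n t x - Tlim t x) \<le> e" if "n \<ge> max N N'" "t \<in> {u..v}" for n t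
        using that u uv by (intro est) auto
      then show "\<exists>N. \<forall>n\<ge>N. \<forall>t\<in>{u..v}. q (T n t x - Tlim t x) \<le> e" by blast
    qed
    then show "\<exists>d>0. \<forall>u v. u \<le> t0 \<and> t0 \<le> v \<and> v - u < d \<longrightarrow> ?Q u v"
      using d(1) d'(1) by (intro exI[of _ "min d d'"]) auto
  qed
  then show ?thesis by simp
qed

end

text \<open>Convergence is uniform on bounded time intervals only, so the Laplace integral is cut at
  b: the tails are small in norm uniformly in n, and the mean value inequality handles [0, b]. The
  norm bound of the resolvents then upgrades \<tau> to \<gamma>.\<close>

lemma lap_converges:
  assumes U: "bounded_semigroup M U" and \<mu>: "\<mu> > 0"
    and conv: "\<And>p b e. p \<in> P \<Longrightarrow> b \<ge> 0 \<Longrightarrow> e > 0 \<Longrightarrow> \<exists>N. \<forall>n\<ge>N. \<forall>t\<in>{0..b}. p (T n t x - U t x) \<le> e"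
  shows "limitin \<gamma> (\<lambda>n. lap (T n) \<mu> x) (lap U \<mu> x) sequentially"
proof (rule tau_bounded_imp_gamma)
  show "\<forall>\<^sub>F n in sequentially. norm (lap (T n) \<mu> x) \<le> M / \<mu> * norm x"
    by (intro always_eventually allI lap_norm[OF sg M0 \<mu>])
  show "limitin \<tau> (\<lambda>n. lap (T n) \<mu> x) (lap U \<mu> x) sequentially"
    unfolding limitin_tau
  proof (intro ballI tendstoI)
    fix p and e :: real assume p: "p \<in> P" and e: "e > 0"
    note pG = P_subset_G[OF p]
    note sn = P_seminorm[OF p]
    define K where "K = M * norm x / \<mu>"
    have "((\<lambda>b. K * exp (- \<mu> * b)) \<longlongrightarrow> 0) at_top" using \<mu> by real_asymp
    then have "\<forall>\<^sub>F b in at_top. K * exp (- \<mu> * b) < e / 4 \<and> b \<ge> 0"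
      using e by (intro eventually_conj order_tendstoD(2) eventually_ge_at_top) auto
    then obtain b where b: "K * exp (- \<mu> * b) < e / 4" "b \<ge> 0" by (auto simp: eventually_at_top_linorder)
    define e' where "e' = e / (4 * (b + 1))"
    have e': "e' > 0" "e' * b < e / 4"
      using e b by (auto simp: e'_def field_simps)
    obtain N where N: "\<And>n t. n \<ge> N \<Longrightarrow> 0 \<le> t \<Longrightarrow> t \<le> b \<Longrightarrow> p (T n t x - U t x) \<le> e'"
      using conv[OF p b(2) e'(1)] by (metis atLeastAtMost_iff)
    have "p (lap (T n) \<mu> x - lap U \<mu> x) < e" if n: "n \<ge> N" for n
    proof -
      let ?a = "lap (T n) \<mu> x - prim (T n) \<mu> x b" and ?b = "lap U \<mu> x - prim U \<mu> x b"
        and ?c = "prim (T n) \<mu> x b - prim U \<mu> x b"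
      have "norm ?a \<le> K * exp (- \<mu> * b)"
        unfolding K_def by (rule lap_tail[OF sg M0 \<mu> sg_norm[OF sg M0] b(2)])
      then have 1: "p ?a < e / 4" using P_le_norm[OF p, of ?a] b(1) by linarith
      have "norm ?b \<le> K * exp (- \<mu> * b)"
        unfolding K_def by (rule lap_tail[OF U M0 \<mu> sg_norm[OF U M0] b(2)])
      then have 2: "p ?b < e / 4" using P_le_norm[OF p, of ?b] b(1) by linarith
      have "p ((\<lambda>t. prim (T n) \<mu> x t - prim U \<mu> x t) b - (\<lambda>t. prim (T n) \<mu> x t - prim U \<mu> x t) 0) \<le> (\<lambda>t. e' * t) b - (\<lambda>t. e' * t) 0"
      proof (rule gderiv_mean_value[OF _ b(2) gderiv_diff[OF prim_deriv[OF sg M0] prim_deriv[OF U M0]] pG])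
        fix t assume t: "0 \<le> t" "t \<le> b"
        have "exp (- \<mu> * t) * p (T n t x - U t x) \<le> 1 * e'"
          using N[OF n t] \<mu> t seminorm_nonneg[OF sn] by (intro mult_mono) auto
        then show "p (exp (- \<mu> * t) *\<^sub>R T n t x - exp (- \<mu> * t) *\<^sub>R U t x) \<le> e'"
          unfolding scaleR_diff_right[symmetric] by (simp add: seminorm_scaleR[OF sn])
        show "((\<lambda>t. e' * t) has_real_derivative e') (at t within {0..b})"
          by (auto intro!: derivative_eq_intros)
      qed auto
      then have 3: "p ?c \<le> e' * b" by (simp add: prim_0[OF sg M0] prim_0[OF U M0])
      have eq: "(?a - ?b) + ?c = lap (T n) \<mu> x - lap U \<mu> x" by simp
      have "p (lap (T n) \<mu> x - lap U \<mu> x) \<le> p ?a + p ?b + p ?c"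
        using seminorm_add[OF sn, of "?a - ?b" ?c, unfolded eq] seminorm_diff[OF sn, of ?a ?b] by linarith
      then show ?thesis using 1 2 3 e'(2) e by linarith
    qed
    then show "\<forall>\<^sub>F n in sequentially. dist (p (lap (T n) \<mu> x - lap U \<mu> x)) 0 < e"
      using seminorm_nonneg[OF sn] unfolding eventually_sequentially by auto
  qed
qed

end

section \<open>Bi-generators of locally bi-continuous semigroups\<close>

definition rescaled :: "real \<Rightarrow> (real \<Rightarrow> 'a \<Rightarrow> 'a) \<Rightarrow> real \<Rightarrow> 'a \<Rightarrow> 'a" where
  "rescaled \<omega> S t x = exp (- \<omega> * t) *\<^sub>R S t x"

lemma rescaled_inverse: "S t x = exp (\<omega> * t) *\<^sub>R rescaled \<omega> S t x"
  by (simp add: rescaled_def exp_minus)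

lemma exp_minus_mult_le: "0 \<le> t \<Longrightarrow> t \<le> b \<Longrightarrow> exp (- \<omega> * t) \<le> exp (\<bar>\<omega>\<bar> * (b :: real))"
  using mult_mono[of "\<bar>\<omega>\<bar>" "\<bar>\<omega>\<bar>" t b] abs_ge_minus_self[of "\<omega> * t"] by (simp add: abs_mult)

lemma bi_continuous_norm:
  assumes S: "locally_bi_continuous_semigroup scal \<tau> S" and t: "t \<ge> 0"
    and on: "onorm (S t) \<le> K"
  shows "norm (S t x) \<le> K * norm x"
proof -
  have "bounded_linear (S t)" using S t by (simp add: locally_bi_continuous_semigroup_def bounded_operator_def)
  then have "norm (S t x) \<le> onorm (S t) * norm x" by (rule onorm)
  also have "\<dots> \<le> K * norm x" using on by (intro mult_right_mono) auto
  finally show ?thesis .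
qed

text \<open>The index type is left open: the sequence of semigroups and, over the unit type, a
  single semigroup are both instances.\<close>

lemma family_equicontinuous:
  fixes S :: "'j \<Rightarrow> real \<Rightarrow> 'a \<Rightarrow> 'a"
  assumes S: "\<And>j. locally_bi_continuous_semigroup scal \<tau> (S j)"
    and on: "\<And>j t. t \<ge> 0 \<Longrightarrow> onorm (S j t) \<le> M * exp (\<omega> * t)"
    and eq: "bi_equicontinuous \<tau> (UNIV \<times> {0..b}) (\<lambda>(j, t). S j t)" and q: "q \<in> G" and M: "M \<ge> 0"
  shows "\<exists>q'\<in>G. \<forall>j. \<forall>t\<in>{0..b}. \<forall>x. q (rescaled \<omega> (S j) t x) \<le> q' x"
proof -
  have "\<exists>q'\<in>G. \<forall>z\<in>UNIV \<times> {0..b}. \<forall>x. q ((case z of (j, t) \<Rightarrow> S j t) x) \<le> q' x"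
  proof (rule equicontinuousI[OF _ _ bi_equicontinuousD[OF eq] q])
    fix z :: "'j \<times> real" assume "z \<in> UNIV \<times> {0..b}"
    then obtain j t where z: "z = (j, t)" "0 \<le> t" "t \<le> b" by auto
    show "Vector_Spaces.linear scal scal (case z of (j, t) \<Rightarrow> S j t)"
      using S[of j] z by (simp add: locally_bi_continuous_semigroup_def bounded_operator_def)
    fix x
    have "norm (S j t x) \<le> M * exp (\<omega> * t) * norm x" by (rule bi_continuous_norm[OF S z(2) on[OF z(2)]])
    also have "\<dots> \<le> M * exp (\<bar>\<omega>\<bar> * b) * norm x"
      using exp_minus_mult_le[OF z(2,3), of "- \<omega>"] M by (intro mult_right_mono mult_left_mono) auto
    finally show "norm ((case z of (j, t) \<Rightarrow> S j t) x) \<le> M * exp (\<bar>\<omega>\<bar> * b) * norm x" using z by simp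
  qed
  then obtain q' where q': "q' \<in> G" "\<And>j t x. 0 \<le> t \<Longrightarrow> t \<le> b \<Longrightarrow> q (S j t x) \<le> q' x" by fastforce
  have "q (rescaled \<omega> (S j) t x) \<le> exp (\<bar>\<omega>\<bar> * b) * q' x" if t: "0 \<le> t" "t \<le> b" for j t x
    unfolding rescaled_def seminorm_scaleR[OF G_seminorm[OF q]]
    using exp_minus_mult_le[OF t] q'(2)[OF t] seminorm_nonneg[OF G_seminorm[OF q]] by (intro mult_mono) auto
  then show ?thesis using G_mult[OF q'(1), of "exp (\<bar>\<omega>\<bar> * b)"]
    by (intro bexI[of _ "\<lambda>x. exp (\<bar>\<omega>\<bar> * b) * q' x"]) auto
qed

text \<open>Orbits are locally bounded in norm, and on norm-bounded sets \<tau>-continuity implies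
  \<gamma>-continuity.\<close>

lemma bi_continuous_gcts:
  assumes S: "locally_bi_continuous_semigroup scal \<tau> S"
    and on: "\<And>t. t \<ge> 0 \<Longrightarrow> onorm (S t) \<le> M * exp (\<omega> * t)" and M: "M \<ge> 0"
  shows "gcts (\<lambda>t. S t x)"
  unfolding gcts_def
proof (intro allI ballI impI)
  fix t :: real and q and e :: real assume t: "t \<ge> 0" and q: "q \<in> G" and e: "e > 0"
  define K where "K = M * exp (\<bar>\<omega>\<bar> * (t + 1)) * norm x"
  have K: "norm (S s x) \<le> K" if "0 \<le> s" "s \<le> t + 1" for s
  proof -
    have "norm (S s x) \<le> M * exp (\<omega> * s) * norm x" by (rule bi_continuous_norm[OF S that(1) on[OF that(1)]])
    also have "\<dots> \<le> K"
      unfolding K_def using exp_minus_mult_le[OF that, of "- \<omega>"] M by (intro mult_right_mono mult_left_mono) auto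
    finally show ?thesis .
  qed
  obtain p d where p: "p \<in> P" "d > 0" "\<And>y. norm y \<le> K + K \<Longrightarrow> p y < d \<Longrightarrow> q y < e"
    using G_smallD[OF q e, of "K + K"] by metis
  have "continuous_map (top_of_set {0..}) \<tau> (\<lambda>t. S t x)"
    using S by (simp add: locally_bi_continuous_semigroup_def)
  from openin_continuous_map_preimage[OF this openin_tau_ball[OF p(1), of "S t x" d]]
  have "openin (top_of_set {0..}) {s \<in> {0..}. p (S s x - S t x) < d}" by simp
  moreover have "t \<in> {s \<in> {0..}. p (S s x - S t x) < d}" using t p by (simp add: seminorm_0[OF P_seminorm])
  ultimately obtain r where r: "r > 0" "\<And>s. s \<ge> 0 \<Longrightarrow> \<bar>s - t\<bar> < r \<Longrightarrow> p (S s x - S t x) < d"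
    unfolding openin_euclidean_subtopology_iff dist_real_def by (metis (mono_tags, lifting) atLeast_iff mem_Collect_eq)
  have "q (S s x - S t x) < e" if s: "s \<ge> 0" "\<bar>s - t\<bar> < min 1 r" for s
  proof (rule p(3))
    have "s \<le> t + 1" using s by linarith
    then show "norm (S s x - S t x) \<le> K + K"
      using norm_triangle_ineq4[of "S s x" "S t x"] K[of s] K[of t] s t by simp
    show "p (S s x - S t x) < d" using r(2) s by simp
  qed
  then show "\<exists>d>0. \<forall>s\<ge>0. \<bar>s - t\<bar> < d \<longrightarrow> q (S s x - S t x) < e"
    using r(1) by (intro exI[of _ "min 1 r"]) auto
qed

lemma rescaled_bounded_semigroup:
  assumes S: "locally_bi_continuous_semigroup scal \<tau> S"
    and on: "\<And>t. t \<ge> 0 \<Longrightarrow> onorm (S t) \<le> M * exp (\<omega> * t)" and M: "M \<ge> 0"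
  shows "bounded_semigroup M (rescaled \<omega> S)"
proof -
  have lin: "Vector_Spaces.linear scal scal (S t)" if "t \<ge> 0" for t
    using S that by (simp add: locally_bi_continuous_semigroup_def bounded_operator_def)
  have eqc: "\<exists>q'\<in>G. \<forall>t\<in>{0..b}. \<forall>x. q (rescaled \<omega> S t x) \<le> q' x" if q: "q \<in> G" for q b
  proof -
    have "bi_equicontinuous \<tau> {0..b} S" using S by (auto simp: locally_bi_continuous_semigroup_def)
    then have "bi_equicontinuous \<tau> (UNIV \<times> {0..b}) (\<lambda>(j :: unit, t). S t)"
      unfolding bi_equicontinuous_def by simp
    from family_equicontinuous[OF S on this q M] show ?thesis by simp
  qed
  show ?thesis
    unfolding bounded_semigroup_def
  proof (intro conjI allI ballI impI)
    show "gcont (rescaled \<omega> S t)" if t: "t \<ge> 0" for t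
      unfolding gcont_def
    proof (intro conjI ballI)
      show "Vector_Spaces.linear scal scal (rescaled \<omega> S t)"
        unfolding rescaled_def using lin[OF t]
        by (intro linI) (auto simp: lin_add lin_scal scaleR_add_right scal_of_real[symmetric] scale_left_commute)
      fix q assume "q \<in> G"
      from eqc[OF this, of t] obtain q' where "q' \<in> G" "\<forall>s\<in>{0..t}. \<forall>x. q (rescaled \<omega> S s x) \<le> q' x" by blast
      then show "\<exists>q'\<in>G. \<forall>x. q (rescaled \<omega> S t x) \<le> q' x" using t by (intro bexI[of _ q']) auto
    qed
    show "rescaled \<omega> S 0 x = x" for x
      using S by (simp add: rescaled_def locally_bi_continuous_semigroup_def operator_semigroup_def)
    show "rescaled \<omega> S (s + t) x = rescaled \<omega> S s (rescaled \<omega> S t x)" if st: "s \<ge> 0" "t \<ge> 0" for s t x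
    proof -
      have "S s (S t x) = S (s + t) x"
        using S st unfolding locally_bi_continuous_semigroup_def operator_semigroup_def by (metis comp_apply)
      then show ?thesis
        by (simp add: rescaled_def lin_scaleR[OF lin[OF st(1)]] exp_add[symmetric] algebra_simps)
    qed
    show "norm (rescaled \<omega> S t x) \<le> M * norm x" if t: "t \<ge> 0" for t x
    proof -
      have "exp (- \<omega> * t) * norm (S t x) \<le> exp (- \<omega> * t) * (M * exp (\<omega> * t) * norm x)"
        by (intro mult_left_mono bi_continuous_norm[OF S t on[OF t]]) simp
      also have "\<dots> = M * norm x" by (simp add: exp_minus)
      finally show ?thesis by (simp add: rescaled_def)
    qed
    show "gcts (\<lambda>t. rescaled \<omega> S t x)" for x
      unfolding rescaled_def by (intro gcts_scaleR bi_continuous_gcts[OF S on M] continuous_intros)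
  qed (use eqc in blast)
qed

lemma bi_continuousI:
  assumes T: "bounded_semigroup M T" and M: "M \<ge> 0"
  shows "locally_bi_continuous_semigroup scal \<tau> (\<lambda>t x. exp (\<omega> * t) *\<^sub>R T t x)"
    and "t \<ge> 0 \<Longrightarrow> onorm (\<lambda>x. exp (\<omega> * t) *\<^sub>R T t x) \<le> M * exp (\<omega> * t)"
proof -
  let ?S = "\<lambda>t x. exp (\<omega> * t) *\<^sub>R T t x"
  have norm: "norm (?S t x) \<le> M * exp (\<omega> * t) * norm x" if "t \<ge> 0" for t x
    using mult_left_mono[OF sg_norm[OF T M that, of x], of "exp (\<omega> * t)"] by (simp add: algebra_simps)
  show on: "onorm (?S t) \<le> M * exp (\<omega> * t)" if "t \<ge> 0" for t
    using norm[OF that] M by (intro onorm_bound) auto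
  have lin: "Vector_Spaces.linear scal scal (?S t)" if t: "t \<ge> 0" for t
    using sg_linear[OF T M t]
    by (intro linI) (auto simp: lin_add lin_scal scaleR_add_right scal_of_real[symmetric] scale_left_commute)
  have bl: "bounded_linear (?S t)" if "t \<ge> 0" for t
    by (rule lin_bounded_linear[OF lin[OF that] norm[OF that]])
  have eqc: "\<exists>q'\<in>G. \<forall>t\<in>{0..b}. \<forall>x. q (?S t x) \<le> q' x" if q: "q \<in> G" for q b
  proof -
    obtain q' where q': "q' \<in> G" "\<And>t x. 0 \<le> t \<Longrightarrow> t \<le> b \<Longrightarrow> q (T t x) \<le> q' x"
      using sg_equicont[OF T M q, of b] by (metis atLeastAtMost_iff)
    have "q (?S t x) \<le> exp (\<bar>\<omega>\<bar> * b) * q' x" if t: "0 \<le> t" "t \<le> b" for t x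
      unfolding seminorm_scaleR[OF G_seminorm[OF q]]
      using exp_minus_mult_le[OF t, of "- \<omega>"] q'(2)[OF t] seminorm_nonneg[OF G_seminorm[OF q]] by (intro mult_mono) auto
    then show ?thesis using G_mult[OF q'(1), of "exp (\<bar>\<omega>\<bar> * b)"]
      by (intro bexI[of _ "\<lambda>x. exp (\<bar>\<omega>\<bar> * b) * q' x"]) auto
  qed
  have cts: "gcts (\<lambda>t. ?S t x)" for x
    by (intro gcts_scaleR sg_gcts[OF T M] continuous_intros)
  show "locally_bi_continuous_semigroup scal \<tau> ?S"
    unfolding locally_bi_continuous_semigroup_def operator_semigroup_def
  proof (intro conjI allI impI)
    show "Vector_Spaces.linear scal scal (?S t)" if "t \<ge> 0" for t by (rule lin[OF that])
    show "?S 0 = id" by (auto simp: sg_0[OF T M])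
    show "?S t \<circ> ?S s = ?S (t + s)" if "t \<ge> 0" "s \<ge> 0" for t s
      by (rule ext) (simp add: sg_add[OF T M that] lin_scaleR[OF sg_linear[OF T M that(1)]] exp_add distrib_left)
    show "bounded_operator scal (?S t)" if "t \<ge> 0" for t
      using lin[OF that] bl[OF that] by (simp add: bounded_operator_def)
    show "continuous_map (top_of_set {0..}) \<tau> (\<lambda>t. ?S t x)" for x
      unfolding continuous_map_eq_topcontinuous_at topcontinuous_at_def topspace_tau
    proof (intro ballI conjI allI impI UNIV_I)
      fix t U assume t: "t \<in> topspace (top_of_set {0..})" and U: "openin \<tau> U \<and> ?S t x \<in> U"
      then have t0: "t \<ge> 0" by simp
      obtain p r where p: "p \<in> P" "r > 0" "\<And>y. p (y - ?S t x) < r \<Longrightarrow> y \<in> U"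
        using U unfolding openin_tau by metis
      obtain d where d: "d > 0" "\<And>s. s \<ge> 0 \<Longrightarrow> \<bar>s - t\<bar> < d \<Longrightarrow> p (?S s x - ?S t x) < r"
        using gctsD[OF cts t0 P_subset_G[OF p(1)] p(2)] by metis
      show "\<exists>V. openin (top_of_set {0..}) V \<and> t \<in> V \<and> (\<forall>y\<in>V. ?S y x \<in> U)"
      proof (intro exI[of _ "{0..} \<inter> ball t d"] conjI ballI)
        show "openin (top_of_set {0..}) ({0..} \<inter> ball t d)" by (simp add: openin_open_Int)
        show "t \<in> {0..} \<inter> ball t d" using t0 d by simp
        show "?S s x \<in> U" if "s \<in> {0..} \<inter> ball t d" for s
          using that by (intro p(3) d(2)) (auto simp: dist_real_def)
      qed
    qed auto
    fix N :: "real set" assume N: "compact N \<and> N \<subseteq> {0..}"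
    then have "bounded N" by (simp add: compact_imp_bounded)
    then obtain b where "\<forall>t\<in>N. \<bar>t\<bar> \<le> b" unfolding bounded_iff real_norm_def by blast
    then have b: "N \<subseteq> {0..b}" using N by (fastforce simp: subset_iff)
    show "bdd_above ((\<lambda>t. onorm (?S t)) ` N)"
    proof (rule bdd_aboveI2)
      fix t assume "t \<in> N"
      then have t: "0 \<le> t" "t \<le> b" using b by auto
      have "M * exp (\<omega> * t) \<le> M * exp (\<bar>\<omega>\<bar> * b)"
        using exp_minus_mult_le[OF t, of "- \<omega>"] M by (intro mult_left_mono) auto
      then show "onorm (?S t) \<le> M * exp (\<bar>\<omega>\<bar> * b)" using on[OF t(1)] by linarith
    qed
    show "bi_equicontinuous \<tau> N ?S"
    proof (rule bi_equicontinuousI)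
      show "Vector_Spaces.linear scal scal (?S t)" if "t \<in> N" for t using that N by (intro lin) auto
      show "\<exists>q'\<in>G. \<forall>t\<in>N. \<forall>x. q (?S t x) \<le> q' x" if "q \<in> G" for q
        using eqc[OF that, of b] b by (meson subsetD)
    qed
  qed
qed

lemma gderiv_0_limit:
  assumes "gderiv F y 0"
  shows "limitin \<gamma> (\<lambda>t. (1 / t) *\<^sub>R (F t - F 0)) y (at_right 0)"
  unfolding limitin_gamma
proof (intro ballI tendstoI)
  fix q and e :: real assume q: "q \<in> G" and e: "e > 0"
  note sn = G_seminorm[OF q]
  obtain d where d: "d > 0" "\<And>s. s \<ge> 0 \<Longrightarrow> \<bar>s - 0\<bar> < d \<Longrightarrow> q (F s - F 0 - (s - 0) *\<^sub>R y) \<le> e/2 * \<bar>s - 0\<bar>"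
    using gderivD[OF assms q half_gt_zero[OF e]] by metis
  have "q ((1 / s) *\<^sub>R (F s - F 0) - y) < e" if s: "0 < s" "s < d" for s
  proof -
    have "(1 / s) *\<^sub>R (F s - F 0) - y = (1 / s) *\<^sub>R (F s - F 0 - s *\<^sub>R y)"
      using s by (simp add: scaleR_diff_right)
    then have "q ((1 / s) *\<^sub>R (F s - F 0) - y) = (1 / s) * q (F s - F 0 - s *\<^sub>R y)"
      using s by (simp add: seminorm_scaleR[OF sn])
    also have "\<dots> \<le> (1 / s) * (e/2 * s)" using d(2)[of s] s by (intro mult_left_mono) auto
    also have "\<dots> < e" using s e by simp
    finally show ?thesis .
  qed
  then show "\<forall>\<^sub>F t in at_right 0. dist (q ((1 / t) *\<^sub>R (F t - F 0) - y)) 0 < e"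
    using d(1) seminorm_nonneg[OF sn] by (auto simp: eventually_at_right_field intro!: exI[of _ d])
qed

lemma bi_generator_SomeD:
  assumes "bi_generator \<tau> S x = Some z"
  shows "limitin \<tau> (\<lambda>t. (1 / t) *\<^sub>R (S t x - x)) z (at_right 0)"
    and "bdd_above ((\<lambda>t. (1 / t) * norm (S t x - x)) ` {0<..1})"
proof -
  let ?L = "\<lambda>y. limitin \<tau> (\<lambda>t. (1 / t) *\<^sub>R (S t x - x)) y (at_right 0)"
  have *: "(\<exists>y. ?L y) \<and> bdd_above ((\<lambda>t. (1 / t) * norm (S t x - x)) ` {0<..1})" "z = (THE y. ?L y)"
    using assms unfolding bi_generator_def by (auto split: if_splits)
  show "bdd_above ((\<lambda>t. (1 / t) * norm (S t x - x)) ` {0<..1})" using *(1) by (rule conjunct2)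
  obtain y where y: "?L y" using conjunct1[OF *(1)] by (rule exE)
  have "(THE y. ?L y) = y" using y tau_limit_unique trivial_limit_at_right_real by (intro the_equality) blast+
  then show "?L z" using y *(2) by simp
qed

lemma bi_generator_SomeI:
  assumes y: "limitin \<tau> (\<lambda>t. (1 / t) *\<^sub>R (S t x - x)) y (at_right 0)"
    and b: "bdd_above ((\<lambda>t. (1 / t) * norm (S t x - x)) ` {0<..1})"
  shows "bi_generator \<tau> S x = Some y"
proof -
  have "(THE y. limitin \<tau> (\<lambda>t. (1 / t) *\<^sub>R (S t x - x)) y (at_right 0)) = y"
    using y tau_limit_unique trivial_limit_at_right_real by (intro the_equality) blast+
  then show ?thesis using assms unfolding bi_generator_def by auto
qed

context
  fixes S :: "real \<Rightarrow> 'a \<Rightarrow> 'a" and M \<omega> l :: real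
  assumes S: "locally_bi_continuous_semigroup scal \<tau> S"
    and on: "\<And>t. t \<ge> 0 \<Longrightarrow> onorm (S t) \<le> M * exp (\<omega> * t)"
    and M: "M \<ge> 0" and l: "l > \<omega>"
begin

abbreviation (input) "T \<equiv> rescaled \<omega> S"
abbreviation (input) "L \<equiv> lap (rescaled \<omega> S) (l - \<omega>)"

lemma rescaled_semigroup: "bounded_semigroup M T"
  by (rule rescaled_bounded_semigroup[OF S on M])

lemma l_minus_omega_pos: "l - \<omega> > 0"
  using l by simp

text \<open>Undoing the rescaling adds \<omega> to the generator, which turns l - \<omega> back into
  l.\<close>

lemma lap_orbit_S:
  assumes t: "t \<ge> 0"
  shows "gderiv (\<lambda>t. S t (L x)) (S t (l *\<^sub>R L x - x)) t"
proof -
  note lin = sg_linear[OF rescaled_semigroup M t]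
  have "((\<lambda>t. exp (\<omega> * t)) has_real_derivative \<omega> * exp (\<omega> * t)) (at t)"
    by (auto intro!: derivative_eq_intros)
  from gderiv_scaleR[OF lap_orbit_deriv[OF rescaled_semigroup M l_minus_omega_pos t, of x] this]
  have "gderiv (\<lambda>t. exp (\<omega> * t) *\<^sub>R T t (L x))
    (exp (\<omega> * t) *\<^sub>R T t ((l - \<omega>) *\<^sub>R L x - x) + (\<omega> * exp (\<omega> * t)) *\<^sub>R T t (L x)) t" .
  moreover have "exp (\<omega> * t) *\<^sub>R T t ((l - \<omega>) *\<^sub>R L x - x) + (\<omega> * exp (\<omega> * t)) *\<^sub>R T t (L x) = S t (l *\<^sub>R L x - x)"
    unfolding rescaled_inverse[of S t _ \<omega>] by (simp add: lin_diff[OF lin] lin_add[OF lin] lin_scaleR[OF lin] algebra_simps)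
  ultimately show ?thesis unfolding rescaled_inverse[of S _ _ \<omega>, symmetric] by simp
qed

lemma S_0: "S 0 x = x"
  using S by (simp add: locally_bi_continuous_semigroup_def operator_semigroup_def)

text \<open>Differentiability of the orbit at 0 gives the limit, the mean value inequality the
  boundedness of the difference quotients on (0, 1].\<close>

lemma generator_lap: "bi_generator \<tau> S (L x) = Some (l *\<^sub>R L x - x)"
proof (rule bi_generator_SomeI)
  define z where "z = l *\<^sub>R L x - x"
  have "gderiv (\<lambda>t. S t (L x)) z 0" using lap_orbit_S[of 0 x] by (simp add: S_0 z_def)
  from gderiv_0_limit[OF this]
  show "limitin \<tau> (\<lambda>t. (1 / t) *\<^sub>R (S t (L x) - L x)) (l *\<^sub>R L x - x) (at_right 0)"
    by (simp add: S_0 gamma_imp_tau z_def)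
  define K where "K = M * exp (\<bar>\<omega>\<bar> * 1) * norm z"
  show "bdd_above ((\<lambda>t. (1 / t) * norm (S t (L x) - L x)) ` {0<..1})"
  proof (rule bdd_aboveI2)
    fix t :: real assume t: "t \<in> {0<..1}"
    have "norm (S t (L x) - S 0 (L x)) \<le> (\<lambda>t. K * t) t - (\<lambda>t. K * t) 0"
    proof (rule gderiv_mean_value_norm)
      fix s assume s: "0 \<le> s" "s \<le> t"
      show "gderiv (\<lambda>t. S t (L x)) (S s z) s" unfolding z_def by (rule lap_orbit_S[OF s(1)])
      have "norm (S s z) \<le> M * exp (\<omega> * s) * norm z" by (rule bi_continuous_norm[OF S s(1) on[OF s(1)]])
      also have "\<dots> \<le> K"
        unfolding K_def using exp_minus_mult_le[of s 1 "- \<omega>"] s t M by (intro mult_right_mono mult_left_mono) auto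
      finally show "norm (S s z) \<le> K" .
      show "((\<lambda>t. K * t) has_real_derivative K) (at s within {0..t})"
        by (auto intro!: derivative_eq_intros)
    qed (use t in auto)
    then show "(1 / t) * norm (S t (L x) - L x) \<le> K" using t by (simp add: S_0 field_simps)
  qed
qed

lemma lap_S: "t \<ge> 0 \<Longrightarrow> L (S t x) = S t (L x)"
  unfolding rescaled_inverse[of S t _ \<omega>]
  by (simp add: lin_scaleR[OF lap_linear[OF rescaled_semigroup M l_minus_omega_pos]] lap_sg[OF rescaled_semigroup M l_minus_omega_pos])

text \<open>By the boundedness clause of the bi-generator the difference quotients of x converge for
  \<gamma>, so \<open>L\<close> may be applied to them. As \<open>L\<close> commutes with the
  semigroup, the images are the difference quotients of \<open>L x\<close>, whose limit is
  known.\<close>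

lemma generator_lap_inverse:
  assumes "bi_generator \<tau> S x = Some z"
  shows "L (l *\<^sub>R x - z) = x"
proof -
  note lin = lap_linear[OF rescaled_semigroup M l_minus_omega_pos]
  have h: "filterlim (\<lambda>n. 1 / real (Suc n)) (at_right 0) sequentially"
    by real_asymp
  let ?d = "\<lambda>x n. (1 / (1 / real (Suc n))) *\<^sub>R (S (1 / real (Suc n)) x - x)"
  have comp: "limitin \<tau> (?d x) z sequentially" if "limitin \<tau> (\<lambda>t. (1 / t) *\<^sub>R (S t x - x)) z (at_right 0)" for x z
    unfolding limitin_tau
  proof
    fix p assume "p \<in> P"
    then have "((\<lambda>t. p ((1 / t) *\<^sub>R (S t x - x) - z)) \<longlongrightarrow> 0) (at_right 0)"
      using that by (simp add: limitin_tau)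
    from filterlim_compose[OF this h] show "(\<lambda>n. p (?d x n - z)) \<longlonglongrightarrow> 0" .
  qed
  from bi_generator_SomeD(2)[OF assms, unfolded bdd_above_def]
  obtain K where K0: "\<forall>r\<in>(\<lambda>t. (1 / t) * norm (S t x - x)) ` {0<..1}. r \<le> K" by (rule exE)
  have K: "(1 / t) * norm (S t x - x) \<le> K" if "t \<in> {0<..1}" for t
    by (rule bspec[OF K0 imageI[OF that]])
  have K: "norm (?d x n) \<le> K" for n
    using K[of "1 / real (Suc n)"] by simp
  have "limitin \<gamma> (?d x) z sequentially"
    by (rule tau_bounded_imp_gamma[OF comp[OF bi_generator_SomeD(1)[OF assms]] always_eventually]) (use K in blast)
  from gcont_limit[OF lap_gcont[OF rescaled_semigroup M l_minus_omega_pos] this]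
  have "limitin \<gamma> (\<lambda>n. ?d (L x) n) (L z) sequentially"
    by (simp add: lin_scaleR[OF lin] lin_diff[OF lin] lap_S)
  moreover have "limitin \<tau> (?d (L x)) (l *\<^sub>R L x - x) sequentially"
    by (rule comp[OF bi_generator_SomeD(1)[OF generator_lap]])
  ultimately have "L z = l *\<^sub>R L x - x" using tau_limit_unique gamma_imp_tau sequentially_bot by blast
  then show ?thesis by (simp add: lin_diff[OF lin] lin_scaleR[OF lin])
qed

lemma generator_iff: "bi_generator \<tau> S y = Some z \<longleftrightarrow> L (l *\<^sub>R y - z) = y"
proof
  assume *: "L (l *\<^sub>R y - z) = y"
  show "bi_generator \<tau> S y = Some z" using generator_lap[of "l *\<^sub>R y - z"] by (simp add: *)
qed (rule generator_lap_inverse)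

lemma shifted_lap: "shifted scal (of_real l) (bi_generator \<tau> S) (L x) = x"
  by (simp add: shifted_def generator_lap scal_of_real)

lemma lap_shifted: "y \<in> dom (bi_generator \<tau> S) \<Longrightarrow> L (shifted scal (of_real l) (bi_generator \<tau> S) y) = y"
  using generator_lap_inverse by (auto simp: shifted_def scal_of_real)

lemma generator_resolvent:
  "of_real l \<in> resolvent_set scal (bi_generator \<tau> S)" "resolvent scal (of_real l) (bi_generator \<tau> S) = L"
proof -
  let ?B = "bi_generator \<tau> S"
  let ?s = "shifted scal (of_real l) ?B"
  have dom: "L x \<in> dom ?B" for x using generator_lap by blast
  have bij: "bij_betw ?s (dom ?B) UNIV"
    using lap_shifted shifted_lap dom by (intro bij_betwI[where g = L]) auto
  show res: "resolvent scal (of_real l) ?B = L"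
  proof
    fix x
    have "resolvent scal (of_real l) ?B (?s (L x)) = L x"
      unfolding resolvent_def using bij dom by (intro inv_into_f_f) (auto simp: bij_betw_def)
    then show "resolvent scal (of_real l) ?B x = L x" by (simp add: shifted_lap)
  qed
  have "bounded_operator scal L"
    unfolding bounded_operator_def
    using lap_linear[OF rescaled_semigroup M l_minus_omega_pos] lin_bounded_linear lap_norm[OF rescaled_semigroup M l_minus_omega_pos] by blast
  then show "of_real l \<in> resolvent_set scal ?B" using bij res by (simp add: resolvent_set_def)
qed

lemma lap_inj: "inj L"
  by (rule injI) (metis shifted_lap)

text \<open>Averages of the rescaled, exponentially damped orbit over [0, h] tend to x, and the
  shift formula places the integrals in the range. Taking h = 1/(n + 1) yields the sequence that
  bi-density asks for.\<close>

lemma lap_bi_dense: "bi_dense \<tau> (range L)"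
  unfolding bi_dense_iff
proof
  fix x
  let ?F = "prim T (l - \<omega>) x"
  note lin = lap_linear[OF rescaled_semigroup M l_minus_omega_pos]
  have F: "?F h \<in> range L" if h: "h \<ge> 0" for h
  proof -
    have e: "exp (- (l - \<omega>) * h) * exp ((l - \<omega>) * h) = 1"
      unfolding exp_add[symmetric] by (simp add: algebra_simps)
    have "exp (- (l - \<omega>) * h) *\<^sub>R T h (L x) = L x - ?F h"
      unfolding lap_shift[OF rescaled_semigroup M l_minus_omega_pos h] scaleR_scaleR e by simp
    then have "?F h = L x - exp (- (l - \<omega>) * h) *\<^sub>R T h (L x)" by simp
    also have "\<dots> = L (x - exp (- (l - \<omega>) * h) *\<^sub>R T h x)"
      by (simp only: lin_diff[OF lin] lin_scaleR[OF lin] lap_sg[OF rescaled_semigroup M l_minus_omega_pos h])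
    finally show ?thesis by blast
  qed
  have h: "filterlim (\<lambda>n. 1 / real (Suc n)) (at_right 0) sequentially"
    by real_asymp
  have "gderiv ?F x 0" using prim_deriv[OF rescaled_semigroup M, of 0 "l - \<omega>" x] by (simp add: sg_0[OF rescaled_semigroup M])
  from gamma_limit_compose[OF gderiv_0_limit[OF this] h]
  have lim: "limitin \<gamma> (\<lambda>n. real (Suc n) *\<^sub>R ?F (1 / real (Suc n))) x sequentially"
    by (simp add: prim_0[OF rescaled_semigroup M])
  have range: "real (Suc n) *\<^sub>R ?F (1 / real (Suc n)) \<in> range L" for n
  proof -
    obtain w where "?F (1 / real (Suc n)) = L w" using F[of "1 / real (Suc n)"] by auto
    then show ?thesis by (auto simp: lin_scaleR[OF lin, symmetric])
  qed
  show "\<exists>s. range s \<subseteq> range L \<and> limitin \<gamma> s x sequentially"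
    by (rule exI, rule conjI[OF image_subsetI[OF range] lim])
qed

end

section \<open>The Trotter--Kato theorem\<close>

lemma linop_subspace: "linear_operator scal C \<Longrightarrow> subspace (dom C)"
  by (simp add: linear_operator_def)

lemma linop_0: "linear_operator scal C \<Longrightarrow> 0 \<in> dom C"
  by (rule subspace_0[OF linop_subspace])

lemma linop_dom_diff: "linear_operator scal C \<Longrightarrow> x \<in> dom C \<Longrightarrow> y \<in> dom C \<Longrightarrow> x - y \<in> dom C"
  by (rule subspace_diff[OF linop_subspace])

lemma linop_add: "linear_operator scal C \<Longrightarrow> x \<in> dom C \<Longrightarrow> y \<in> dom C \<Longrightarrow> the (C (x + y)) = the (C x) + the (C y)"
  unfolding linear_operator_def by blast

lemma linop_diff:
  assumes C: "linear_operator scal C" and x: "x \<in> dom C" and y: "y \<in> dom C"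
  shows "the (C (x - y)) = the (C x) - the (C y)"
  using linop_add[OF C linop_dom_diff[OF C x y] y] by simp

lemma linop_the_0: "linear_operator scal C \<Longrightarrow> the (C 0) = 0"
  using linop_diff[of C 0 0] linop_0 by simp

text \<open>The functions \<open>\<lambda>x. p x + p (the (C x))\<close> obey the triangle
  inequality on the domain only; elsewhere \<open>the (C x)\<close> is unspecified.\<close>

lemma openin_graph_topology:
  assumes C: "linear_operator scal C" and Q: "\<forall>q\<in>Q. is_seminorm scal q"
  shows "openin (graph_topology Q C) U \<longleftrightarrow>
    U \<subseteq> dom C \<and> (\<forall>x\<in>U. \<exists>F. finite F \<and> F \<subseteq> (\<lambda>p x. p x + p (the (C x))) ` Q \<and>
      (\<exists>r>0. \<forall>y\<in>dom C. (\<forall>q\<in>F. q (y - x) < r) \<longrightarrow> y \<in> U))"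
  unfolding graph_topology_def
proof (rule openin_seminorm_topology)
  show "x - y \<in> dom C" if "x \<in> dom C" "y \<in> dom C" for x y by (rule linop_dom_diff[OF C that])
  fix q assume "q \<in> (\<lambda>p x. p x + p (the (C x))) ` Q"
  then obtain p where p: "p \<in> Q" "q = (\<lambda>x. p x + p (the (C x)))" by auto
  note sn = bspec[OF Q p(1)]
  show "q 0 = 0" using p by (simp add: seminorm_0[OF sn] linop_the_0[OF C])
  show "q (x + y) \<le> q x + q y" if "x \<in> dom C" "y \<in> dom C" for x y
    using seminorm_add[OF sn, of x y] seminorm_add[OF sn, of "the (C x)" "the (C y)"]
    by (simp add: p linop_add[OF C that])
qed

text \<open>A ball of the graph topology controls vector and image at once, as both summands are
  nonnegative; the norm bounds in a bi-core then upgrade \<tau> to \<gamma>.\<close>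

lemma bi_core_sequence:
  assumes C: "linear_operator scal C" and D: "bi_core scal P C D" and x: "x \<in> dom C"
  obtains s where "range s \<subseteq> D" "limitin \<gamma> s x sequentially" "limitin \<gamma> (\<lambda>i. the (C (s i))) (the (C x)) sequentially"
proof -
  obtain s where s: "range s \<subseteq> D" "bounded (range s)" "bounded (range (\<lambda>i. the (C (s i))))"
    "limitin (graph_topology P C) s x sequentially"
    using D x unfolding bi_core_def by blast
  have sD: "s i \<in> dom C" for i using s(1) D unfolding bi_core_def by blast
  have small: "\<forall>\<^sub>F i in sequentially. p (s i - x) + p (the (C (s i)) - the (C x)) < e" if p: "p \<in> P" and e: "e > 0" for p e
  proof -
    let ?U = "{y \<in> dom C. p (y - x) + p (the (C (y - x))) < e}"
    have "openin (graph_topology P C) ?U"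
      unfolding graph_topology_def
      by (rule openin_seminorm_topology_ball[where p = "\<lambda>x. p x + p (the (C x))"]) (use p x e in auto)
    moreover have "x \<in> ?U"
      using x e by (simp add: seminorm_0[OF P_seminorm[OF p]] linop_the_0[OF C])
    ultimately have "\<forall>\<^sub>F i in sequentially. s i \<in> ?U" using s(4) unfolding limitin_def by blast
    then show ?thesis by eventually_elim (simp add: linop_diff[OF C sD x])
  qed
  have "limitin \<tau> s x sequentially"
    unfolding limitin_tau
  proof (intro ballI tendstoI)
    fix p and e :: real assume p: "p \<in> P" and e: "e > 0"
    note nn = seminorm_nonneg[OF P_seminorm[OF p]]
    show "\<forall>\<^sub>F i in sequentially. dist (p (s i - x)) 0 < e"
      using small[OF p e]
    proof eventually_elim
      case (elim i)
      then show ?case using nn[of "s i - x"] nn[of "the (C (s i)) - the (C x)"] by simp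
    qed
  qed
  moreover have "limitin \<tau> (\<lambda>i. the (C (s i))) (the (C x)) sequentially"
    unfolding limitin_tau
  proof (intro ballI tendstoI)
    fix p and e :: real assume p: "p \<in> P" and e: "e > 0"
    note nn = seminorm_nonneg[OF P_seminorm[OF p]]
    show "\<forall>\<^sub>F i in sequentially. dist (p (the (C (s i)) - the (C x))) 0 < e"
      using small[OF p e]
    proof eventually_elim
      case (elim i)
      then show ?case using nn[of "s i - x"] nn[of "the (C (s i)) - the (C x)"] by simp
    qed
  qed
  ultimately show thesis using that[OF s(1)] s(2,3) gamma_seq_iff by blast
qed

text \<open>Core sequences and their images converge in every seminorm in G, so the whole of
  \<open>G\<close> is chosen as the system generating \<gamma>.\<close>

lemma bi_core_imp_gamma_core:
  assumes C: "linear_operator scal C" and D: "bi_core scal P C D"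
  shows "gamma_core scal \<gamma> C D"
  unfolding gamma_core_def
proof (intro conjI exI)
  show "module.subspace scal D" "D \<subseteq> dom C" using D by (auto simp: bi_core_def)
  show "generates scal G \<gamma>" by (rule generates_G)
  have top: "topspace (graph_topology G C) = dom C"
    by (simp add: graph_topology_def topspace_seminorm_topology)
  have "x \<in> graph_topology G C closure_of D" if x: "x \<in> dom C" for x
    unfolding in_closure_of top
  proof (intro conjI allI impI x)
    fix U assume U: "x \<in> U \<and> openin (graph_topology G C) U"
    then have Uo: "openin (graph_topology G C) U" and xU: "x \<in> U" by auto
    have "\<forall>q\<in>G. is_seminorm scal q" using G_seminorm by blast
    note openU = openin_graph_topology[OF C this]
    obtain F r where F: "finite F" "F \<subseteq> (\<lambda>p x. p x + p (the (C x))) ` G" and r: "r > 0"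
      and FU: "\<forall>y\<in>dom C. (\<forall>q\<in>F. q (y - x) < r) \<longrightarrow> y \<in> U"
      using bspec[OF conjunct2[OF iffD1[OF openU Uo]] xU] by (elim exE conjE) (rule that)
    obtain s where s: "range s \<subseteq> D" "limitin \<gamma> s x sequentially" "limitin \<gamma> (\<lambda>i. the (C (s i))) (the (C x)) sequentially"
      by (rule bi_core_sequence[OF C D x])
    have sD: "s i \<in> dom C" for i using s(1) D unfolding bi_core_def by blast
    have "\<forall>\<^sub>F i in sequentially. \<forall>q\<in>F. q (s i - x) < r"
    proof (rule eventually_ball_finite[OF F(1)], rule ballI)
      fix q assume "q \<in> F"
      then obtain p where p: "p \<in> G" "q = (\<lambda>x. p x + p (the (C x)))" using F(2) by auto
      have "(\<lambda>i. p (s i - x) + p (the (C (s i)) - the (C x))) \<longlonglongrightarrow> 0 + 0"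
        using s p by (intro tendsto_add) (auto simp: limitin_gamma)
      then have "\<forall>\<^sub>F i in sequentially. p (s i - x) + p (the (C (s i)) - the (C x)) < r"
        using r by (intro order_tendstoD(2)) auto
      then show "\<forall>\<^sub>F i in sequentially. q (s i - x) < r"
        by eventually_elim (simp add: p linop_diff[OF C sD x])
    qed
    then obtain i where "\<forall>q\<in>F. q (s i - x) < r" by (auto simp: eventually_sequentially)
    then have "s i \<in> U" using FU sD[of i] by simp
    then show "\<exists>y. y \<in> D \<and> y \<in> U" using s(1) by blast
  qed
  then show "dense_in_topology (graph_topology G C) D"
    unfolding dense_in_topology_def top
    using closure_of_subset_topspace[of "graph_topology G C" D] top by blast
qed

text \<open>The generating system in a \<gamma>-core is some unspecified H. A q-ball around 0
  contains a finite intersection of H-balls, which transfers the approximation from H to any q in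
  G.\<close>

lemma gamma_core_approx:
  assumes C: "linear_operator scal C" and D: "gamma_core scal \<gamma> C D" and x: "x \<in> dom C"
    and q: "q \<in> G" and e: "e > 0"
  obtains d where "d \<in> D" "q (d - x) < e" "q (the (C d) - the (C x)) < e"
proof -
  obtain H where H: "generates scal H \<gamma>" "dense_in_topology (graph_topology H C) D"
    using D unfolding gamma_core_def by blast
  have Hs: "\<And>h. h \<in> H \<Longrightarrow> is_seminorm scal h" and \<gamma>: "\<gamma> = seminorm_topology UNIV H"
    using H(1) by (auto simp: generates_def)
  have open_iff: "openin \<gamma> U \<longleftrightarrow> (\<forall>x\<in>U. \<exists>F. finite F \<and> F \<subseteq> H \<and> (\<exists>r>0. \<forall>y. (\<forall>q\<in>F. q (y - x) < r) \<longrightarrow> y \<in> U))" for U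
    unfolding \<gamma> by (subst openin_seminorm_topology) (auto intro: seminorm_add seminorm_0 Hs)
  have q0: "0 \<in> {y. q (y - 0) < e}" using e by (simp add: seminorm_0[OF G_seminorm[OF q]])
  from open_iff[THEN iffD1, OF openin_gamma_ball[OF q, of 0 e], rule_format, OF q0]
  obtain F r where F: "finite F" "F \<subseteq> H" "r > 0" "\<And>y. (\<forall>h\<in>F. h y < r) \<Longrightarrow> q y < e" by auto
  let ?X = "graph_topology H C"
  have top: "topspace ?X = dom C" by (simp add: graph_topology_def topspace_seminorm_topology)
  let ?W = "(\<Inter>h\<in>F. {y \<in> dom C. h (y - x) + h (the (C (y - x))) < r}) \<inter> topspace ?X"
  have W: "openin ?X ?W"
  proof (rule openin_INT[OF F(1)])
    fix h assume "h \<in> F"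
    then have "(\<lambda>x. h x + h (the (C x))) \<in> (\<lambda>p x. p x + p (the (C x))) ` H" using F(2) by auto
    from openin_seminorm_topology_ball[OF this x F(3)]
    show "openin ?X {y \<in> dom C. h (y - x) + h (the (C (y - x))) < r}"
      unfolding graph_topology_def .
  qed
  have xW: "x \<in> ?W"
    unfolding top using x F(2,3) by (auto simp: linop_the_0[OF C] seminorm_0[OF Hs])
  have cl: "x \<in> ?X closure_of D" using H(2) x top by (simp add: dense_in_topology_def)
  obtain d where d: "d \<in> D" "d \<in> ?W"
    using conjunct2[OF cl[unfolded in_closure_of], rule_format, OF conjI[OF xW W]] by auto
  have dC: "d \<in> dom C" using d(2) top by simp
  have h: "h (d - x) < r \<and> h (the (C d) - the (C x)) < r" if "h \<in> F" for h
  proof -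
    have "h (d - x) + h (the (C d) - the (C x)) < r" using d(2) that by (auto simp: linop_diff[OF C dC x])
    moreover have "h (d - x) \<ge> 0" "h (the (C d) - the (C x)) \<ge> 0"
      using that F(2) by (auto intro: seminorm_nonneg Hs)
    ultimately show ?thesis by linarith
  qed
  show thesis by (rule that[OF d(1)]) (use h F(4) in blast)+
qed

lemma eq_if_seminorm_diff_small:
  assumes "\<And>q e. q \<in> G \<Longrightarrow> e > 0 \<Longrightarrow> q (x - y) < e"
  shows "x = y"
proof -
  have "q (x - y) = 0" if q: "q \<in> G" for q
  proof (rule ccontr)
    assume "q (x - y) \<noteq> 0"
    then have "q (x - y) > 0" using seminorm_nonneg[OF G_seminorm[OF q], of "x - y"] by simp
    then show False using assms[OF q] by blast
  qed
  then show ?thesis using G_separates[of "x - y"] by simp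
qed

section \<open>Convergence of resolvents and of semigroups\<close>

context
  fixes S :: "nat \<Rightarrow> real \<Rightarrow> 'a \<Rightarrow> 'a" and A :: "nat \<Rightarrow> ('a \<rightharpoonup> 'a)" and M \<omega> l :: real
  assumes S: "\<And>n. locally_bi_continuous_semigroup scal \<tau> (S n)"
    and A: "\<And>n. A n = bi_generator \<tau> (S n)"
    and eq: "uniformly_locally_bi_equicontinuous \<tau> S"
    and M: "M \<ge> 1"
    and on: "\<And>n t. t \<ge> 0 \<Longrightarrow> onorm (S n t) \<le> M * exp (\<omega> * t)"
    and l: "l > \<omega>"
begin

abbreviation (input) "Lap n \<equiv> lap (rescaled \<omega> (S n)) (l - \<omega>)"

lemma M_nonneg: "M \<ge> 0"
  using M by simp

lemma shift_pos: "l - \<omega> > 0"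
  using l by simp

lemma family_semigroup: "bounded_semigroup M (rescaled \<omega> (S n))"
  by (rule rescaled_bounded_semigroup[OF S on M_nonneg])

lemma family_equicont: "q \<in> G \<Longrightarrow> \<exists>q'\<in>G. \<forall>n. \<forall>t\<in>{0..b}. \<forall>x. q (rescaled \<omega> (S n) t x) \<le> q' x"
  using eq by (intro family_equicontinuous[OF S on _ _ M_nonneg])
    (auto simp: uniformly_locally_bi_equicontinuous_def)

lemma L_equicont: "equicont (\<lambda>n. Lap n)"
  by (rule laps_equicont[OF family_semigroup M family_equicont shift_pos])

lemma A_resolvent: "of_real l \<in> resolvent_set scal (A n)" "resolvent scal (of_real l) (A n) = Lap n"
  unfolding A
   apply (rule generator_resolvent(1)[OF S on M_nonneg l], assumption)
  apply (rule generator_resolvent(2)[OF S on M_nonneg l], assumption)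
  done

lemma A_lap: "y \<in> dom (A n) \<Longrightarrow> Lap n (l *\<^sub>R y - the (A n y)) = y"
  unfolding A using generator_lap_inverse[OF S on M_nonneg l, of n y] by auto

lemma L_norm: "norm (Lap n x) \<le> M / (l - \<omega>) * norm x"
  by (rule lap_norm[OF family_semigroup M_nonneg shift_pos])

text \<open>The common way from (b), (c) and (d) to (e): each provides a \<gamma>-limit of the
  resolvents with dense range. The factor \<open>exp (\<omega> * t)\<close> that undoes the
  rescaling is bounded on compact sets of times.\<close>

lemma assertion_eI:
  assumes R: "\<And>x. limitin \<gamma> (\<lambda>n. Lap n x) (R x) sequentially" and dense: "dense_in_topology \<gamma> (range R)"
  shows "\<exists>S\<^sub>0. assertion_e scal \<tau> S M \<omega> S\<^sub>0"
proof -
  note fam = family_semigroup M family_equicont shift_pos R dense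
  let ?T = "Tlim (\<lambda>n. rescaled \<omega> (S n))"
  have sg: "bounded_semigroup M ?T" by (rule Tlim_bounded_semigroup[OF fam])
  have "assertion_e scal \<tau> S M \<omega> (\<lambda>t x. exp (\<omega> * t) *\<^sub>R ?T t x)"
    unfolding assertion_e_def
  proof (intro conjI allI impI)
    show "locally_bi_continuous_semigroup scal \<tau> (\<lambda>t x. exp (\<omega> * t) *\<^sub>R ?T t x)"
      by (rule bi_continuousI(1)[OF sg M_nonneg])
    show "onorm (\<lambda>x. exp (\<omega> * t) *\<^sub>R ?T t x) \<le> M * exp (\<omega> * t)" if "t \<ge> 0" for t
      by (rule bi_continuousI(2)[OF sg M_nonneg that])
    fix x U and N :: "real set" assume N: "compact N \<and> N \<subseteq> {0..}" and U: "openin \<tau> U \<and> 0 \<in> U"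
    obtain p r where p: "p \<in> P" "r > 0" "\<And>y. p y < r \<Longrightarrow> y \<in> U" using tau_nhd_0 U by metis
    note sn = P_seminorm[OF p(1)]
    have "bounded N" using N by (simp add: compact_imp_bounded)
    then obtain b where b: "\<And>t. t \<in> N \<Longrightarrow> \<bar>t\<bar> \<le> b" unfolding bounded_iff real_norm_def by blast
    define E where "E = exp (\<bar>\<omega>\<bar> * \<bar>b\<bar>)"
    have E: "E > 0" by (simp add: E_def)
    have "r / (2 * E) > 0" using p(2) E by simp
    from Tlim_uniform[OF fam abs_ge_zero P_subset_G[OF p(1)] this, of b x]
    obtain n0 where "\<forall>n\<ge>n0. \<forall>t\<in>{0..\<bar>b\<bar>}. p (rescaled \<omega> (S n) t x - ?T t x) \<le> r / (2 * E)" by (rule exE)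
    then have n0: "p (rescaled \<omega> (S n) t x - ?T t x) \<le> r / (2 * E)" if "n \<ge> n0" "0 \<le> t" "t \<le> \<bar>b\<bar>" for n t
      using that by simp
    have "S n t x - exp (\<omega> * t) *\<^sub>R ?T t x \<in> U" if n: "n \<ge> n0" and t: "t \<in> N" for n t
    proof (rule p(3))
      have t': "0 \<le> t" "t \<le> \<bar>b\<bar>" using t N b[OF t] by auto
      have "p (S n t x - exp (\<omega> * t) *\<^sub>R ?T t x) = exp (\<omega> * t) * p (rescaled \<omega> (S n) t x - ?T t x)"
        unfolding rescaled_inverse[of "S n" t x \<omega>] by (simp add: seminorm_scaleR[OF sn] scaleR_diff_right[symmetric])
      also have "\<dots> \<le> E * (r / (2 * E))"
        unfolding E_def
        using exp_minus_mult_le[OF t', of "- \<omega>"] n0[OF n t'] seminorm_nonneg[OF sn] by (intro mult_mono) (auto simp: E_def)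
      also have "\<dots> < r" using E p(2) by simp
      finally show "p (S n t x - exp (\<omega> * t) *\<^sub>R ?T t x) < r" .
    qed
    then show "\<forall>\<^sub>F n in sequentially. \<forall>t\<in>N. S n t x - exp (\<omega> * t) *\<^sub>R ?T t x \<in> U"
      unfolding eventually_sequentially by blast
  qed
  then show ?thesis by blast
qed

context
  fixes S\<^sub>0
  assumes e: "assertion_e scal \<tau> S M \<omega> S\<^sub>0"
begin

abbreviation (input) "L0 \<equiv> lap (rescaled \<omega> S\<^sub>0) (l - \<omega>)"

lemma S0: "locally_bi_continuous_semigroup scal \<tau> S\<^sub>0" "t \<ge> 0 \<Longrightarrow> onorm (S\<^sub>0 t) \<le> M * exp (\<omega> * t)"
  using e by (simp_all add: assertion_e_def)

lemma S0_sg: "bounded_semigroup M (rescaled \<omega> S\<^sub>0)"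
  by (rule rescaled_bounded_semigroup[OF S0 M_nonneg])

lemma L_limit: "limitin \<gamma> (\<lambda>n. Lap n x) (L0 x) sequentially"
proof (rule lap_converges[OF family_semigroup M family_equicont S0_sg shift_pos])
  fix p and b d :: real assume p: "p \<in> P" and b: "b \<ge> 0" and d: "d > 0"
  note sn = P_seminorm[OF p]
  define E where "E = exp (\<bar>\<omega>\<bar> * b)"
  have E: "E > 0" by (simp add: E_def)
  have "d / E > 0" using d E by simp
  then have "0 \<in> {y. p (y - 0) < d / E}" by (simp add: seminorm_0[OF sn])
  moreover have "compact {0..b} \<and> {0..b} \<subseteq> {0..}" by auto
  ultimately have "\<forall>\<^sub>F n in sequentially. \<forall>t\<in>{0..b}. S n t x - S\<^sub>0 t x \<in> {y. p (y - 0) < d / E}"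
    using e openin_tau_ball[OF p, of 0 "d / E"] unfolding assertion_e_def by blast
  then obtain N where "\<forall>n\<ge>N. \<forall>t\<in>{0..b}. S n t x - S\<^sub>0 t x \<in> {y. p (y - 0) < d / E}"
    unfolding eventually_sequentially by (rule exE)
  then have N: "p (S n t x - S\<^sub>0 t x) < d / E" if "n \<ge> N" "t \<in> {0..b}" for n t
    using that by simp
  have "p (rescaled \<omega> (S n) t x - rescaled \<omega> S\<^sub>0 t x) \<le> d" if n: "n \<ge> N" and t: "t \<in> {0..b}" for n t
  proof -
    have "p (rescaled \<omega> (S n) t x - rescaled \<omega> S\<^sub>0 t x) = exp (- \<omega> * t) * p (S n t x - S\<^sub>0 t x)"
      unfolding rescaled_def scaleR_diff_right[symmetric] by (simp add: seminorm_scaleR[OF sn])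
    also have "\<dots> \<le> E * (d / E)"
      unfolding E_def using t exp_minus_mult_le[of t b \<omega>] N[OF n t] seminorm_nonneg[OF sn]
      by (intro mult_mono) (auto simp: E_def)
    finally show ?thesis using E by simp
  qed
  then show "\<exists>N. \<forall>n\<ge>N. \<forall>t\<in>{0..b}. p (rescaled \<omega> (S n) t x - rescaled \<omega> S\<^sub>0 t x) \<le> d" by blast
qed

lemma L0_gcont: "gcont L0"
  by (rule lap_gcont[OF S0_sg M_nonneg shift_pos])

lemma assertion_c_lap: "assertion_c scal \<tau> A l L0"
  unfolding assertion_c_def A_resolvent(2)
proof (intro conjI allI A_resolvent(1))
  show "bounded_operator scal L0"
    unfolding bounded_operator_def
    using lap_linear[OF S0_sg M_nonneg shift_pos] lin_bounded_linear lap_norm[OF S0_sg M_nonneg shift_pos] by blast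
  show "limitin \<tau> (\<lambda>n. Lap n x) (L0 x) sequentially" for x by (rule gamma_imp_tau[OF L_limit])
  show "inj L0" by (rule lap_inj[OF S0 M_nonneg l])
  show "bi_dense \<tau> (range L0)" by (rule lap_bi_dense[OF S0 M_nonneg l])
qed

lemma assertion_d_lap: "assertion_d scal \<gamma> A l L0"
  unfolding assertion_d_def A_resolvent(2)
proof (intro conjI allI A_resolvent(1))
  show "continuous_operator scal \<gamma> L0" by (rule gcont_continuous[OF L0_gcont])
  show "limitin \<gamma> (\<lambda>n. Lap n x) (L0 x) sequentially" for x by (rule L_limit)
  show "inj L0" by (rule lap_inj[OF S0 M_nonneg l])
  show "dense_in_topology \<gamma> (range L0)"
    by (rule bi_dense_imp_dense[OF lap_bi_dense[OF S0 M_nonneg l]])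
qed

abbreviation (input) "B \<equiv> bi_generator \<tau> S\<^sub>0"

lemma B_iff: "B y = Some z \<longleftrightarrow> L0 (l *\<^sub>R y - z) = y"
  by (rule generator_iff[OF S0 M_nonneg l])

text \<open>Read off the description of the graph by the linear map \<open>L0\<close>, without going
  back to difference quotients.\<close>

lemma B_linear_operator: "linear_operator scal B"
proof -
  note lin = lap_linear[OF S0_sg M_nonneg shift_pos]
  have add: "B (x + y) = Some (u + v)" if "B x = Some u" "B y = Some v" for x y u v
  proof -
    have eq: "l *\<^sub>R (x + y) - (u + v) = (l *\<^sub>R x - u) + (l *\<^sub>R y - v)" by (simp add: algebra_simps)
    show ?thesis using that unfolding B_iff eq lin_add[OF lin] by simp
  qed
  have sc: "B (scal c x) = Some (scal c u)" if "B x = Some u" for c x u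
  proof -
    have eq: "l *\<^sub>R scal c x - scal c u = scal c (l *\<^sub>R x - u)"
      by (simp add: scal_of_real[symmetric] scale_right_diff_distrib scale_left_commute)
    show ?thesis using that unfolding B_iff eq lin_scal[OF lin] by simp
  qed
  have zero: "B 0 = Some 0" unfolding B_iff by (simp add: lin_0[OF lin])
  show ?thesis
    unfolding linear_operator_def
  proof (intro conjI ballI allI)
    show "subspace (dom B)"
    proof (rule subspaceI)
      show "0 \<in> dom B" using zero by blast
      show "x + y \<in> dom B" if "x \<in> dom B" "y \<in> dom B" for x y using that add by blast
      show "scal c x \<in> dom B" if "x \<in> dom B" for c x using that sc by blast
    qed
    show "the (B (x + y)) = the (B x) + the (B y)" if xy: "x \<in> dom B" "y \<in> dom B" for x y
    proof -
      obtain u v where "B x = Some u" "B y = Some v" using xy by blast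
      then show ?thesis using add by simp
    qed
    show "the (B (scal c x)) = scal c (the (B x))" if x: "x \<in> dom B" for c x
    proof -
      obtain u where "B x = Some u" using x by blast
      then show ?thesis using sc by simp
    qed
  qed
qed

text \<open>The graph is the zero set of the \<gamma>-continuous map that sends (x, y) to
  \<open>L0 (l *\<^sub>R x - y) - x\<close>.\<close>

lemma B_gamma_closed: "gamma_closed \<gamma> B"
  unfolding gamma_closed_iff
proof (intro allI impI)
  note lin = lap_linear[OF S0_sg M_nonneg shift_pos]
  fix x y
  assume *: "\<forall>q\<in>G. \<forall>e>0. \<exists>a\<in>dom B. q (a - x) < e \<and> q (the (B a) - y) < e"
  have "L0 (l *\<^sub>R x - y) = x"
  proof (rule eq_if_seminorm_diff_small)
    fix q and d :: real assume q: "q \<in> G" and d: "d > 0"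
    note sn = G_seminorm[OF q]
    obtain q' where q': "q' \<in> G" "\<And>x. q (L0 x) \<le> q' x" using gcontD[OF L0_gcont q] by blast
    note sn' = G_seminorm[OF q'(1)]
    \<comment> \<open>The error consists of \<open>q (a - x)\<close>, of |l| times
      \<open>q' (a - x)\<close> and of \<open>q' (the (B a) - y)\<close>, hence |l| + 2
      shares.\<close>
    define d' where "d' = d / (\<bar>l\<bar> + 2)"
    have "\<bar>l\<bar> + 2 > 0" by simp
    then have d': "d' > 0" "(\<bar>l\<bar> + 2) * d' = d" using d by (simp_all add: d'_def)
    obtain a where a: "a \<in> dom B" "q (a - x) + q' (a - x) < d'" "q (the (B a) - y) + q' (the (B a) - y) < d'"
      using *[rule_format, OF G_add[OF q q'(1)] d'(1)] by blast
    have a1: "q (a - x) < d'" "q' (a - x) < d'" "q' (the (B a) - y) < d'"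
      using a seminorm_nonneg[OF sn, of "a - x"] seminorm_nonneg[OF sn', of "a - x"]
        seminorm_nonneg[OF sn, of "the (B a) - y"] by linarith+
    obtain z where z: "B a = Some z" using a(1) by blast
    then have "L0 (l *\<^sub>R a - the (B a)) = a" using B_iff[THEN iffD1, OF z] by simp
    then have "L0 (l *\<^sub>R x - y) - x = (a - x) - L0 (l *\<^sub>R (a - x) - (the (B a) - y))"
      unfolding lin_diff[OF lin] lin_scaleR[OF lin] by (simp add: algebra_simps)
    then have "q (L0 (l *\<^sub>R x - y) - x) \<le> q (a - x) + q (L0 (l *\<^sub>R (a - x) - (the (B a) - y)))"
      using seminorm_diff[OF sn, of "a - x" "L0 (l *\<^sub>R (a - x) - (the (B a) - y))"] by metis
    also have "q (L0 (l *\<^sub>R (a - x) - (the (B a) - y))) \<le> q' (l *\<^sub>R (a - x) - (the (B a) - y))" by (rule q'(2))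
    also have "\<dots> \<le> \<bar>l\<bar> * q' (a - x) + q' (the (B a) - y)"
      using seminorm_diff[OF sn', of "l *\<^sub>R (a - x)" "the (B a) - y"] by (simp add: seminorm_scaleR[OF sn'])
    also have "\<bar>l\<bar> * q' (a - x) \<le> \<bar>l\<bar> * d'" using a1 by (intro mult_left_mono) auto
    finally show "q (L0 (l *\<^sub>R x - y) - x) < d" using a1 d'(2) by (simp add: algebra_simps)
  qed
  then show "B x = Some y" unfolding B_iff .
qed

lemma B_bi_closed: "bi_closed \<tau> B"
  unfolding bi_closed_def
proof (intro allI impI)
  fix s x y
  assume *: "range s \<subseteq> dom B \<and> bounded (range s) \<and> bounded (range (\<lambda>i. the (B (s i)))) \<and>
       limitin \<tau> s x sequentially \<and> limitin \<tau> (\<lambda>i. the (B (s i))) y sequentially"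
  have s: "limitin \<gamma> s x sequentially" "limitin \<gamma> (\<lambda>i. the (B (s i))) y sequentially"
    using * gamma_seq_iff by blast+
  have "L0 (l *\<^sub>R s i - the (B (s i))) = s i" for i
  proof -
    obtain z where z: "B (s i) = Some z" using * by blast
    then show ?thesis using B_iff[THEN iffD1, OF z] by simp
  qed
  moreover have "limitin \<gamma> (\<lambda>i. L0 (l *\<^sub>R s i - the (B (s i)))) (L0 (l *\<^sub>R x - y)) sequentially"
    by (intro gcont_limit[OF L0_gcont] gamma_limit_diff gamma_limit_scaleR s)
  ultimately have "limitin \<gamma> s (L0 (l *\<^sub>R x - y)) sequentially" by simp
  then have "L0 (l *\<^sub>R x - y) = x" using gamma_limit_unique s(1) sequentially_bot by blast
  then have "B x = Some y" by (simp add: B_iff)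
  then show "x \<in> dom B \<and> the (B x) = y" by auto
qed

end

section \<open>Consequences of (a) and (b), and the closures\<close>

text \<open>For x in the core, \<open>Lap n\<close> maps l x - \<open>A\<^sub>0\<close> x to x plus
  the image of the difference of \<open>the (A n x)\<close> and \<open>the (A\<^sub>0 x)\<close>,
  which tends to 0 by equicontinuity. Such vectors are dense, so the resolvents converge everywhere;
  the relation for R extends from the core to the domain by continuity.\<close>

lemma assertion_b_limit:
  assumes b: "assertion_b scal \<gamma> A l A\<^sub>0 D"
  obtains R where "\<And>x. limitin \<gamma> (\<lambda>n. Lap n x) (R x) sequentially" "dense_in_topology \<gamma> (range R)"
    "\<And>x. x \<in> dom A\<^sub>0 \<Longrightarrow> R (l *\<^sub>R x - the (A\<^sub>0 x)) = x"
proof -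
  have C: "linear_operator scal A\<^sub>0" and dense: "dense_in_topology \<gamma> (dom A\<^sub>0)"
    and core: "gamma_core scal \<gamma> A\<^sub>0 D" and D: "D \<subseteq> (\<Union>k. \<Inter>n\<in>{k..}. dom (A n))"
    and conv: "\<And>x. x \<in> D \<Longrightarrow> limitin \<gamma> (\<lambda>n. the (A n x)) (the (A\<^sub>0 x)) sequentially"
    and ran: "dense_in_topology \<gamma> (shifted scal (of_real l) A\<^sub>0 ` dom A\<^sub>0)"
    using b by (simp_all add: assertion_b_def)
  have DA: "D \<subseteq> dom A\<^sub>0" using core by (simp add: gamma_core_def)
  note lin = equicont_linear[OF L_equicont]
  let ?s = "\<lambda>x. l *\<^sub>R x - the (A\<^sub>0 x)"
  have onD: "limitin \<gamma> (\<lambda>n. Lap n (?s x)) x sequentially" if x: "x \<in> D" for x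
  proof -
    \<comment> \<open>\<open>the (A n x)\<close> is meaningful from some k on; the limit concerns
      large n only.\<close>
    obtain k where "x \<in> (\<Inter>n\<in>{k..}. dom (A n))" using subsetD[OF D x] by (rule UN_E)
    then have k: "x \<in> dom (A n)" if "n \<ge> k" for n using that by (rule INT_D[OF _ atLeast_iff[THEN iffD2]])
    have "limitin \<gamma> (\<lambda>n. the (A n x) - the (A\<^sub>0 x)) (the (A\<^sub>0 x) - the (A\<^sub>0 x)) sequentially"
      by (intro gamma_limit_diff conv x gamma_limit_const)
    then have 1: "limitin \<gamma> (\<lambda>n. the (A n x) - the (A\<^sub>0 x)) 0 sequentially" by simp
    have "limitin \<gamma> (\<lambda>n. Lap n (the (A n x) - the (A\<^sub>0 x))) 0 sequentially"
      by (rule equicont_limit[OF L_equicont 1]) (simp add: lin_0[OF lin] topspace_gamma)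
    from gamma_limit_add[OF this gamma_limit_const[of x]]
    have lim: "limitin \<gamma> (\<lambda>n. Lap n (the (A n x) - the (A\<^sub>0 x)) + x) x sequentially" by simp
    have "Lap n (the (A n x) - the (A\<^sub>0 x)) + x = Lap n (?s x)" if n: "n \<ge> k" for n
    proof -
      have "Lap n (the (A n x) - the (A\<^sub>0 x)) + Lap n (l *\<^sub>R x - the (A n x)) = Lap n (?s x)"
        unfolding lin_add[OF lin, symmetric] by simp
      then show ?thesis using A_lap[OF k[OF n]] by simp
    qed
    then have "\<forall>\<^sub>F n in sequentially. Lap n (the (A n x) - the (A\<^sub>0 x)) + x = Lap n (?s x)"
      unfolding eventually_sequentially by blast
    then show ?thesis using lim by (rule limitin_transform_eventually)
  qed
  have dense_D: "\<exists>d\<in>D. q (?s d - y) < e" if q: "q \<in> G" and e: "e > 0" for q y e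
  proof -
    note sn = G_seminorm[OF q]
    obtain x where x: "x \<in> dom A\<^sub>0" "q (?s x - y) < e/2"
      using ran[unfolded dense_gamma_iff, rule_format, OF q half_gt_zero[OF e], of y]
      by (auto simp: shifted_def scal_of_real)
    define e' where "e' = e / (2 * (\<bar>l\<bar> + 1))"
    have "\<bar>l\<bar> + 1 > 0" by simp
    then have e': "e' > 0" "(\<bar>l\<bar> + 1) * e' = e/2" using e by (simp_all add: e'_def field_simps)
    obtain d where d: "d \<in> D" "q (d - x) < e'" "q (the (A\<^sub>0 d) - the (A\<^sub>0 x)) < e'"
      by (rule gamma_core_approx[OF C core x(1) q e'(1)])
    have "q (?s d - ?s x) = q (l *\<^sub>R (d - x) - (the (A\<^sub>0 d) - the (A\<^sub>0 x)))" by (simp add: algebra_simps)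
    also have "\<dots> \<le> \<bar>l\<bar> * q (d - x) + q (the (A\<^sub>0 d) - the (A\<^sub>0 x))"
      using seminorm_diff[OF sn, of "l *\<^sub>R (d - x)"] by (simp add: seminorm_scaleR[OF sn])
    also have "\<bar>l\<bar> * q (d - x) \<le> \<bar>l\<bar> * e'" using d by (intro mult_left_mono) auto
    finally have "q (?s d - ?s x) < e/2" using d(3) e'(2) by (simp add: algebra_simps)
    then have "q (?s d - y) < e" using x(2) seminorm_add[OF sn, of "?s d - ?s x" "?s x - y"] by simp
    then show ?thesis using d(1) by blast
  qed
  have "gCauchy (\<lambda>n. Lap n y)" for y
  proof (rule gCauchy_approx)
    fix q and e :: real assume q: "q \<in> G" and e: "e > 0"
    obtain q' where q': "q' \<in> G" "\<And>n x. q (Lap n x) \<le> q' x" using equicontD[OF L_equicont q] by blast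
    obtain d where d: "d \<in> D" "q' (?s d - y) < e" using dense_D[OF q'(1) e] by blast
    have "q (Lap n y - Lap n (?s d)) \<le> e" for n
      using q'(2)[of n "y - ?s d"] d(2) seminorm_minus_commute[OF G_seminorm[OF q'(1)], of y "?s d"]
      by (simp add: lin_diff[OF lin])
    then show "\<exists>s' N. gCauchy s' \<and> (\<forall>n\<ge>N. q (Lap n y - s' n) \<le> e)"
      using convergent_gCauchy[OF onD[OF d(1)]] by blast
  qed
  then have "\<exists>l. limitin \<gamma> (\<lambda>n. Lap n y) l sequentially" for y using gCauchy_convergent by blast
  then obtain R where R: "\<And>y. limitin \<gamma> (\<lambda>n. Lap n y) (R y) sequentially" by metis
  have gR: "gcont R" by (rule limit_gcont[OF L_equicont R])
  note linR = gcont_linear[OF gR]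
  have RD: "R (?s d) = d" if "d \<in> D" for d
    by (rule gamma_limit_unique[OF R onD[OF that] sequentially_bot])
  have "dense_in_topology \<gamma> (range R)"
    unfolding dense_gamma_iff
  proof (intro allI ballI impI)
    fix x q and e :: real assume q: "q \<in> G" and e: "e > 0"
    obtain z where z: "z \<in> dom A\<^sub>0" "q (z - x) < e/2"
      using dense[unfolded dense_gamma_iff, rule_format, OF q half_gt_zero[OF e], of x] by blast
    obtain d where d: "d \<in> D" "q (d - z) < e/2"
      by (rule gamma_core_approx[OF C core z(1) q half_gt_zero[OF e]])
    have "q (d - x) < e" using z(2) d(2) seminorm_add[OF G_seminorm[OF q], of "d - z" "z - x"] by simp
    then show "\<exists>y\<in>range R. q (y - x) < e" using RD[OF d(1)] by (metis rangeI)
  qed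
  moreover have "R (?s x) = x" if x: "x \<in> dom A\<^sub>0" for x
  proof (rule eq_if_seminorm_diff_small)
    fix q and e :: real assume q: "q \<in> G" and e: "e > 0"
    note sn = G_seminorm[OF q]
    obtain q' where q': "q' \<in> G" "\<And>x. q (R x) \<le> q' x" using gcontD[OF gR q] by blast
    note sn' = G_seminorm[OF q'(1)]
    define e' where "e' = e / (\<bar>l\<bar> + 2)"
    have "\<bar>l\<bar> + 2 > 0" by simp
    then have e': "e' > 0" "(\<bar>l\<bar> + 2) * e' = e" using e by (simp_all add: e'_def)
    obtain d where d: "d \<in> D" "q (d - x) + q' (d - x) < e'"
        "q (the (A\<^sub>0 d) - the (A\<^sub>0 x)) + q' (the (A\<^sub>0 d) - the (A\<^sub>0 x)) < e'"
      by (rule gamma_core_approx[OF C core x G_add[OF q q'(1)] e'(1)])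
    let ?u = "d - x" and ?v = "the (A\<^sub>0 d) - the (A\<^sub>0 x)"
    have d1: "q ?u < e'" "q' ?u < e'" "q' ?v < e'"
      using d seminorm_nonneg[OF sn, of ?u] seminorm_nonneg[OF sn', of ?u] seminorm_nonneg[OF sn, of ?v] by linarith+
    have Rs: "R (?s x) = d - R (l *\<^sub>R ?u - ?v)"
      using RD[OF d(1)] unfolding lin_diff[OF linR] lin_scaleR[OF linR] by (simp add: algebra_simps)
    have "q (R (?s x) - x) = q (?u - R (l *\<^sub>R ?u - ?v))"
      unfolding Rs by (rule arg_cong[where f = q]) (simp only: diff_diff_eq add.commute)
    also have "\<dots> \<le> q ?u + q (R (l *\<^sub>R ?u - ?v))" by (rule seminorm_diff[OF sn])
    also have "q (R (l *\<^sub>R ?u - ?v)) \<le> q' (l *\<^sub>R ?u - ?v)" by (rule q'(2))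
    also have "\<dots> \<le> \<bar>l\<bar> * q' ?u + q' ?v"
      using seminorm_diff[OF sn', of "l *\<^sub>R ?u" ?v] by (simp add: seminorm_scaleR[OF sn'])
    also have "\<bar>l\<bar> * q' ?u \<le> \<bar>l\<bar> * e'" using d1 by (intro mult_left_mono) auto
    finally show "q (R (?s x) - x) < e" using d1 e'(2) by (simp add: algebra_simps)
  qed
  ultimately show thesis using that R by blast
qed

lemma assertion_a_imp_b:
  assumes a: "assertion_a scal \<tau> P A l A\<^sub>0 D"
  shows "assertion_b scal \<gamma> A l A\<^sub>0 D"
  unfolding assertion_b_def
proof (intro conjI ballI)
  show C: "linear_operator scal A\<^sub>0" and D: "D \<subseteq> (\<Union>k. \<Inter>n\<in>{k..}. dom (A n))"
    using a by (simp_all add: assertion_a_def)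
  show "dense_in_topology \<gamma> (dom A\<^sub>0)" "dense_in_topology \<gamma> (shifted scal (of_real l) A\<^sub>0 ` dom A\<^sub>0)"
    using a by (auto simp: assertion_a_def intro: bi_dense_imp_dense)
  show "gamma_core scal \<gamma> A\<^sub>0 D" using a C by (auto simp: assertion_a_def intro: bi_core_imp_gamma_core)
  fix x assume x: "x \<in> D"
  then have bd: "bounded {the (A n x) | n. x \<in> dom (A n)}"
    and L: "limitin \<tau> (\<lambda>n. the (A n x)) (the (A\<^sub>0 x)) sequentially"
    using a by (auto simp: assertion_a_def)
  obtain k where "x \<in> (\<Inter>n\<in>{k..}. dom (A n))" using subsetD[OF D x] by (rule UN_E)
  then have k: "x \<in> dom (A n)" if "n \<ge> k" for n using that by (rule INT_D[OF _ atLeast_iff[THEN iffD2]])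
  obtain K where "\<forall>y\<in>{the (A n x) | n. x \<in> dom (A n)}. norm y \<le> K" using bd unfolding bounded_iff by blast
  \<comment> \<open>The boundedness in (a) says nothing where x lies outside the domain, which may
    happen for n < k; an eventual bound is enough.\<close>
  then have "norm (the (A n x)) \<le> K" if "n \<ge> k" for n using k[OF that] by blast
  then show "limitin \<gamma> (\<lambda>n. the (A n x)) (the (A\<^sub>0 x)) sequentially"
    by (intro tau_bounded_imp_gamma[OF L, of K]) (auto simp: eventually_sequentially)
qed

text \<open>The limit obtained from (b) is the resolvent of the limit semigroup by uniqueness of
  limits, so \<open>A\<^sub>0\<close> satisfies the equation that describes the graph of the
  generator.\<close>

lemma assertion_b_extension:
  assumes b: "assertion_b scal \<gamma> A l A\<^sub>0 D" and e: "assertion_e scal \<tau> S M \<omega> S\<^sub>0"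
  shows "A\<^sub>0 \<subseteq>\<^sub>m bi_generator \<tau> S\<^sub>0"
    and "x \<in> dom A\<^sub>0 \<Longrightarrow> lap (rescaled \<omega> S\<^sub>0) (l - \<omega>) (l *\<^sub>R x - the (A\<^sub>0 x)) = x"
proof -
  obtain R where R: "\<And>x. limitin \<gamma> (\<lambda>n. Lap n x) (R x) sequentially"
    "\<And>x. x \<in> dom A\<^sub>0 \<Longrightarrow> R (l *\<^sub>R x - the (A\<^sub>0 x)) = x"
    by (rule assertion_b_limit[OF b]) blast
  have eq: "R x = lap (rescaled \<omega> S\<^sub>0) (l - \<omega>) x" for x
    by (rule gamma_limit_unique[OF R(1) L_limit[OF e] sequentially_bot])
  then show *: "x \<in> dom A\<^sub>0 \<Longrightarrow> lap (rescaled \<omega> S\<^sub>0) (l - \<omega>) (l *\<^sub>R x - the (A\<^sub>0 x)) = x" for x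
    using R(2) by simp
  show "A\<^sub>0 \<subseteq>\<^sub>m bi_generator \<tau> S\<^sub>0"
    unfolding map_le_def
  proof
    fix x assume x: "x \<in> dom A\<^sub>0"
    have "bi_generator \<tau> S\<^sub>0 x = Some (the (A\<^sub>0 x))" unfolding B_iff[OF e] by (rule *[OF x])
    then show "A\<^sub>0 x = bi_generator \<tau> S\<^sub>0 x" using x by auto
  qed
qed

text \<open>For minimality, take (y, z) in the graph of the generator and approximate w = l y - z by
  values of l - \<open>A\<^sub>0\<close> at points x. The continuous resolvent brings x close to y,
  then \<open>the (A\<^sub>0 x)\<close> is close to z, and closedness of C puts (y, z) into its
  graph.\<close>

lemma assertion_b_closure:
  assumes b: "assertion_b scal \<gamma> A l A\<^sub>0 D" and e: "assertion_e scal \<tau> S M \<omega> S\<^sub>0"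
  shows "is_gamma_closure scal \<gamma> A\<^sub>0 (bi_generator \<tau> S\<^sub>0)"
  unfolding is_gamma_closure_def smallest_extension_def
proof (intro conjI allI impI B_linear_operator[OF e] B_gamma_closed[OF e] assertion_b_extension(1)[OF b e])
  let ?B = "bi_generator \<tau> S\<^sub>0" and ?R = "lap (rescaled \<omega> S\<^sub>0) (l - \<omega>)"
  note gR = L0_gcont[OF e]
  note linR = gcont_linear[OF gR]
  fix C assume C: "(linear_operator scal C \<and> gamma_closed \<gamma> C) \<and> A\<^sub>0 \<subseteq>\<^sub>m C"
  show "?B \<subseteq>\<^sub>m C"
    unfolding map_le_def
  proof
    fix y assume "y \<in> dom ?B"
    then obtain z where z: "?B y = Some z" by blast
    define w where "w = l *\<^sub>R y - z"
    have Rw: "?R w = y" using z unfolding w_def B_iff[OF e] .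
    have "\<exists>a\<in>dom C. q (a - y) < d \<and> q (the (C a) - z) < d" if q: "q \<in> G" and d: "d > 0" for q d
    proof -
      note sn = G_seminorm[OF q]
      obtain q' where q': "q' \<in> G" "\<And>x. q (?R x) \<le> q' x" using gcontD[OF gR q] by blast
      note sn' = G_seminorm[OF q'(1)]
      define d' where "d' = d / (\<bar>l\<bar> + 2)"
      have "\<bar>l\<bar> + 2 > 0" by simp
      then have d': "d' > 0" "(\<bar>l\<bar> + 2) * d' = d" using d by (simp_all add: d'_def)
      \<comment> \<open>The sum of q and q' controls the approximation of w both directly and after
        the resolvent has been applied.\<close>
      obtain x where x: "x \<in> dom A\<^sub>0" and sm: "q (l *\<^sub>R x - the (A\<^sub>0 x) - w) + q' (l *\<^sub>R x - the (A\<^sub>0 x) - w) < d'"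
      proof -
        have "dense_in_topology \<gamma> (shifted scal (of_real l) A\<^sub>0 ` dom A\<^sub>0)" using b by (simp add: assertion_b_def)
        from this[unfolded dense_gamma_iff, rule_format, OF G_add[OF q q'(1)] d'(1), of w] that
        show thesis by (auto simp: shifted_def scal_of_real)
      qed
      let ?v = "l *\<^sub>R x - the (A\<^sub>0 x) - w"
      have v: "q ?v < d'" "q' ?v < d'"
        using sm seminorm_nonneg[OF sn, of ?v] seminorm_nonneg[OF sn', of ?v] by linarith+
      have "x - y = ?R ?v"
        by (simp only: lin_diff[OF linR, of _ w] assertion_b_extension(2)[OF b e x] Rw)
      then have xy: "q (x - y) < d'" using q'(2)[of ?v] v(2) by simp
      have "the (A\<^sub>0 x) - z = l *\<^sub>R (x - y) - ?v" by (simp add: w_def algebra_simps)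
      then have "q (the (A\<^sub>0 x) - z) \<le> \<bar>l\<bar> * q (x - y) + q ?v"
        using seminorm_diff[OF sn, of "l *\<^sub>R (x - y)" ?v] seminorm_scaleR[OF sn, of l "x - y"] by metis
      also have "\<bar>l\<bar> * q (x - y) \<le> \<bar>l\<bar> * d'" using xy by (intro mult_left_mono) auto
      finally have "q (the (A\<^sub>0 x) - z) < d" using v(1) d' by (simp add: algebra_simps)
      moreover have "q (x - y) < d"
      proof -
        have "\<bar>l\<bar> * d' \<ge> 0" using d'(1) by simp
        moreover have "\<bar>l\<bar> * d' + 2 * d' = d" using d'(2) by (simp add: algebra_simps)
        ultimately show ?thesis using xy d'(1) by linarith
      qed
      ultimately show ?thesis
        using map_le_dom[OF conjunct2[OF C] x] by (intro bexI[of _ x] conjI) simp_all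
    qed
    then have "\<forall>q\<in>G. \<forall>d>0. \<exists>a\<in>dom C. q (a - y) < d \<and> q (the (C a) - z) < d"
      by (intro ballI allI impI)
    moreover have "gamma_closed \<gamma> C" using C by simp
    ultimately have "C y = Some z" unfolding gamma_closed_iff by (elim allE[of _ y] allE[of _ z] impE)
    then show "?B y = C y" using z by simp
  qed
qed

text \<open>The same approximation along sequences: bi-density of the range yields values of l -
  \<open>A\<^sub>0\<close> that \<gamma>-converge to w. Hence their preimages and the images of
  these under \<open>A\<^sub>0\<close> converge and are norm bounded, as bi-closedness
  demands.\<close>

lemma assertion_a_closure:
  assumes a: "assertion_a scal \<tau> P A l A\<^sub>0 D" and e: "assertion_e scal \<tau> S M \<omega> S\<^sub>0"
  shows "is_bi_closure scal \<tau> A\<^sub>0 (bi_generator \<tau> S\<^sub>0)"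
  unfolding is_bi_closure_def smallest_extension_def
proof (intro conjI allI impI B_linear_operator[OF e] B_bi_closed[OF e] assertion_b_extension(1)[OF assertion_a_imp_b[OF a] e])
  let ?B = "bi_generator \<tau> S\<^sub>0" and ?R = "lap (rescaled \<omega> S\<^sub>0) (l - \<omega>)"
  fix C assume C: "(linear_operator scal C \<and> bi_closed \<tau> C) \<and> A\<^sub>0 \<subseteq>\<^sub>m C"
  show "?B \<subseteq>\<^sub>m C"
    unfolding map_le_def
  proof
    fix y assume "y \<in> dom ?B"
    then obtain z where z: "?B y = Some z" by blast
    define w where "w = l *\<^sub>R y - z"
    have Rw: "?R w = y" using z unfolding w_def B_iff[OF e] .
    have "bi_dense \<tau> (shifted scal (of_real l) A\<^sub>0 ` dom A\<^sub>0)" using a by (simp add: assertion_a_def)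
    then obtain s where s: "range s \<subseteq> shifted scal (of_real l) A\<^sub>0 ` dom A\<^sub>0" "limitin \<gamma> s w sequentially"
      unfolding bi_dense_iff by blast
    have "\<exists>x. x \<in> dom A\<^sub>0 \<and> s i = l *\<^sub>R x - the (A\<^sub>0 x)" for i
    proof -
      have "s i \<in> shifted scal (of_real l) A\<^sub>0 ` dom A\<^sub>0" using s(1) by blast
      then show ?thesis by (auto simp: shifted_def scal_of_real)
    qed
    then obtain x where x: "\<And>i. x i \<in> dom A\<^sub>0" "\<And>i. s i = l *\<^sub>R x i - the (A\<^sub>0 (x i))" by metis
    have "?R (s i) = x i" for i
      unfolding x(2) by (rule assertion_b_extension(2)[OF assertion_a_imp_b[OF a] e x(1)])
    then have lx: "limitin \<gamma> x y sequentially" using gcont_limit[OF L0_gcont[OF e] s(2)] by (simp add: Rw)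
    have "limitin \<gamma> (\<lambda>i. l *\<^sub>R x i - s i) (l *\<^sub>R y - w) sequentially"
      by (intro gamma_limit_diff gamma_limit_scaleR lx s(2))
    then have lA: "limitin \<gamma> (\<lambda>i. the (A\<^sub>0 (x i))) z sequentially" by (simp add: x(2) w_def)
    note CA = map_le_dom[OF conjunct2[OF C] x(1)]
    have "range x \<subseteq> dom C \<and> bounded (range x) \<and> bounded (range (\<lambda>i. the (C (x i)))) \<and>
        limitin \<tau> x y sequentially \<and> limitin \<tau> (\<lambda>i. the (C (x i))) z sequentially"
      unfolding CA(2) using lx lA by (intro conjI image_subsetI CA(1)) (simp_all add: gamma_seq_iff)
    moreover have "bi_closed \<tau> C" using C by simp
    ultimately have "y \<in> dom C \<and> the (C y) = z"
      unfolding bi_closed_def by (elim allE[of _ x] allE[of _ y] allE[of _ z] impE)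
    then show "?B y = C y" using z by auto
  qed
qed

end

end

theorem corollary6p20:
  fixes scal :: "'k::real_normed_field \<Rightarrow> 'a::real_normed_vector \<Rightarrow> 'a"
    and \<tau> \<gamma> :: "'a topology"
    and P :: "('a \<Rightarrow> real) set"
    and S :: "nat \<Rightarrow> real \<Rightarrow> 'a \<Rightarrow> 'a"
    and A :: "nat \<Rightarrow> ('a \<rightharpoonup> 'a)"
    and M \<omega> l :: real
  assumes "saks_space scal \<tau> P"
    and "is_mixed_topology scal \<tau> \<gamma>"
    and "sequentially_complete \<gamma>"
    and "C_sequential \<gamma>"
    and "\<And>n. locally_bi_continuous_semigroup scal \<tau> (S n)"
    and "\<And>n. A n = bi_generator \<tau> (S n)"
    and "uniformly_locally_bi_equicontinuous \<tau> S"
    and "M \<ge> 1"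
    and "\<And>n t. t \<ge> 0 \<Longrightarrow> onorm (S n t) \<le> M * exp (\<omega> * t)"
    and "l > \<omega>"
  shows "((\<exists>A\<^sub>0 D. assertion_a scal \<tau> P A l A\<^sub>0 D) \<longrightarrow> (\<exists>A\<^sub>0 D. assertion_b scal \<gamma> A l A\<^sub>0 D))
    \<and> ((\<exists>A\<^sub>0 D. assertion_b scal \<gamma> A l A\<^sub>0 D) \<longrightarrow> (\<exists>R. assertion_c scal \<tau> A l R))
    \<and> ((\<exists>R. assertion_c scal \<tau> A l R) \<longleftrightarrow> (\<exists>R. assertion_d scal \<gamma> A l R))
    \<and> ((\<exists>R. assertion_d scal \<gamma> A l R) \<longleftrightarrow> (\<exists>S\<^sub>0. assertion_e scal \<tau> S M \<omega> S\<^sub>0))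
    \<and> (\<forall>R S\<^sub>0. assertion_c scal \<tau> A l R \<and> assertion_e scal \<tau> S M \<omega> S\<^sub>0 \<longrightarrow>
          of_real l \<in> resolvent_set scal (bi_generator \<tau> S\<^sub>0)
          \<and> resolvent scal (of_real l) (bi_generator \<tau> S\<^sub>0) = R)
    \<and> (\<forall>A\<^sub>0 D. assertion_b scal \<gamma> A l A\<^sub>0 D \<longrightarrow> gamma_closable scal \<gamma> A\<^sub>0
          \<and> (\<forall>S\<^sub>0. assertion_e scal \<tau> S M \<omega> S\<^sub>0 \<longrightarrow>
                is_gamma_closure scal \<gamma> A\<^sub>0 (bi_generator \<tau> S\<^sub>0)))
    \<and> (\<forall>A\<^sub>0 D S\<^sub>0. assertion_a scal \<tau> P A l A\<^sub>0 D \<and> assertion_e scal \<tau> S M \<omega> S\<^sub>0 \<longrightarrow>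
          is_bi_closure scal \<tau> A\<^sub>0 (bi_generator \<tau> S\<^sub>0))"
proof -
  interpret normed_space scal using assms(1) by (simp add: saks_space_def)
  interpret mixed_saks_space scal \<tau> \<gamma> P by unfold_locales (rule assms)+
  note as = assms(5-10)
  have M: "M \<ge> 0" using assms(8) by simp
  let ?L = "\<lambda>n. lap (rescaled \<omega> (S n)) (l - \<omega>)"
  \<comment> \<open>In (c) the resolvents converge for \<tau>; their uniform norm bound makes the
    limit a \<gamma>-limit.\<close>
  have ce: "\<exists>S\<^sub>0. assertion_e scal \<tau> S M \<omega> S\<^sub>0" if c: "assertion_c scal \<tau> A l R" for R
  proof (rule assertion_eI[OF as])
    show "limitin \<gamma> (\<lambda>n. ?L n x) (R x) sequentially" for x
    proof (rule tau_bounded_imp_gamma)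
      show "limitin \<tau> (\<lambda>n. ?L n x) (R x) sequentially"
        using c by (simp add: assertion_c_def A_resolvent(2)[OF as])
      show "\<forall>\<^sub>F n in sequentially. norm (?L n x) \<le> M / (l - \<omega>) * norm x"
        by (rule always_eventually, rule allI, rule L_norm[OF as])
    qed
    show "dense_in_topology \<gamma> (range R)" using c by (simp add: assertion_c_def bi_dense_imp_dense)
  qed
  have de: "\<exists>S\<^sub>0. assertion_e scal \<tau> S M \<omega> S\<^sub>0" if d: "assertion_d scal \<gamma> A l R" for R
  proof (rule assertion_eI[OF as])
    show "limitin \<gamma> (\<lambda>n. ?L n x) (R x) sequentially" for x
      using d by (simp add: assertion_d_def A_resolvent(2)[OF as])
    show "dense_in_topology \<gamma> (range R)" using d by (simp add: assertion_d_def)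
  qed
  have be: "\<exists>S\<^sub>0. assertion_e scal \<tau> S M \<omega> S\<^sub>0" if b: "assertion_b scal \<gamma> A l A\<^sub>0 D" for A\<^sub>0 D
  proof -
    obtain R where R: "\<And>x. limitin \<gamma> (\<lambda>n. ?L n x) (R x) sequentially" "dense_in_topology \<gamma> (range R)"
      by (rule assertion_b_limit[OF as b], assumption) (rule that)
    show ?thesis by (rule assertion_eI[OF as R])
  qed
  have ec: "\<exists>R. assertion_c scal \<tau> A l R" and ed: "\<exists>R. assertion_d scal \<gamma> A l R"
    if "assertion_e scal \<tau> S M \<omega> S\<^sub>0" for S\<^sub>0
    using assertion_c_lap[OF as that] assertion_d_lap[OF as that] by blast+
  have res: "of_real l \<in> resolvent_set scal (bi_generator \<tau> S\<^sub>0)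
      \<and> resolvent scal (of_real l) (bi_generator \<tau> S\<^sub>0) = R"
    if c: "assertion_c scal \<tau> A l R" and e: "assertion_e scal \<tau> S M \<omega> S\<^sub>0" for R S\<^sub>0
  proof -
    note S0 = S0[OF as e]
    have "R x = lap (rescaled \<omega> S\<^sub>0) (l - \<omega>) x" for x
    proof (rule tau_limit_unique[OF _ gamma_imp_tau[OF L_limit[OF as e]] sequentially_bot])
      show "limitin \<tau> (\<lambda>n. ?L n x) (R x) sequentially"
        using c by (simp add: assertion_c_def A_resolvent(2)[OF as])
    qed
    then show ?thesis using generator_resolvent[OF S0 M assms(10)] by auto
  qed
  \<comment> \<open>The closed extension that witnesses closability is the generator of the limit
    semigroup, so (e) is derived first.\<close>
  have closable: "gamma_closable scal \<gamma> A\<^sub>0" if b: "assertion_b scal \<gamma> A l A\<^sub>0 D" for A\<^sub>0 D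
  proof -
    obtain S\<^sub>0 where "assertion_e scal \<tau> S M \<omega> S\<^sub>0" using be[OF b] by blast
    from assertion_b_closure[OF as b this] show ?thesis
      unfolding gamma_closable_def is_gamma_closure_def smallest_extension_def by blast
  qed
  show ?thesis
  proof (intro conjI)
    show "(\<exists>A\<^sub>0 D. assertion_a scal \<tau> P A l A\<^sub>0 D) \<longrightarrow> (\<exists>A\<^sub>0 D. assertion_b scal \<gamma> A l A\<^sub>0 D)"
      using assertion_a_imp_b[OF as] by blast
    show "(\<exists>A\<^sub>0 D. assertion_b scal \<gamma> A l A\<^sub>0 D) \<longrightarrow> (\<exists>R. assertion_c scal \<tau> A l R)"
      using be ec by blast
    show "(\<exists>R. assertion_c scal \<tau> A l R) \<longleftrightarrow> (\<exists>R. assertion_d scal \<gamma> A l R)"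
      using ce de ec ed by blast
    show "(\<exists>R. assertion_d scal \<gamma> A l R) \<longleftrightarrow> (\<exists>S\<^sub>0. assertion_e scal \<tau> S M \<omega> S\<^sub>0)"
      using de ed by blast
  qed (use res closable assertion_b_closure[OF as] assertion_a_closure[OF as] in blast)+
qed

end
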